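(* Let $G$ be a finite group acting on $V$, let $\gimel\subset V$ be a $G$-invariant subgroup, $v\in V$, and let $\mathcal A\subset\mathcal S(\gimel)$ be a subalgebra that preserves the vector space $\mathfrak O^{G}|_{(G\ltimes\gimel)\cdot v/G}$. Then both $M(G,(G\ltimes\gimel)\cdot v)$ and $M^*(G,(G\ltimes\gimel)\cdot v)$ are $\mathcal A$-modules: the first with the action induced from $\mathfrak O^{G}|_{(G\ltimes\gimel)\cdot v/G}$, the second with the dual action $(A(\alpha))(F)=\alpha(A(F))$ (which makes it a right $\mathcal A$-module).
   Context: Fix one of two categories, complex-analytic or algebraic. $V$ is a complex Lie group (resp. a complex linear algebraic group) with identity $e$, and the finite group $G$ acts on $V$ by holomorphic (resp. algebraic) group automorphisms, written $g\cdot v=gvg^{-1}$ in $G\ltimes V$. $\mathcal O$ is the structure sheaf of $V$ (holomorphic, resp. polynomial functions), $\mathcal M$ is the sheaf of meromorphic (resp. rational) functions, and $\mathcal O_x,\mathcal M_x$ are the algebras of germs at $x$. For $\xi\in V$, $\phi_\xi$ is left translation $x\mapsto \xi x$; it acts on germs by $\phi_\xi(f)(x)=f(\xi^{-1}x)$, so $\phi_\xi:\mathcal M_x\to\mathcal M_{\xi x}$. Also $(g\cdot f)(x)=f(g^{-1}\cdot x)$, so $g:\mathcal M_x\to\mathcal M_{g\cdot x}$. $\mathcal S(\gimel)$ is the skew-group ring of finite sums $\sum_i f_i\phi_{\xi_i}$ with $f_i$ a global meromorphic (resp. rational) function on $V$ and $\xi_i\in\gimel$, with product $f\phi_\xi\circ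 f'\phi_{\xi'}=f\,\phi_\xi(f')\,\phi_{\xi\xi'}$. It acts on $\mathfrak M=\bigoplus_{x\in V}\mathcal M_x$ by $f\phi_\xi:\mathcal M_x\to\mathcal M_{\xi x}$, $F\mapsto f\,\phi_\xi(F)$. For a $G$-orbit $\bar x\subset V$ put $\mathcal O^G_{\bar x}=\big(\bigoplus_{x'\in\bar x}\mathcal O_{x'}\big)^G$, and for a $G$-invariant $W\subset V$ put $\mathfrak O^G|_{W/G}=\bigoplus_{\bar x\in W/G}\mathcal O^G_{\bar x}\subset\mathfrak M$. $(G\ltimes\gimel)\cdot v=\{g\cdot(\xi v): g\in G,\xi\in\gimel\}$. A subalgebra $\mathcal A$ preserves a subspace of $\mathfrak M$ if each of its elements maps the subspace to itself. For $\xi\in V$ let $G_\xi$ be its stabilizer in $G$ and let $\mathcal O^G_\xi=\mathcal O_\xi^{G_\xi}=\phi_\xi(\mathcal O_e^{G_\xi})$. Let $\mathcal J_e\subset\mathcal O_e$ be the ideal generated by the $G$-invariant germs at $e$ that vanish at $e$. Put $\mathbb E_\xi=\mathcal O^G_\xi/\phi_\xi(\mathcal O_e^{G_\xi}\cap\mathcal J_e)$ and, for an orbit $\bar\xi$, $\mathbb E^G_{\bar\xi}=\big(\bigoplus_{\xi'\in\bar\xi}\mathbb E_{\xi'}\big)^G$, a quotient of $\mathcal O^G_{\bar\xi}$. For $G$-invariant $W\subset V$, $$M(G,W)=\bigoplus_{\bar\xi\in W/G}\mathbb E^G_{\bar\xi},\qquad M^*(G,W)=\bigoplus_{\bar\xi\in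 W/G}(\mathbb E^G_{\bar\xi})^*,$$ where $(\cdot)^*$ is the linear dual; $M(G,W)$ is a quotient of $\mathfrak O^G|_{W/G}$ and $M^*(G,W)$ is a subspace of $M(G,W)^*$. *)

theory Defs
  imports
    "HOL-Analysis.Analysis"
    "HOL-Algebra.Group_Action"
    "HOL-Algebra.QuotRing"
    "Jordan_Normal_Form.Matrix"
begin

section \<open>Groups with a structure sheaf\<close>

text \<open>
  Both categories are handled through groups that carry a topology and a sheaf of
  complex-valued functions. A section over an open set \<open>U\<close> is represented by a total function;
  only its values on \<open>U\<close> matter, and \<open>sections\<close> is only meaningful on open sets.
\<close>

record 'v sgroup = "'v monoid" +
  topo :: "'v topology"
  sections :: "'v set \<Rightarrow> ('v \<Rightarrow> complex) set"

definition morphism :: "('v, 'z) sgroup_scheme \<Rightarrow> ('v \<Rightarrow> 'v) \<Rightarrow> bool" where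
  "morphism V s \<longleftrightarrow> continuous_map (topo V) (topo V) s \<and>
     (\<forall>U. \<forall>f\<in>sections V U. openin (topo V) U \<longrightarrow>
        (\<lambda>x. f (s x)) \<in> sections V {x \<in> topspace (topo V). s x \<in> U})"


subsection \<open>Complex Lie groups\<close>

text \<open>
  Coordinate space of dimension \<open>n\<close>, realised on extensional functions on \<open>{..<n}\<close>
  so that \<open>n\<close> can be any natural number, \<open>0\<close> included.
\<close>

definition Cspace :: "nat \<Rightarrow> (nat \<Rightarrow> complex) topology" where
  "Cspace n = product_topology (\<lambda>_. euclidean) {..<n}"

text \<open>Complex (Frechet) differentiability at every point of \<open>U\<close>; used for open \<open>U\<close> only.\<close>

definition holomorphic_Cn ::
    "nat \<Rightarrow> (nat \<Rightarrow> complex) set \<Rightarrow> ((nat \<Rightarrow> complex) \<Rightarrow> complex) \<Rightarrow> bool" where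
  "holomorphic_Cn n U f \<longleftrightarrow>
     (\<forall>a\<in>U. \<exists>c. ((\<lambda>z. (f z - f a - (\<Sum>i<n. c i * (z i - a i)))
                     / complex_of_real (L2_set (\<lambda>i. cmod (z i - a i)) {..<n})) \<longlongrightarrow> 0)
                (atin (Cspace n) a))"

type_synonym 'v chart = "'v set \<times> ('v \<Rightarrow> nat \<Rightarrow> complex)"

definition complex_atlas :: "nat \<Rightarrow> 'v topology \<Rightarrow> 'v chart set \<Rightarrow> bool" where
  "complex_atlas n T \<A> \<longleftrightarrow>
     (\<Union>(C, \<phi>)\<in>\<A>. C) = topspace T \<and>
     (\<forall>(C, \<phi>)\<in>\<A>. openin T C \<and> openin (Cspace n) (\<phi> ` C) \<and>
        homeomorphic_map (subtopology T C) (subtopology (Cspace n) (\<phi> ` C)) \<phi>) \<and>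
     (\<forall>(C, \<phi>)\<in>\<A>. \<forall>(D, \<psi>)\<in>\<A>. \<forall>i<n.
        holomorphic_Cn n (\<phi> ` (C \<inter> D)) (\<lambda>z. \<psi> (inv_into C \<phi> z) i))"

definition holomorphic_sections :: "nat \<Rightarrow> 'v chart set \<Rightarrow> 'v set \<Rightarrow> ('v \<Rightarrow> complex) set" where
  "holomorphic_sections n \<A> U =
     {f. \<forall>(C, \<phi>)\<in>\<A>. holomorphic_Cn n (\<phi> ` (C \<inter> U)) (\<lambda>z. f (inv_into C \<phi> z))}"

text \<open>
  Holomorphy of the multiplication is expressed in the product charts of \<open>V \<times> V\<close>: a point \<open>t\<close> of
  \<open>2n\<close>-dimensional coordinate space is split into its first and last \<open>n\<close> coordinates, and
  sections are pulled back.
\<close>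

definition holomorphic_mult :: "nat \<Rightarrow> ('v, 'z) sgroup_scheme \<Rightarrow> 'v chart set \<Rightarrow> bool" where
  "holomorphic_mult n V \<A> \<longleftrightarrow>
     continuous_map (prod_topology (topo V) (topo V)) (topo V) (\<lambda>(x, y). x \<otimes>\<^bsub>V\<^esub> y) \<and>
     (\<forall>(C, \<phi>)\<in>\<A>. \<forall>(D, \<psi>)\<in>\<A>. \<forall>U. \<forall>f\<in>sections V U. openin (topo V) U \<longrightarrow>
        (let p = (\<lambda>t. inv_into C \<phi> (\<lambda>i\<in>{..<n}. t i));
             q = (\<lambda>t. inv_into D \<psi> (\<lambda>i\<in>{..<n}. t (n + i)))
         in holomorphic_Cn (2 * n)
              {t \<in> topspace (Cspace (2 * n)).
                 (\<lambda>i\<in>{..<n}. t i) \<in> \<phi> ` C \<and> (\<lambda>i\<in>{..<n}. t (n + i)) \<in> \<psi> ` D \<and>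
                 p t \<otimes>\<^bsub>V\<^esub> q t \<in> U}
              (\<lambda>t. f (p t \<otimes>\<^bsub>V\<^esub> q t))))"

text \<open>Second countability is not required.\<close>

definition complex_lie_group :: "('v, 'z) sgroup_scheme \<Rightarrow> bool" where
  "complex_lie_group V \<longleftrightarrow>
     group V \<and> topspace (topo V) = carrier V \<and> Hausdorff_space (topo V) \<and>
     (\<exists>n \<A>. complex_atlas n (topo V) \<A> \<and>
        (\<forall>U. openin (topo V) U \<longrightarrow> sections V U = holomorphic_sections n \<A> U) \<and>
        holomorphic_mult n V \<A>) \<and>
     morphism V (\<lambda>x. inv\<^bsub>V\<^esub> x)"


subsection \<open>Complex linear algebraic groups\<close>

definition GL :: "nat \<Rightarrow> complex mat monoid" where
  "GL n = units_of (ring_mat TYPE(complex) n ())"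

inductive_set poly_funs :: "nat \<Rightarrow> (complex mat \<Rightarrow> complex) set" for n where
  const: "(\<lambda>_. c) \<in> poly_funs n"
| entry: "i < n \<Longrightarrow> j < n \<Longrightarrow> (\<lambda>A. A $$ (i, j)) \<in> poly_funs n"
| add: "p \<in> poly_funs n \<Longrightarrow> q \<in> poly_funs n \<Longrightarrow> (\<lambda>A. p A + q A) \<in> poly_funs n"
| mult: "p \<in> poly_funs n \<Longrightarrow> q \<in> poly_funs n \<Longrightarrow> (\<lambda>A. p A * q A) \<in> poly_funs n"

text \<open>
  A group identified by \<open>\<rho>\<close> with a Zariski closed subgroup of some \<open>GL n\<close>, with the Zariski
  topology and the sheaf of regular functions, i.e. locally quotients of polynomial functions
  (over the whole group: polynomials in the matrix entries and the inverse of the determinant).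
\<close>

definition linear_algebraic_group :: "('v, 'z) sgroup_scheme \<Rightarrow> bool" where
  "linear_algebraic_group V \<longleftrightarrow> group V \<and>
     (\<exists>n \<rho>. \<rho> \<in> hom V (GL n) \<and> inj_on \<rho> (carrier V) \<and>
        (\<exists>P \<subseteq> poly_funs n. \<rho> ` carrier V = {A \<in> carrier (GL n). \<forall>p\<in>P. p A = 0}) \<and>
        (\<forall>U. openin (topo V) U \<longleftrightarrow>
           (\<exists>P \<subseteq> poly_funs n. U = {x \<in> carrier V. \<exists>p\<in>P. p (\<rho> x) \<noteq> 0})) \<and>
        (\<forall>U. openin (topo V) U \<longrightarrow> sections V U =
           {f. \<forall>x\<in>U. \<exists>p\<in>poly_funs n. \<exists>q\<in>poly_funs n. \<exists>U'. openin (topo V) U' \<and> x \<in> U' \<and> U' \<subseteq> U \<and>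
                 (\<forall>y\<in>U'. q (\<rho> y) \<noteq> 0 \<and> f y = p (\<rho> y) / q (\<rho> y))}))"


section \<open>Germs of regular and meromorphic functions\<close>

definition near :: "('v, 'z) sgroup_scheme \<Rightarrow> 'v \<Rightarrow> ('v \<Rightarrow> bool) \<Rightarrow> bool" where
  "near V x P \<longleftrightarrow> (\<exists>U. openin (topo V) U \<and> x \<in> U \<and> (\<forall>y\<in>U. P y))"

definition regular_at :: "('v, 'z) sgroup_scheme \<Rightarrow> 'v \<Rightarrow> ('v \<Rightarrow> complex) \<Rightarrow> bool" where
  "regular_at V x f \<longleftrightarrow> (\<exists>U. openin (topo V) U \<and> x \<in> U \<and> f \<in> sections V U)"

text \<open>The germ of \<open>b\<close> at \<open>x\<close> is not a zero divisor.\<close>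

definition nonzerodiv_at :: "('v, 'z) sgroup_scheme \<Rightarrow> 'v \<Rightarrow> ('v \<Rightarrow> complex) \<Rightarrow> bool" where
  "nonzerodiv_at V x b \<longleftrightarrow> regular_at V x b \<and>
     (\<forall>a. regular_at V x a \<and> near V x (\<lambda>y. b y * a y = 0) \<longrightarrow> near V x (\<lambda>y. a y = 0))"

text \<open>
  The stalk \<open>\<M>\<^sub>x\<close> is the total ring of fractions of the stalk \<open>\<O>\<^sub>x\<close> (its field of fractions,
  since the stalks of holomorphic or regular functions are domains): \<open>mfrac V x a b\<close> is the class
  of the fraction \<open>a / b\<close>. The stalk \<open>\<O>\<^sub>x\<close> is identified with the subring of the fractions
  \<open>a / 1\<close>.
\<close>

type_synonym 'v mgerm = "(('v \<Rightarrow> complex) \<times> ('v \<Rightarrow> complex)) set"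

definition mfrac ::
    "('v, 'z) sgroup_scheme \<Rightarrow> 'v \<Rightarrow> ('v \<Rightarrow> complex) \<Rightarrow> ('v \<Rightarrow> complex) \<Rightarrow> 'v mgerm" where
  "mfrac V x a b =
     {(c, d). regular_at V x c \<and> nonzerodiv_at V x d \<and> near V x (\<lambda>y. a y * d y = c y * b y)}"

definition mer_stalk :: "('v, 'z) sgroup_scheme \<Rightarrow> 'v \<Rightarrow> 'v mgerm ring" where
  "mer_stalk V x = \<lparr>
     carrier = {mfrac V x a b | a b. regular_at V x a \<and> nonzerodiv_at V x b},
     monoid.mult = (\<lambda>P Q. \<Union>(a, b)\<in>P. \<Union>(c, d)\<in>Q. mfrac V x (\<lambda>y. a y * c y) (\<lambda>y. b y * d y)),
     one = mfrac V x (\<lambda>_. 1) (\<lambda>_. 1),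
     ring.zero = mfrac V x (\<lambda>_. 0) (\<lambda>_. 1),
     ring.add = (\<lambda>P Q. \<Union>(a, b)\<in>P. \<Union>(c, d)\<in>Q. mfrac V x (\<lambda>y. a y * d y + c y * b y) (\<lambda>y. b y * d y))\<rparr>"

definition reg_stalk :: "('v, 'z) sgroup_scheme \<Rightarrow> 'v \<Rightarrow> 'v mgerm ring" where
  "reg_stalk V x = (mer_stalk V x)\<lparr>carrier := {mfrac V x a (\<lambda>_. 1) | a. regular_at V x a}\<rparr>"

definition mconst :: "('v, 'z) sgroup_scheme \<Rightarrow> 'v \<Rightarrow> complex \<Rightarrow> 'v mgerm" where
  "mconst V x c = mfrac V x (\<lambda>_. c) (\<lambda>_. 1)"

text \<open>
  Pull-back along \<open>s\<close> of a germ at \<open>s x\<close> to a germ at \<open>x\<close>. Translation \<open>\<phi>\<^sub>\<xi>\<close> is pull-back along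
  \<open>y \<mapsto> \<xi>\<^sup>-\<^sup>1 y\<close>, and the action of \<open>g\<close> is pull-back along \<open>y \<mapsto> g\<^sup>-\<^sup>1 \<cdot> y\<close>.
\<close>

definition mpull ::
    "('v, 'z) sgroup_scheme \<Rightarrow> ('v \<Rightarrow> 'v) \<Rightarrow> 'v \<Rightarrow> 'v mgerm \<Rightarrow> 'v mgerm" where
  "mpull V s x P = (\<Union>(a, b)\<in>P. mfrac V x (\<lambda>y. a (s y)) (\<lambda>y. b (s y)))"

text \<open>\<open>\<phi>\<^sub>\<xi> : \<M>\<^sub>x \<rightarrow> \<M>\<^bsub>\<xi>x\<^esub>\<close> and \<open>g : \<M>\<^sub>x \<rightarrow> \<M>\<^bsub>g\<cdot>x\<^esub>\<close>.\<close>

definition germ_trans :: "('v, 'z) sgroup_scheme \<Rightarrow> 'v \<Rightarrow> 'v \<Rightarrow> 'v mgerm \<Rightarrow> 'v mgerm" where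
  "germ_trans V \<xi> x = mpull V (\<lambda>y. inv\<^bsub>V\<^esub> \<xi> \<otimes>\<^bsub>V\<^esub> y) (\<xi> \<otimes>\<^bsub>V\<^esub> x)"

definition germ_act ::
    "('v, 'z) sgroup_scheme \<Rightarrow> ('g, 'y) monoid_scheme \<Rightarrow> ('g \<Rightarrow> 'v \<Rightarrow> 'v) \<Rightarrow>
     'g \<Rightarrow> 'v \<Rightarrow> 'v mgerm \<Rightarrow> 'v mgerm" where
  "germ_act V G act g x = mpull V (act (inv\<^bsub>G\<^esub> g)) (act g x)"

text \<open>
  \<open>\<phi>\<^sub>\<xi>\<close> on families of germs indexed by the points of \<open>V\<close>. Both global meromorphic functions and
  the elements of \<open>\<MM>\<close>, the direct sum of all the stalks \<open>\<M>\<^sub>x\<close> (finitely supported families), are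
  such families.
\<close>

definition family_trans ::
    "('v, 'z) sgroup_scheme \<Rightarrow> 'v \<Rightarrow> ('v \<Rightarrow> 'v mgerm) \<Rightarrow> 'v \<Rightarrow> 'v mgerm" where
  "family_trans V \<xi> F =
     (\<lambda>x\<in>carrier V. germ_trans V \<xi> (inv\<^bsub>V\<^esub> \<xi> \<otimes>\<^bsub>V\<^esub> x) (F (inv\<^bsub>V\<^esub> \<xi> \<otimes>\<^bsub>V\<^esub> x)))"

text \<open>
  Global sections of the sheaf \<open>\<M>\<close>: families of germs that are locally given by a fraction whose
  denominator is nowhere a zero divisor.
\<close>

definition mer_fun :: "('v, 'z) sgroup_scheme \<Rightarrow> ('v \<Rightarrow> 'v mgerm) ring" where
  "mer_fun V = \<lparr>
     carrier = {f \<in> extensional (carrier V). \<forall>x\<in>carrier V. \<exists>U a b.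
       openin (topo V) U \<and> x \<in> U \<and> a \<in> sections V U \<and> b \<in> sections V U \<and>
       (\<forall>y\<in>U. nonzerodiv_at V y b \<and> f y = mfrac V y a b)},
     monoid.mult = (\<lambda>f h. \<lambda>x\<in>carrier V. f x \<otimes>\<^bsub>mer_stalk V x\<^esub> h x),
     one = (\<lambda>x\<in>carrier V. \<one>\<^bsub>mer_stalk V x\<^esub>),
     ring.zero = (\<lambda>x\<in>carrier V. \<zero>\<^bsub>mer_stalk V x\<^esub>),
     ring.add = (\<lambda>f h. \<lambda>x\<in>carrier V. f x \<oplus>\<^bsub>mer_stalk V x\<^esub> h x)\<rparr>"


section \<open>The skew-group ring\<close>

text \<open>
  The sum of the \<open>f\<^sub>i \<phi>\<^bsub>\<xi>\<^sub>i\<^esub>\<close> is the finitely supported function on \<open>\<Gamma>\<close> with value \<open>f\<^sub>i\<close> at \<open>\<xi>\<^sub>i\<close>.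
  The product of \<open>A\<close> and \<open>B\<close> has at \<open>\<zeta>\<close> the sum of all \<open>A \<xi> * \<phi>\<^sub>\<xi> (B \<eta>)\<close> with \<open>\<xi> \<eta> = \<zeta>\<close>.
\<close>

definition skew_support ::
    "('v, 'z) sgroup_scheme \<Rightarrow> 'v set \<Rightarrow> ('v \<Rightarrow> 'v \<Rightarrow> 'v mgerm) \<Rightarrow> 'v set" where
  "skew_support V \<Gamma> A = {\<xi> \<in> \<Gamma>. A \<xi> \<noteq> \<zero>\<^bsub>mer_fun V\<^esub>}"

definition skew_ring ::
    "('v, 'z) sgroup_scheme \<Rightarrow> 'v set \<Rightarrow> (complex, 'v \<Rightarrow> 'v \<Rightarrow> 'v mgerm) module" where
  "skew_ring V \<Gamma> = \<lparr>
     carrier = {A \<in> \<Gamma> \<rightarrow>\<^sub>E carrier (mer_fun V). finite (skew_support V \<Gamma> A)},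
     monoid.mult = (\<lambda>A B. \<lambda>\<zeta>\<in>\<Gamma>. \<Oplus>\<^bsub>mer_fun V\<^esub>\<xi>\<in>skew_support V \<Gamma> A.
               A \<xi> \<otimes>\<^bsub>mer_fun V\<^esub> family_trans V \<xi> (B (inv\<^bsub>V\<^esub> \<xi> \<otimes>\<^bsub>V\<^esub> \<zeta>))),
     one = (\<lambda>\<xi>\<in>\<Gamma>. if \<xi> = \<one>\<^bsub>V\<^esub> then \<one>\<^bsub>mer_fun V\<^esub> else \<zero>\<^bsub>mer_fun V\<^esub>),
     ring.zero = (\<lambda>\<xi>\<in>\<Gamma>. \<zero>\<^bsub>mer_fun V\<^esub>),
     ring.add = (\<lambda>A B. \<lambda>\<xi>\<in>\<Gamma>. A \<xi> \<oplus>\<^bsub>mer_fun V\<^esub> B \<xi>),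
     smult = (\<lambda>c A. \<lambda>\<xi>\<in>\<Gamma>. (\<lambda>x\<in>carrier V. mconst V x c) \<otimes>\<^bsub>mer_fun V\<^esub> A \<xi>)\<rparr>"

text \<open>\<open>f \<phi>\<^sub>\<xi>\<close> maps a germ \<open>F\<close> at \<open>\<xi>\<^sup>-\<^sup>1 x\<close> to the germ \<open>f \<phi>\<^sub>\<xi>(F)\<close> at \<open>x\<close>.\<close>

definition skew_act ::
    "('v, 'z) sgroup_scheme \<Rightarrow> 'v set \<Rightarrow> ('v \<Rightarrow> 'v \<Rightarrow> 'v mgerm) \<Rightarrow>
     ('v \<Rightarrow> 'v mgerm) \<Rightarrow> 'v \<Rightarrow> 'v mgerm" where
  "skew_act V \<Gamma> A F = (\<lambda>x\<in>carrier V. \<Oplus>\<^bsub>mer_stalk V x\<^esub>\<xi>\<in>skew_support V \<Gamma> A.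
     A \<xi> x \<otimes>\<^bsub>mer_stalk V x\<^esub> family_trans V \<xi> F x)"

text \<open>
  Complex subalgebras. They need not contain the unit; if they do, modules over them are required
  to be unital.
\<close>

definition is_subalgebra :: "(complex, 'a) module \<Rightarrow> 'a set \<Rightarrow> bool" where
  "is_subalgebra S \<A> \<longleftrightarrow> \<A> \<subseteq> carrier S \<and> \<zero>\<^bsub>S\<^esub> \<in> \<A> \<and>
     (\<forall>A\<in>\<A>. \<forall>B\<in>\<A>. A \<oplus>\<^bsub>S\<^esub> B \<in> \<A> \<and> A \<otimes>\<^bsub>S\<^esub> B \<in> \<A>) \<and>
     (\<forall>c. \<forall>A\<in>\<A>. c \<odot>\<^bsub>S\<^esub> A \<in> \<A>)"

definition complex_ring :: "complex ring" where
  "complex_ring = \<lparr>carrier = UNIV, monoid.mult = (*), one = 1, ring.zero = 0, ring.add = (+)\<rparr>"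

text \<open>\<open>\<mu> A m\<close> is the result of letting \<open>A\<close> act on \<open>m\<close>.\<close>

definition bilinear_action ::
    "(complex, 'a) module \<Rightarrow> 'a set \<Rightarrow> (complex, 'm) module \<Rightarrow> ('a \<Rightarrow> 'm \<Rightarrow> 'm) \<Rightarrow> bool" where
  "bilinear_action S \<A> M \<mu> \<longleftrightarrow>
     (\<forall>A\<in>\<A>. \<forall>m\<in>carrier M. \<mu> A m \<in> carrier M) \<and>
     (\<forall>A\<in>\<A>. \<forall>m\<in>carrier M. \<forall>m'\<in>carrier M. \<mu> A (m \<oplus>\<^bsub>M\<^esub> m') = \<mu> A m \<oplus>\<^bsub>M\<^esub> \<mu> A m') \<and>
     (\<forall>A\<in>\<A>. \<forall>B\<in>\<A>. \<forall>m\<in>carrier M. \<mu> (A \<oplus>\<^bsub>S\<^esub> B) m = \<mu> A m \<oplus>\<^bsub>M\<^esub> \<mu> B m) \<and>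
     (\<forall>c. \<forall>A\<in>\<A>. \<forall>m\<in>carrier M. \<mu> A (c \<odot>\<^bsub>M\<^esub> m) = c \<odot>\<^bsub>M\<^esub> \<mu> A m \<and>
                               \<mu> (c \<odot>\<^bsub>S\<^esub> A) m = c \<odot>\<^bsub>M\<^esub> \<mu> A m) \<and>
     (\<one>\<^bsub>S\<^esub> \<in> \<A> \<longrightarrow> (\<forall>m\<in>carrier M. \<mu> \<one>\<^bsub>S\<^esub> m = m))"

definition left_module ::
    "(complex, 'a) module \<Rightarrow> 'a set \<Rightarrow> (complex, 'm) module \<Rightarrow> ('a \<Rightarrow> 'm \<Rightarrow> 'm) \<Rightarrow> bool" where
  "left_module S \<A> M \<mu> \<longleftrightarrow> module complex_ring M \<and> bilinear_action S \<A> M \<mu> \<and>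
     (\<forall>A\<in>\<A>. \<forall>B\<in>\<A>. \<forall>m\<in>carrier M. \<mu> (A \<otimes>\<^bsub>S\<^esub> B) m = \<mu> A (\<mu> B m))"

definition right_module ::
    "(complex, 'a) module \<Rightarrow> 'a set \<Rightarrow> (complex, 'm) module \<Rightarrow> ('a \<Rightarrow> 'm \<Rightarrow> 'm) \<Rightarrow> bool" where
  "right_module S \<A> M \<mu> \<longleftrightarrow> module complex_ring M \<and> bilinear_action S \<A> M \<mu> \<and>
     (\<forall>A\<in>\<A>. \<forall>B\<in>\<A>. \<forall>m\<in>carrier M. \<mu> (A \<otimes>\<^bsub>S\<^esub> B) m = \<mu> B (\<mu> A m))"


section \<open>Direct sums indexed by the points of the group\<close>

definition direct_sum :: "'v set \<Rightarrow> ('v \<Rightarrow> 'a ring) \<Rightarrow> ('v \<Rightarrow> 'a) set" where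
  "direct_sum I R = {F \<in> (\<Pi>\<^sub>E x\<in>I. carrier (R x)). finite {x \<in> I. F x \<noteq> \<zero>\<^bsub>R x\<^esub>}}"

definition component :: "'v set \<Rightarrow> ('v \<Rightarrow> 'a ring) \<Rightarrow> 'v set \<Rightarrow> ('v \<Rightarrow> 'a) \<Rightarrow> 'v \<Rightarrow> 'a" where
  "component I R X F = (\<lambda>x\<in>I. if x \<in> X then F x else \<zero>\<^bsub>R x\<^esub>)"

definition supported_in :: "'v set \<Rightarrow> ('v \<Rightarrow> 'a ring) \<Rightarrow> 'v set \<Rightarrow> ('v \<Rightarrow> 'a) \<Rightarrow> bool" where
  "supported_in I R X F \<longleftrightarrow> (\<forall>x\<in>I - X. F x = \<zero>\<^bsub>R x\<^esub>)"

text \<open>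
  The internal direct sum, inside \<open>direct_sum I R\<close>, of subspaces \<open>D X\<close> for \<open>X \<in> \<X>\<close>, where \<open>\<X>\<close> is a
  set of disjoint subsets of \<open>I\<close> and the elements of \<open>D X\<close> are supported in \<open>X\<close>.
\<close>

definition internal_sum ::
    "'v set \<Rightarrow> ('v \<Rightarrow> 'a ring) \<Rightarrow> 'v set set \<Rightarrow> ('v set \<Rightarrow> ('v \<Rightarrow> 'a) set) \<Rightarrow> ('v \<Rightarrow> 'a) set" where
  "internal_sum I R \<X> D =
     {F \<in> direct_sum I R. supported_in I R (\<Union>\<X>) F \<and> (\<forall>X\<in>\<X>. component I R X F \<in> D X)}"

text \<open>
  A subspace \<open>C\<close> of \<open>direct_sum I R\<close> as a complex vector space; \<open>k x c\<close> is the image of the scalar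
  \<open>c\<close> in the ring \<open>R x\<close>.
\<close>

definition family_space ::
    "'v set \<Rightarrow> ('v \<Rightarrow> 'a ring) \<Rightarrow> ('v \<Rightarrow> complex \<Rightarrow> 'a) \<Rightarrow> ('v \<Rightarrow> 'a) set \<Rightarrow>
     (complex, 'v \<Rightarrow> 'a) module" where
  "family_space I R k C = \<lparr>
     carrier = C,
     monoid.mult = undefined,
     one = undefined,
     ring.zero = (\<lambda>x\<in>I. \<zero>\<^bsub>R x\<^esub>),
     ring.add = (\<lambda>F H. \<lambda>x\<in>I. F x \<oplus>\<^bsub>R x\<^esub> H x),
     smult = (\<lambda>c F. \<lambda>x\<in>I. k x c \<otimes>\<^bsub>R x\<^esub> F x)\<rparr>"

definition zero_functional :: "(complex, 'm) module \<Rightarrow> 'm \<Rightarrow> complex" where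
  "zero_functional M = (\<lambda>m\<in>carrier M. 0)"

definition linear_dual :: "(complex, 'm) module \<Rightarrow> ('m \<Rightarrow> complex) set" where
  "linear_dual M = {\<alpha> \<in> extensional (carrier M).
     (\<forall>m\<in>carrier M. \<forall>m'\<in>carrier M. \<alpha> (m \<oplus>\<^bsub>M\<^esub> m') = \<alpha> m + \<alpha> m') \<and>
     (\<forall>c. \<forall>m\<in>carrier M. \<alpha> (c \<odot>\<^bsub>M\<^esub> m) = c * \<alpha> m)}"


section \<open>Invariant germs and the modules\<close>

text \<open>\<open>\<OO>\<^sup>G\<^bsub>X\<^esub>\<close> for an orbit \<open>X\<close>, and \<open>\<OO>\<^sup>G|\<^bsub>W/G\<^esub>\<close>, as subspaces of \<open>\<MM>\<close>.\<close>

definition inv_germs ::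
    "('v, 'z) sgroup_scheme \<Rightarrow> ('g, 'y) monoid_scheme \<Rightarrow> ('g \<Rightarrow> 'v \<Rightarrow> 'v) \<Rightarrow>
     'v set \<Rightarrow> ('v \<Rightarrow> 'v mgerm) set" where
  "inv_germs V G act X =
     {F \<in> direct_sum (carrier V) (mer_stalk V). supported_in (carrier V) (mer_stalk V) X F \<and>
        (\<forall>x\<in>X. F x \<in> carrier (reg_stalk V x)) \<and>
        (\<forall>g\<in>carrier G. \<forall>x\<in>carrier V. F (act g x) = germ_act V G act g x (F x))}"

definition inv_germs_on ::
    "('v, 'z) sgroup_scheme \<Rightarrow> ('g, 'y) monoid_scheme \<Rightarrow> ('g \<Rightarrow> 'v \<Rightarrow> 'v) \<Rightarrow>
     'v set \<Rightarrow> (complex, 'v \<Rightarrow> 'v mgerm) module" where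
  "inv_germs_on V G act W = family_space (carrier V) (mer_stalk V) (mconst V)
     (internal_sum (carrier V) (mer_stalk V) (orbits G W act) (inv_germs V G act))"

text \<open>The ring \<open>\<O>\<^sup>G\<^sub>\<xi> = \<O>\<^sub>\<xi>\<^bsup>G\<^sub>\<xi>\<^esup>\<close>.\<close>

definition stab_inv_stalk ::
    "('v, 'z) sgroup_scheme \<Rightarrow> ('g, 'y) monoid_scheme \<Rightarrow> ('g \<Rightarrow> 'v \<Rightarrow> 'v) \<Rightarrow>
     'v \<Rightarrow> 'v mgerm ring" where
  "stab_inv_stalk V G act \<xi> = (reg_stalk V \<xi>)\<lparr>carrier :=
     {P \<in> carrier (reg_stalk V \<xi>). \<forall>g\<in>stabilizer G act \<xi>. germ_act V G act g \<xi> P = P}\<rparr>"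

text \<open>The ideal \<open>\<J>\<^sub>e\<close> of \<open>\<O>\<^sub>e\<close>.\<close>

definition inv_ideal ::
    "('v, 'z) sgroup_scheme \<Rightarrow> ('g, 'y) monoid_scheme \<Rightarrow> ('g \<Rightarrow> 'v \<Rightarrow> 'v) \<Rightarrow> 'v mgerm set" where
  "inv_ideal V G act = genideal (reg_stalk V \<one>\<^bsub>V\<^esub>)
     {mfrac V \<one>\<^bsub>V\<^esub> a (\<lambda>_. 1) | a. regular_at V \<one>\<^bsub>V\<^esub> a \<and> a \<one>\<^bsub>V\<^esub> = 0 \<and>
        (\<forall>g\<in>carrier G. germ_act V G act g \<one>\<^bsub>V\<^esub> (mfrac V \<one>\<^bsub>V\<^esub> a (\<lambda>_. 1)) = mfrac V \<one>\<^bsub>V\<^esub> a (\<lambda>_. 1))}"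

text \<open>\<open>\<phi>\<^sub>\<xi> (\<O>\<^sub>e\<^bsup>G\<^sub>\<xi>\<^esup> \<inter> \<J>\<^sub>e)\<close>; the stabilizer is that of \<open>\<xi>\<close>, the germs are taken at \<open>e\<close>.\<close>

definition trans_ideal ::
    "('v, 'z) sgroup_scheme \<Rightarrow> ('g, 'y) monoid_scheme \<Rightarrow> ('g \<Rightarrow> 'v \<Rightarrow> 'v) \<Rightarrow> 'v \<Rightarrow> 'v mgerm set" where
  "trans_ideal V G act \<xi> = germ_trans V \<xi> \<one>\<^bsub>V\<^esub> `
     ({P \<in> carrier (reg_stalk V \<one>\<^bsub>V\<^esub>). \<forall>g\<in>stabilizer G act \<xi>. germ_act V G act g \<one>\<^bsub>V\<^esub> P = P}
      \<inter> inv_ideal V G act)"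

text \<open>\<open>\<E>\<^sub>\<xi>\<close>, a quotient of \<open>\<O>\<^sup>G\<^sub>\<xi>\<close>, as a ring of cosets.\<close>

definition E_ring ::
    "('v, 'z) sgroup_scheme \<Rightarrow> ('g, 'y) monoid_scheme \<Rightarrow> ('g \<Rightarrow> 'v \<Rightarrow> 'v) \<Rightarrow>
     'v \<Rightarrow> 'v mgerm set ring" where
  "E_ring V G act \<xi> = stab_inv_stalk V G act \<xi> Quot trans_ideal V G act \<xi>"

definition E_class ::
    "('v, 'z) sgroup_scheme \<Rightarrow> ('g, 'y) monoid_scheme \<Rightarrow> ('g \<Rightarrow> 'v \<Rightarrow> 'v) \<Rightarrow>
     'v \<Rightarrow> 'v mgerm \<Rightarrow> 'v mgerm set" where
  "E_class V G act \<xi> P = trans_ideal V G act \<xi> +>\<^bsub>stab_inv_stalk V G act \<xi>\<^esub> P"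

text \<open>\<open>\<E>\<^sup>G\<^bsub>X\<^esub>\<close> for an orbit \<open>X\<close>; \<open>g\<close> maps a coset in \<open>\<E>\<^sub>\<xi>\<close> to its image in \<open>\<E>\<^bsub>g\<cdot>\<xi>\<^esub>\<close>.\<close>

definition E_orbit ::
    "('v, 'z) sgroup_scheme \<Rightarrow> ('g, 'y) monoid_scheme \<Rightarrow> ('g \<Rightarrow> 'v \<Rightarrow> 'v) \<Rightarrow>
     'v set \<Rightarrow> ('v \<Rightarrow> 'v mgerm set) set" where
  "E_orbit V G act X =
     {m \<in> direct_sum (carrier V) (E_ring V G act). supported_in (carrier V) (E_ring V G act) X m \<and>
        (\<forall>g\<in>carrier G. \<forall>\<xi>\<in>carrier V. m (act g \<xi>) = germ_act V G act g \<xi> ` m \<xi>)}"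

definition E_space ::
    "('v, 'z) sgroup_scheme \<Rightarrow> ('g, 'y) monoid_scheme \<Rightarrow> ('g \<Rightarrow> 'v \<Rightarrow> 'v) \<Rightarrow>
     ('v \<Rightarrow> 'v mgerm set) set \<Rightarrow> (complex, 'v \<Rightarrow> 'v mgerm set) module" where
  "E_space V G act C =
     family_space (carrier V) (E_ring V G act) (\<lambda>\<xi> c. E_class V G act \<xi> (mconst V \<xi> c)) C"

definition M_space ::
    "('v, 'z) sgroup_scheme \<Rightarrow> ('g, 'y) monoid_scheme \<Rightarrow> ('g \<Rightarrow> 'v \<Rightarrow> 'v) \<Rightarrow>
     'v set \<Rightarrow> (complex, 'v \<Rightarrow> 'v mgerm set) module" where
  "M_space V G act W = E_space V G act
     (internal_sum (carrier V) (E_ring V G act) (orbits G W act) (E_orbit V G act))"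

definition M_proj ::
    "('v, 'z) sgroup_scheme \<Rightarrow> ('g, 'y) monoid_scheme \<Rightarrow> ('g \<Rightarrow> 'v \<Rightarrow> 'v) \<Rightarrow>
     ('v \<Rightarrow> 'v mgerm) \<Rightarrow> 'v \<Rightarrow> 'v mgerm set" where
  "M_proj V G act F = (\<lambda>\<xi>\<in>carrier V. E_class V G act \<xi> (F \<xi>))"

text \<open>
  The action induced on \<open>M(G,W)\<close>: \<open>A m\<close> is the common value of the classes of \<open>A F\<close>, where \<open>F\<close>
  ranges over the representatives of \<open>m\<close>.
\<close>

definition M_act ::
    "('v, 'z) sgroup_scheme \<Rightarrow> ('g, 'y) monoid_scheme \<Rightarrow> ('g \<Rightarrow> 'v \<Rightarrow> 'v) \<Rightarrow>
     'v set \<Rightarrow> 'v set \<Rightarrow> ('v \<Rightarrow> 'v \<Rightarrow> 'v mgerm) \<Rightarrow>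
     ('v \<Rightarrow> 'v mgerm set) \<Rightarrow> 'v \<Rightarrow> 'v mgerm set" where
  "M_act V G act \<Gamma> W A m = the_elem ((\<lambda>F. M_proj V G act (skew_act V \<Gamma> A F)) `
     {F \<in> carrier (inv_germs_on V G act W). M_proj V G act F = m})"

text \<open>
  \<open>M\<^sup>*(G,W)\<close>: the direct sum of the duals of the \<open>\<E>\<^sup>G\<^bsub>X\<^esub>\<close>, a finitely supported family \<open>\<beta>\<close> being
  identified with the functional on \<open>M(G,W)\<close> it induces.
\<close>

definition Mstar_space ::
    "('v, 'z) sgroup_scheme \<Rightarrow> ('g, 'y) monoid_scheme \<Rightarrow> ('g \<Rightarrow> 'v \<Rightarrow> 'v) \<Rightarrow>
     'v set \<Rightarrow> (complex, ('v \<Rightarrow> 'v mgerm set) \<Rightarrow> complex) module" where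
  "Mstar_space V G act W =
     (let M = M_space V G act W;
          E = (\<lambda>X. E_space V G act (E_orbit V G act X));
          supp = (\<lambda>\<beta>. {X \<in> orbits G W act. \<beta> X \<noteq> zero_functional (E X)})
      in \<lparr>carrier = {(\<lambda>m\<in>carrier M. \<Sum>X\<in>supp \<beta>. \<beta> X (component (carrier V) (E_ring V G act) X m)) | \<beta>.
                       (\<forall>X\<in>orbits G W act. \<beta> X \<in> linear_dual (E X)) \<and> finite (supp \<beta>)},
          monoid.mult = undefined,
          one = undefined,
          ring.zero = zero_functional M,
          ring.add = (\<lambda>\<alpha> \<beta>. \<lambda>m\<in>carrier M. \<alpha> m + \<beta> m),
          smult = (\<lambda>c \<alpha>. \<lambda>m\<in>carrier M. c * \<alpha> m)\<rparr>)"

definition Mstar_act ::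
    "('v, 'z) sgroup_scheme \<Rightarrow> ('g, 'y) monoid_scheme \<Rightarrow> ('g \<Rightarrow> 'v \<Rightarrow> 'v) \<Rightarrow>
     'v set \<Rightarrow> 'v set \<Rightarrow> ('v \<Rightarrow> 'v \<Rightarrow> 'v mgerm) \<Rightarrow>
     (('v \<Rightarrow> 'v mgerm set) \<Rightarrow> complex) \<Rightarrow> ('v \<Rightarrow> 'v mgerm set) \<Rightarrow> complex" where
  "Mstar_act V G act \<Gamma> W A \<alpha> =
     (\<lambda>m\<in>carrier (M_space V G act W). \<alpha> (M_act V G act \<Gamma> W A m))"

end

theory Submission
  imports Defs "HOL-Algebra.Subrings"
begin

text \<open>
  Let \<open>F\<close> be an invariant family of regular germs whose class in \<open>M(G,W)\<close> is zero. The point is that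
  the class of \<open>A F\<close> is then zero for every \<open>A\<close> in the algebra.

  A germ \<open>\<lambda>\<close> at \<open>e\<close> spreads by left translation to the family \<open>x \<mapsto> \<phi>\<^sub>x(\<lambda>)\<close>, which is fixed by all
  translations. Multiplication by this family therefore commutes with all operators
  \<open>f \<phi>\<^sub>\<xi>\<close>. If \<open>\<lambda>\<close> is \<open>G\<close>-invariant, its spread is also fixed by \<open>G\<close>, since \<open>G\<close> acts by group
  automorphisms. If in addition \<open>\<lambda>\<close> vanishes at \<open>e\<close>, then \<open>\<lambda> \<cdot> H\<close> has class zero for every invariant
  family \<open>H\<close> of regular germs (\<open>spread_mult_kernel\<close>).

  Conversely every invariant \<open>F\<close> of class zero is a sum of such products: at each point \<open>x\<close> of its
  finite support, \<open>F\<close> is \<open>\<phi>\<^sub>x\<close> of a combination \<open>\<Sum> a\<^sub>j \<lambda>\<^sub>j\<close> of invariant germs \<open>\<lambda>\<^sub>j\<close> vanishing at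
  \<open>e\<close>, with regular coefficients, and averaging over \<open>G\<close> makes the coefficient families invariant
  without changing \<open>F\<close> or the \<open>\<lambda>\<^sub>j\<close>. Hence \<open>A F = \<Sum> \<lambda>\<^sub>j \<cdot> A H\<^sub>j\<close> with invariant regular \<open>H\<^sub>j\<close>; as \<open>A\<close> preserves the invariant
  families of regular germs, so are the \<open>A H\<^sub>j\<close>, and \<open>A F\<close> has class zero (\<open>kernel_stable\<close>).

  The projection from invariant families to \<open>M(G,W)\<close> is surjective, again by averaging
  (\<open>proj_lift\<close>), so \<open>M(G,W)\<close> inherits the module structure (\<open>M_left_module\<close>).

  For the dual, \<open>M\<^sup>*(G,W)\<close> is the space of functionals on \<open>M(G,W)\<close> that depend on the values at finitely
  many points only (\<open>Mstar_carrier\<close>). The value of \<open>A m\<close> at \<open>x\<close> is determined by the values of \<open>m\<close> at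
  the finitely many points \<open>\<xi>\<^sup>-\<^sup>1 x\<close> with \<open>\<xi>\<close> in the support of \<open>A\<close> (\<open>M_act_vanishing\<close>), so the
  transpose of \<open>A\<close> maps this space to itself (\<open>Mstar_right_module\<close>).

  All computations take place in one commutative ring, the product of all stalks of meromorphic
  germs, on which \<open>V\<close> acts by translations and \<open>G\<close> by pull-back, both by ring automorphisms.
\<close>

section \<open>Groups with a sheaf of functions\<close>

text \<open>
  The common ground of the two categories: functions form algebras over open sets, and the left
  translations respect them. Everything after the two instances is derived from these properties.
\<close>

locale function_sheaf =
  fixes V :: "('v, 'z) sgroup_scheme" (structure)
  assumes topspace_eq: "topspace (topo V) = carrier V"
    and sections_const: "openin (topo V) U \<Longrightarrow> (\<lambda>_. c) \<in> sections V U"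
    and sections_add: "\<lbrakk>openin (topo V) U; f \<in> sections V U; h \<in> sections V U\<rbrakk>
                        \<Longrightarrow> (\<lambda>x. f x + h x) \<in> sections V U"
    and sections_mult: "\<lbrakk>openin (topo V) U; f \<in> sections V U; h \<in> sections V U\<rbrakk>
                        \<Longrightarrow> (\<lambda>x. f x * h x) \<in> sections V U"
    and sections_restrict: "\<lbrakk>openin (topo V) U; openin (topo V) U'; U' \<subseteq> U; f \<in> sections V U\<rbrakk>
                        \<Longrightarrow> f \<in> sections V U'"

locale sheaf_group = group V + function_sheaf V for V :: "('v, 'z) sgroup_scheme" (structure) +
  assumes morphism_left_mult: "\<xi> \<in> carrier V \<Longrightarrow> morphism V (\<lambda>x. \<xi> \<otimes> x)"


section \<open>Complex Lie groups\<close>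

lemma topspace_Cspace: "topspace (Cspace n) = {..<n} \<rightarrow>\<^sub>E UNIV"
  by (simp add: Cspace_def)

text \<open>
  The relative error of the affine approximation of \<open>f\<close> at \<open>a\<close> with gradient \<open>c\<close>; differentiability
  says that it tends to \<open>0\<close> for some \<open>c\<close>.
\<close>

definition linear_error ::
    "nat \<Rightarrow> (nat \<Rightarrow> complex) \<Rightarrow> (nat \<Rightarrow> complex) \<Rightarrow> ((nat \<Rightarrow> complex) \<Rightarrow> complex) \<Rightarrow> (nat \<Rightarrow> complex) \<Rightarrow> complex"
  where "linear_error n a c f z = (f z - f a - (\<Sum>i<n. c i * (z i - a i)))
            / complex_of_real (L2_set (\<lambda>i. cmod (z i - a i)) {..<n})"

lemma holomorphic_Cn_alt:
  "holomorphic_Cn n U f \<longleftrightarrow>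
     (\<forall>a\<in>U. \<exists>c. (linear_error n a c f \<longlongrightarrow> 0) (atin (Cspace n) a))"
  unfolding holomorphic_Cn_def linear_error_def [abs_def] by (rule refl)

lemma holomorphic_Cn_subset: "holomorphic_Cn n U f \<Longrightarrow> U' \<subseteq> U \<Longrightarrow> holomorphic_Cn n U' f"
  by (auto simp: holomorphic_Cn_alt)

lemma holomorphic_Cn_const: "holomorphic_Cn n U (\<lambda>_. c)"
  unfolding holomorphic_Cn_def by (auto intro!: exI[of _ "\<lambda>_. 0"])

lemma holomorphic_Cn_add:
  assumes "holomorphic_Cn n U f" "holomorphic_Cn n U h"
  shows "holomorphic_Cn n U (\<lambda>z. f z + h z)"
  unfolding holomorphic_Cn_alt
proof
  fix a assume "a \<in> U"
  then obtain c d where "(linear_error n a c f \<longlongrightarrow> 0) (atin (Cspace n) a)"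
    "(linear_error n a d h \<longlongrightarrow> 0) (atin (Cspace n) a)"
    using assms unfolding holomorphic_Cn_alt by meson
  then have "((\<lambda>z. linear_error n a c f z + linear_error n a d h z) \<longlongrightarrow> 0 + 0) (atin (Cspace n) a)"
    by (rule tendsto_add)
  moreover have "(\<lambda>z. linear_error n a c f z + linear_error n a d h z)
                 = linear_error n a (\<lambda>i. c i + d i) (\<lambda>z. f z + h z)"
    by (rule ext) (simp add: linear_error_def add_divide_distrib [symmetric] distrib_right sum.distrib)
  ultimately show "\<exists>c. (linear_error n a c (\<lambda>z. f z + h z) \<longlongrightarrow> 0) (atin (Cspace n) a)"
    by auto
qed

lemma tendsto_coordinate_Cspace:
  assumes "i < n" "a \<in> topspace (Cspace n)"
  shows "((\<lambda>z. z i) \<longlongrightarrow> a i) (atin (Cspace n) a)"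
proof -
  have "continuous_map (Cspace n) euclidean (\<lambda>z. z i)"
    using assms(1) by (auto simp: Cspace_def intro: continuous_map_product_projection)
  then show ?thesis
    using assms(2) by (simp add: continuous_map_atin)
qed

lemma tendsto_L2_set_Cspace:
  assumes "a \<in> topspace (Cspace n)"
  shows "((\<lambda>z. complex_of_real (L2_set (\<lambda>i. cmod (z i - a i)) {..<n})) \<longlongrightarrow> 0) (atin (Cspace n) a)"
proof -
  have "((\<lambda>z. complex_of_real (sqrt (\<Sum>i<n. (cmod (z i - a i))\<^sup>2)))
          \<longlongrightarrow> complex_of_real (sqrt (\<Sum>i<n. (cmod (a i - a i))\<^sup>2))) (atin (Cspace n) a)"
    using assms
    by (intro tendsto_of_real tendsto_real_sqrt tendsto_sum tendsto_power tendsto_norm tendsto_diff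
          tendsto_coordinate_Cspace tendsto_const) auto
  then show ?thesis
    by (simp add: L2_set_def)
qed

lemma L2_set_eq_0_Cspace:
  assumes "a \<in> topspace (Cspace n)" "z \<in> topspace (Cspace n)"
    "L2_set (\<lambda>i. cmod (z i - a i)) {..<n} = 0"
  shows "z = a"
  using assms by (auto simp: L2_set_eq_0_iff topspace_Cspace PiE_iff intro: extensionalityI)

lemma eventually_atin_topspace: "eventually (\<lambda>z. z \<in> topspace X \<and> z \<noteq> a) (atin X a)"
  by (auto simp: eventually_atin)

text \<open>
  Differentiability implies continuity: \<open>f\<close> is its affine approximation plus the relative error times
  the distance.
\<close>

lemma tendsto_of_linear_error:
  assumes "(linear_error n a c f \<longlongrightarrow> 0) (atin (Cspace n) a)" and a: "a \<in> topspace (Cspace n)"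
  shows "(f \<longlongrightarrow> f a) (atin (Cspace n) a)"
proof -
  let ?L = "\<lambda>z. complex_of_real (L2_set (\<lambda>i. cmod (z i - a i)) {..<n})"
  have "((\<lambda>z. f a + (\<Sum>i<n. c i * (z i - a i)) + linear_error n a c f z * ?L z)
           \<longlongrightarrow> f a + (\<Sum>i<n. c i * (a i - a i)) + 0 * 0) (atin (Cspace n) a)"
    using a by (intro tendsto_intros assms tendsto_coordinate_Cspace tendsto_L2_set_Cspace) auto
  moreover have "\<forall>\<^sub>F z in atin (Cspace n) a.
      f a + (\<Sum>i<n. c i * (z i - a i)) + linear_error n a c f z * ?L z = f z"
    using eventually_atin_topspace
  proof eventually_elim
    case (elim z)
    then have "?L z \<noteq> 0"
      using L2_set_eq_0_Cspace[OF a] by auto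
    then show ?case
      by (simp add: linear_error_def)
  qed
  ultimately show ?thesis
    by (simp add: tendsto_cong)
qed

lemma holomorphic_Cn_mult:
  assumes "holomorphic_Cn n U f" "holomorphic_Cn n U h"
  shows "holomorphic_Cn n U (\<lambda>z. f z * h z)"
  unfolding holomorphic_Cn_alt
proof
  fix a assume "a \<in> U"
  then obtain c d where c: "(linear_error n a c f \<longlongrightarrow> 0) (atin (Cspace n) a)"
    and d: "(linear_error n a d h \<longlongrightarrow> 0) (atin (Cspace n) a)"
    using assms unfolding holomorphic_Cn_alt by meson
  let ?F = "atin (Cspace n) a" and ?L = "\<lambda>z. complex_of_real (L2_set (\<lambda>i. cmod (z i - a i)) {..<n})"
  let ?c = "\<lambda>z. (\<Sum>i<n. c i * (z i - a i))" and ?d = "\<lambda>z. (\<Sum>i<n. d i * (z i - a i))"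
  show "\<exists>e. (linear_error n a e (\<lambda>z. f z * h z) \<longlongrightarrow> 0) ?F"
  proof (cases "a \<in> topspace (Cspace n)")
    case False
    then show ?thesis by simp
  next
    case True
    \<comment> \<open>\<open>f h - f(a) h(a)\<close> splits as \<open>(f - f(a)) h(a) + f (h - h(a))\<close>; after subtracting the linear
      parts, what is left besides the two error terms is \<open>(f - f(a))\<close> times the linear part of
      \<open>h\<close>, which is bounded by the distance.\<close>
    let ?R = "\<lambda>z. (\<Sum>i<n. d i * ((z i - a i) / ?L z))"
    have bounded: "cmod (?R z) \<le> (\<Sum>i<n. cmod (d i))" for z
    proof -
      have "cmod (d i * ((z i - a i) / ?L z)) \<le> cmod (d i)" if "i < n" for i
      proof -
        have "cmod (z i - a i) \<le> L2_set (\<lambda>i. cmod (z i - a i)) {..<n}"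
          using that by (intro member_le_L2_set) auto
        then have "cmod ((z i - a i) / ?L z) \<le> 1"
          by (cases "L2_set (\<lambda>i. cmod (z i - a i)) {..<n} = 0")
             (auto simp: norm_divide L2_set_nonneg divide_le_eq_1 less_le)
        then have "cmod (d i) * cmod ((z i - a i) / ?L z) \<le> cmod (d i) * 1"
          by (rule mult_left_mono) simp
        then show ?thesis
          by (simp add: norm_mult norm_divide)
      qed
      then show ?thesis
        by (intro order_trans[OF norm_sum] sum_mono) auto
    qed
    have f: "(f \<longlongrightarrow> f a) ?F"
      using c True by (rule tendsto_of_linear_error)
    have "((\<lambda>z. (f z - f a) * ?R z) \<longlongrightarrow> 0) ?F"
    proof (rule tendsto_0_le)
      show "((\<lambda>z. f z - f a) \<longlongrightarrow> 0) ?F"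
        using tendsto_diff[OF f tendsto_const[of "f a"]] by simp
      show "\<forall>\<^sub>F z in ?F. cmod ((f z - f a) * ?R z) \<le> cmod (f z - f a) * (\<Sum>i<n. cmod (d i))"
        unfolding norm_mult by (intro always_eventually allI mult_left_mono bounded) simp
    qed
    then have "((\<lambda>z. linear_error n a c f z * h a + f z * linear_error n a d h z + (f z - f a) * ?R z)
                \<longlongrightarrow> 0 * h a + f a * 0 + 0) ?F"
      by (intro tendsto_intros c d f)
    moreover have "linear_error n a c f z * h a + f z * linear_error n a d h z + (f z - f a) * ?R z
        = linear_error n a (\<lambda>i. c i * h a + f a * d i) (\<lambda>z. f z * h z) z" for z
    proof -
      have R: "?R z = ?d z / ?L z"
        by (simp add: sum_divide_distrib)
      have "(\<Sum>i<n. (c i * h a + f a * d i) * (z i - a i)) = ?c z * h a + f a * ?d z"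
        by (simp add: sum_distrib_left sum_distrib_right sum.distrib [symmetric] algebra_simps)
      then have "f z * h z - f a * h a - (\<Sum>i<n. (c i * h a + f a * d i) * (z i - a i))
          = (f z - f a - ?c z) * h a + f z * (h z - h a - ?d z) + (f z - f a) * ?d z"
        by (simp add: algebra_simps)
      then show ?thesis
        unfolding R linear_error_def by (simp add: add_divide_distrib)
    qed
    ultimately show ?thesis
      by auto
  qed
qed

text \<open>Holomorphy at a point only sees the function near that point.\<close>

lemma holomorphic_Cn_cong:
  assumes "openin (Cspace n) U" "holomorphic_Cn n U f" "\<And>z. z \<in> U \<Longrightarrow> f z = h z"
  shows "holomorphic_Cn n U h"
  unfolding holomorphic_Cn_alt
proof
  fix a assume a: "a \<in> U"
  then obtain c where c: "(linear_error n a c f \<longlongrightarrow> 0) (atin (Cspace n) a)"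
    using assms(2) unfolding holomorphic_Cn_alt by meson
  have "\<forall>\<^sub>F z in atin (Cspace n) a. z \<in> U"
    using assms(1) a by (auto simp: eventually_atin)
  then have "\<forall>\<^sub>F z in atin (Cspace n) a. linear_error n a c f z = linear_error n a c h z"
    by eventually_elim (simp add: linear_error_def assms(3) a)
  with c show "\<exists>c. (linear_error n a c h \<longlongrightarrow> 0) (atin (Cspace n) a)"
    using tendsto_cong by blast
qed

lemma openin_chart_image:
  assumes "complex_atlas n T \<A>" "(C, \<phi>) \<in> \<A>" "openin T U"
  shows "openin (Cspace n) (\<phi> ` (C \<inter> U))"
proof -
  have C: "openin T C" "openin (Cspace n) (\<phi> ` C)"
      and \<phi>: "homeomorphic_map (subtopology T C) (subtopology (Cspace n) (\<phi> ` C)) \<phi>"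
    using assms(1,2) unfolding complex_atlas_def by auto
  have "openin (subtopology T C) (C \<inter> U)"
    using C(1) assms(3) by (simp add: openin_open_subtopology openin_Int)
  then have "openin (subtopology (Cspace n) (\<phi> ` C)) (\<phi> ` (C \<inter> U))"
    using homeomorphic_imp_open_map[OF \<phi>] by (simp add: open_map_def)
  then show ?thesis
    using C(2) by (simp add: openin_open_subtopology)
qed

lemma inj_on_chart:
  assumes "complex_atlas n T \<A>" "(C, \<phi>) \<in> \<A>"
  shows "inj_on \<phi> C"
proof -
  have "openin T C"
      and \<phi>: "homeomorphic_map (subtopology T C) (subtopology (Cspace n) (\<phi> ` C)) \<phi>"
    using assms unfolding complex_atlas_def by auto
  then show ?thesis
    using homeomorphic_imp_injective_map[OF \<phi>] openin_subset[of T C]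
    by (simp add: topspace_subtopology Int_absorb1)
qed

text \<open>
  Freezing the first half of the coordinates is an affine embedding, so it turns a holomorphic
  function of \<open>2n\<close> variables into a holomorphic function of the other \<open>n\<close>.
\<close>

definition pair_coords :: "nat \<Rightarrow> (nat \<Rightarrow> complex) \<Rightarrow> (nat \<Rightarrow> complex) \<Rightarrow> nat \<Rightarrow> complex" where
  "pair_coords n a z = (\<lambda>i\<in>{..<2 * n}. if i < n then a i else z (i - n))"

lemma sum_lessThan_double:
  fixes f :: "nat \<Rightarrow> 'a::comm_monoid_add"
  shows "(\<Sum>i<2 * n. f i) = (\<Sum>i<n. f i) + (\<Sum>i<n. f (n + i))"
proof -
  have "{..<2 * n} = {..<n} \<union> (\<lambda>i. n + i) ` {..<n}"
  proof -
    have "x \<in> {..<n} \<union> (\<lambda>i. n + i) ` {..<n}" if "x < 2 * n" for x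
      using that by (cases "x < n") (auto simp: image_iff intro!: bexI[of _ "x - n"])
    then show ?thesis by auto
  qed
  moreover have "{..<n} \<inter> (\<lambda>i. n + i) ` {..<n} = {}"
    by auto
  ultimately show ?thesis
    by (simp add: sum.union_disjoint sum.reindex)
qed

lemma filterlim_pair_coords:
  assumes "b \<in> topspace (Cspace n)"
  shows "filterlim (pair_coords n a) (atin (Cspace (2 * n)) (pair_coords n a b)) (atin (Cspace n) b)"
proof -
  have cont: "continuous_map (Cspace n) (Cspace (2 * n)) (pair_coords n a)"
    unfolding Cspace_def continuous_map_componentwise
    by (auto simp: pair_coords_def intro!: continuous_map_product_projection)
  have inj: "pair_coords n a z \<noteq> pair_coords n a b" if "z \<in> topspace (Cspace n)" "z \<noteq> b" for z
  proof -
    obtain i where i: "z i \<noteq> b i"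
      using \<open>z \<noteq> b\<close> by (auto simp: fun_eq_iff)
    then have "i < n"
      using that(1) assms by (metis PiE_arb lessThan_iff topspace_Cspace)
    with i have "pair_coords n a z (n + i) \<noteq> pair_coords n a b (n + i)"
      by (simp add: pair_coords_def)
    then show ?thesis by metis
  qed
  have "eventually (\<lambda>z. P (pair_coords n a z)) (atin (Cspace n) b)"
    if P: "eventually P (atin (Cspace (2 * n)) (pair_coords n a b))" for P
  proof -
    have "pair_coords n a b \<in> topspace (Cspace (2 * n))"
      by (auto simp: topspace_Cspace pair_coords_def)
    then obtain U where U: "openin (Cspace (2 * n)) U" "pair_coords n a b \<in> U"
        "\<And>t. t \<in> U - {pair_coords n a b} \<Longrightarrow> P t"
      using P by (auto simp: eventually_atin)
    have "openin (Cspace n) {z \<in> topspace (Cspace n). pair_coords n a z \<in> U}"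
      using cont U(1) by (rule openin_continuous_map_preimage)
    then show ?thesis
      unfolding eventually_atin
      using U(2,3) assms inj
      by (intro disjI2 exI[of _ "{z \<in> topspace (Cspace n). pair_coords n a z \<in> U}"]) auto
  qed
  then show ?thesis
    by (simp add: filterlim_iff)
qed

lemma holomorphic_Cn_second_argument:
  assumes "holomorphic_Cn (2 * n) T h" "U \<subseteq> topspace (Cspace n)" "\<And>z. z \<in> U \<Longrightarrow> pair_coords n a z \<in> T"
  shows "holomorphic_Cn n U (\<lambda>z. h (pair_coords n a z))"
  unfolding holomorphic_Cn_alt
proof
  fix b assume b: "b \<in> U"
  let ?j = "pair_coords n a"
  obtain c where c: "(linear_error (2 * n) (?j b) c h \<longlongrightarrow> 0) (atin (Cspace (2 * n)) (?j b))"
    using assms(1,3) b unfolding holomorphic_Cn_alt by meson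
  have "((\<lambda>z. linear_error (2 * n) (?j b) c h (?j z)) \<longlongrightarrow> 0) (atin (Cspace n) b)"
    using filterlim_compose[OF c filterlim_pair_coords] assms(2) b by auto
  moreover have "linear_error (2 * n) (?j b) c h (?j z)
                  = linear_error n b (\<lambda>i. c (n + i)) (\<lambda>z. h (?j z)) z" for z
    by (simp add: linear_error_def L2_set_def sum_lessThan_double) (simp add: pair_coords_def)
  ultimately show "\<exists>c. (linear_error n b c (\<lambda>z. h (?j z)) \<longlongrightarrow> 0) (atin (Cspace n) b)"
    by auto
qed

text \<open>
  Left translation by \<open>\<xi>\<close> is the multiplication of \<open>V\<close> with the first factor frozen at the coordinates
  of \<open>\<xi>\<close> in some chart, so its holomorphy follows from that of the multiplication.
\<close>

lemma complex_lie_group_sheaf_group: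
  fixes V :: "('v, 'z) sgroup_scheme" (structure)
  assumes "complex_lie_group V"
  shows "sheaf_group V"
proof -
  let ?T = "topo V"
  interpret group V
    using assms by (simp add: complex_lie_group_def)
  obtain n \<A> where top: "topspace ?T = carrier V" and atlas: "complex_atlas n ?T \<A>"
    and sec: "\<And>U. openin ?T U \<Longrightarrow> sections V U = holomorphic_sections n \<A> U"
    and hol: "holomorphic_mult n V \<A>"
    using assms unfolding complex_lie_group_def by metis
  have sec_iff: "f \<in> sections V U \<longleftrightarrow>
      (\<forall>C \<phi>. (C, \<phi>) \<in> \<A> \<longrightarrow> holomorphic_Cn n (\<phi> ` (C \<inter> U)) (\<lambda>z. f (inv_into C \<phi> z)))"
    if "openin ?T U" for f U
    using sec[OF that] by (auto simp: holomorphic_sections_def)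
  have chart_inv: "inv_into C \<phi> (\<phi> x) = x" if "(C, \<phi>) \<in> \<A>" "x \<in> C" for C \<phi> x
    using inj_on_chart[OF atlas that(1)] that(2) by simp
  show ?thesis
  proof unfold_locales
    show "topspace ?T = carrier V"
      by (rule top)
  next
    fix U c assume "openin ?T U"
    then show "(\<lambda>_. c) \<in> sections V U"
      by (simp add: sec_iff holomorphic_Cn_const)
  next
    fix U f h assume "openin ?T U" "f \<in> sections V U" "h \<in> sections V U"
    then show "(\<lambda>x. f x + h x) \<in> sections V U" "(\<lambda>x. f x * h x) \<in> sections V U"
      by (simp_all add: sec_iff holomorphic_Cn_add holomorphic_Cn_mult)
  next
    fix U U' f assume "openin ?T U" "openin ?T U'" "U' \<subseteq> U" "f \<in> sections V U"
    then show "f \<in> sections V U'"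
      unfolding sec_iff[OF \<open>openin ?T U\<close>] sec_iff[OF \<open>openin ?T U'\<close>]
      by (blast intro: holomorphic_Cn_subset)
  next
    fix \<xi> assume \<xi>: "\<xi> \<in> carrier V"
    have "continuous_map ?T ?T ((\<lambda>(x, y). x \<otimes> y) \<circ> (\<lambda>y. (\<xi>, y)))"
      using hol \<xi> unfolding holomorphic_mult_def
      by (intro continuous_map_compose[where X' = "prod_topology ?T ?T"] continuous_map_pairedI) (auto simp: top)
    then have cont: "continuous_map ?T ?T (\<lambda>y. \<xi> \<otimes> y)"
      by (simp add: o_def)
    have "(\<lambda>x. f (\<xi> \<otimes> x)) \<in> sections V {x \<in> topspace ?T. \<xi> \<otimes> x \<in> U}"
      if U: "openin ?T U" and f: "f \<in> sections V U" for f U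
    proof -
      let ?U = "{x \<in> topspace ?T. \<xi> \<otimes> x \<in> U}"
      have openU: "openin ?T ?U"
        using cont U by (rule openin_continuous_map_preimage)
      have "\<xi> \<in> (\<Union>(C, \<phi>)\<in>\<A>. C)"
        using atlas \<xi> by (simp add: complex_atlas_def top)
      then obtain C \<phi> where C: "(C, \<phi>) \<in> \<A>" and \<xi>C: "\<xi> \<in> C"
        by auto
      have "holomorphic_Cn n (\<psi> ` (D \<inter> ?U)) (\<lambda>z. f (\<xi> \<otimes> inv_into D \<psi> z))" if D: "(D, \<psi>) \<in> \<A>" for D \<psi>
      proof -
        define p where "p t = inv_into C \<phi> (\<lambda>i\<in>{..<n}. t i)" for t
        define q where "q t = inv_into D \<psi> (\<lambda>i\<in>{..<n}. t (n + i))" for t :: "nat \<Rightarrow> complex"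
        define S where "S = {t \<in> topspace (Cspace (2 * n)).
                 (\<lambda>i\<in>{..<n}. t i) \<in> \<phi> ` C \<and> (\<lambda>i\<in>{..<n}. t (n + i)) \<in> \<psi> ` D \<and> p t \<otimes> q t \<in> U}"
        let ?j = "pair_coords n (\<phi> \<xi>)"
        have "\<forall>(C, \<phi>)\<in>\<A>. \<forall>(D, \<psi>)\<in>\<A>. \<forall>U. \<forall>f\<in>sections V U. openin (topo V) U \<longrightarrow>
          (let p = (\<lambda>t. inv_into C \<phi> (\<lambda>i\<in>{..<n}. t i));
             q = (\<lambda>t. inv_into D \<psi> (\<lambda>i\<in>{..<n}. t (n + i)))
           in holomorphic_Cn (2 * n)
              {t \<in> topspace (Cspace (2 * n)).
                 (\<lambda>i\<in>{..<n}. t i) \<in> \<phi> ` C \<and> (\<lambda>i\<in>{..<n}. t (n + i)) \<in> \<psi> ` D \<and>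
                 p t \<otimes>\<^bsub>V\<^esub> q t \<in> U}
              (\<lambda>t. f (p t \<otimes>\<^bsub>V\<^esub> q t)))"
          using hol unfolding holomorphic_mult_def by (rule conjunct2)
        from bspec[OF bspec[OF this C, simplified prod.case] D, simplified prod.case] U f
        have S: "holomorphic_Cn (2 * n) S (\<lambda>t. f (p t \<otimes> q t))"
          unfolding p_def [abs_def] q_def [abs_def] S_def by (simp add: Let_def)
        have openD: "openin (Cspace n) (\<psi> ` (D \<inter> ?U))"
          by (rule openin_chart_image[OF atlas D openU])
        have "\<phi> ` C \<subseteq> topspace (Cspace n)" "\<psi> ` D \<subseteq> topspace (Cspace n)"
          using atlas C D unfolding complex_atlas_def by (blast dest: openin_subset)+
        then have first: "(\<lambda>i\<in>{..<n}. ?j z i) = \<phi> \<xi>" and second: "(\<lambda>i\<in>{..<n}. ?j z (n + i)) = z"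
          if "z \<in> \<psi> ` D" for z
          using that \<xi>C
          by (auto simp: topspace_Cspace pair_coords_def PiE_iff subset_iff intro!: extensionalityI[of _ "{..<n}"])
        have eq: "f (p (?j z) \<otimes> q (?j z)) = f (\<xi> \<otimes> inv_into D \<psi> z)" if "z \<in> \<psi> ` D" for z
          using that \<xi>C by (simp add: p_def q_def first second chart_inv[OF C])
        have "?j z \<in> S" if "z \<in> \<psi> ` (D \<inter> ?U)" for z
          using that \<xi>C unfolding S_def
          by (auto simp: p_def q_def first second chart_inv[OF C] chart_inv[OF D])
             (auto simp: pair_coords_def topspace_Cspace)
        then have "holomorphic_Cn n (\<psi> ` (D \<inter> ?U)) (\<lambda>z. f (p (?j z) \<otimes> q (?j z)))"
          using openin_subset[OF openD] by (intro holomorphic_Cn_second_argument[OF S]) auto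
        then show ?thesis
          by (rule holomorphic_Cn_cong[OF openD]) (auto intro: eq)
      qed
      then show ?thesis
        by (simp add: sec_iff[OF openU])
    qed
    with cont show "morphism V (\<lambda>x. \<xi> \<otimes> x)"
      by (simp add: morphism_def)
  qed
qed

section \<open>Linear algebraic groups\<close>

text \<open>
  The entries of \<open>B M\<close> are linear in the entries of \<open>M\<close>.
\<close>

lemma poly_funs_translate:
  assumes "p \<in> poly_funs n" "B \<in> carrier_mat n n"
  shows "\<exists>q\<in>poly_funs n. \<forall>M\<in>carrier_mat n n. q M = p (B * M)"
  using assms(1)
proof induction
  case (const c)
  then show ?case
    by (auto intro: poly_funs.const)
next
  case (entry i j)
  have "(\<lambda>M. \<Sum>k\<in>K. B $$ (i, k) * M $$ (k, j)) \<in> poly_funs n" if "finite K" "K \<subseteq> {..<n}" for K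
    using that
  proof induction
    case empty
    then show ?case by (simp add: poly_funs.const)
  next
    case (insert k K)
    then show ?case
      using entry poly_funs.add[OF poly_funs.mult[OF poly_funs.const poly_funs.entry[of k n j]]] by (simp add: sum.insert)
  qed
  then have "(\<lambda>M. \<Sum>k<n. B $$ (i, k) * M $$ (k, j)) \<in> poly_funs n"
    by blast
  moreover have "(\<Sum>k<n. B $$ (i, k) * M $$ (k, j)) = (B * M) $$ (i, j)" if "M \<in> carrier_mat n n" for M
    using that assms(2) entry by (simp add: times_mat_def scalar_prod_def lessThan_atLeast0)
  ultimately show ?case
    by (intro bexI[of _ "\<lambda>M. \<Sum>k<n. B $$ (i, k) * M $$ (k, j)"]) auto
next
  case (add p q)
  then obtain p' q' where "p' \<in> poly_funs n" "q' \<in> poly_funs n"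
    "\<forall>M\<in>carrier_mat n n. p' M = p (B * M) \<and> q' M = q (B * M)"
    by blast
  then show ?case
    by (intro bexI[of _ "\<lambda>M. p' M + q' M"]) (simp_all add: poly_funs.add)
next
  case (mult p q)
  then obtain p' q' where "p' \<in> poly_funs n" "q' \<in> poly_funs n"
    "\<forall>M\<in>carrier_mat n n. p' M = p (B * M) \<and> q' M = q (B * M)"
    by blast
  then show ?case
    by (intro bexI[of _ "\<lambda>M. p' M * q' M"]) (simp_all add: poly_funs.mult)
qed

text \<open>
  Sections are local fractions of polynomials in the matrix \<open>\<rho> y\<close>. Left translation by \<open>\<xi>\<close> multiplies
  this matrix by the constant matrix \<open>\<rho> \<xi>\<close> from the left and hence turns polynomials into polynomials;
  this gives both its continuity in the Zariski topology and the pull-back of sections.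
\<close>

lemma linear_algebraic_group_sheaf_group:
  fixes V :: "('v, 'z) sgroup_scheme" (structure)
  assumes "linear_algebraic_group V"
  shows "sheaf_group V"
proof -
  let ?T = "topo V"
  interpret group V
    using assms by (simp add: linear_algebraic_group_def)
  obtain n \<rho> where \<rho>: "\<rho> \<in> hom V (GL n)"
    and op: "\<And>U. openin ?T U \<longleftrightarrow> (\<exists>P \<subseteq> poly_funs n. U = {x \<in> carrier V. \<exists>p\<in>P. p (\<rho> x) \<noteq> 0})"
    and sec: "\<And>U. openin ?T U \<Longrightarrow> sections V U =
           {f. \<forall>x\<in>U. \<exists>p\<in>poly_funs n. \<exists>q\<in>poly_funs n. \<exists>U'. openin ?T U' \<and> x \<in> U' \<and> U' \<subseteq> U \<and>
                 (\<forall>y\<in>U'. q (\<rho> y) \<noteq> 0 \<and> f y = p (\<rho> y) / q (\<rho> y))}"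
    using assms unfolding linear_algebraic_group_def
    by (elim conjE exE) (rule that, assumption, erule spec, drule spec, erule mp)
  define fraction_on where "fraction_on f U' \<longleftrightarrow> (\<exists>p\<in>poly_funs n. \<exists>q\<in>poly_funs n.
      \<forall>y\<in>U'. q (\<rho> y) \<noteq> 0 \<and> f y = p (\<rho> y) / q (\<rho> y))" for f U'
  have sec_iff: "f \<in> sections V U \<longleftrightarrow>
      (\<forall>x\<in>U. \<exists>U'. openin ?T U' \<and> x \<in> U' \<and> U' \<subseteq> U \<and> fraction_on f U')" if "openin ?T U" for f U
  proof -
    have swap: "(\<exists>p\<in>S. \<exists>q\<in>S. \<exists>U'. A U' \<and> B U' \<and> C U' \<and> R p q U')
        \<longleftrightarrow> (\<exists>U'. A U' \<and> B U' \<and> C U' \<and> (\<exists>p\<in>S. \<exists>q\<in>S. R p q U'))"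
      for A B C :: "'v set \<Rightarrow> bool" and S :: "'s set" and R
      by blast
    show ?thesis
      unfolding sec[OF that] fraction_on_def mem_Collect_eq by (simp only: swap)
  qed
  have fraction_subset: "fraction_on f U''" if f: "fraction_on f U'" and sub: "U'' \<subseteq> U'" for f U' U''
  proof -
    obtain p q where p: "p \<in> poly_funs n" and q: "q \<in> poly_funs n"
      and "\<forall>y\<in>U'. q (\<rho> y) \<noteq> 0 \<and> f y = p (\<rho> y) / q (\<rho> y)"
      using f unfolding fraction_on_def by (elim bexE)
    then have "\<forall>y\<in>U''. q (\<rho> y) \<noteq> 0 \<and> f y = p (\<rho> y) / q (\<rho> y)"
      using sub by auto
    then show ?thesis
      unfolding fraction_on_def by (rule bexI[OF bexI[OF _ q] p])
  qed
  have fraction_add_mult: "fraction_on (\<lambda>x. f x + h x) U' \<and> fraction_on (\<lambda>x. f x * h x) U'"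
    if f: "fraction_on f U'" and h: "fraction_on h U'" for f h U'
  proof -
    obtain p q where p: "p \<in> poly_funs n" and q: "q \<in> poly_funs n"
      and f: "\<forall>y\<in>U'. q (\<rho> y) \<noteq> 0 \<and> f y = p (\<rho> y) / q (\<rho> y)"
      using f unfolding fraction_on_def by (elim bexE)
    obtain r s where r: "r \<in> poly_funs n" and s: "s \<in> poly_funs n"
      and h: "\<forall>y\<in>U'. s (\<rho> y) \<noteq> 0 \<and> h y = r (\<rho> y) / s (\<rho> y)"
      using h unfolding fraction_on_def by (elim bexE)
    have "\<forall>y\<in>U'. q (\<rho> y) * s (\<rho> y) \<noteq> 0 \<and>
        f y + h y = (p (\<rho> y) * s (\<rho> y) + r (\<rho> y) * q (\<rho> y)) / (q (\<rho> y) * s (\<rho> y))"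
      using f h by (simp add: add_frac_eq)
    moreover have "\<forall>y\<in>U'. q (\<rho> y) * s (\<rho> y) \<noteq> 0 \<and>
        f y * h y = (p (\<rho> y) * r (\<rho> y)) / (q (\<rho> y) * s (\<rho> y))"
      using f h by simp
    ultimately show ?thesis
      unfolding fraction_on_def
      using poly_funs.add[OF poly_funs.mult[OF p s] poly_funs.mult[OF r q]]
        poly_funs.mult[OF p r] poly_funs.mult[OF q s]
      by (intro conjI)
         (rule bexI[of _ "\<lambda>A. p A * s A + r A * q A"], rule bexI[of _ "\<lambda>A. q A * s A"], assumption+,
          rule bexI[of _ "\<lambda>A. p A * r A"], rule bexI[of _ "\<lambda>A. q A * s A"], assumption+)
  qed
  have const: "fraction_on (\<lambda>_. c) U" for c U
    unfolding fraction_on_def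
    by (rule bexI[of _ "\<lambda>_. c"], rule bexI[of _ "\<lambda>_. 1"]) (simp_all add: poly_funs.const)
  have "openin ?T (carrier V)"
    unfolding op by (rule exI[of _ "{\<lambda>_. 1}"]) (simp add: poly_funs.const)
  moreover have "topspace ?T \<subseteq> carrier V"
    using openin_topspace[of ?T] unfolding op by (elim exE conjE) (erule ssubst, rule Collect_restrict)
  ultimately have top: "topspace ?T = carrier V"
    using openin_subset by blast
  show ?thesis
  proof unfold_locales
    show "topspace ?T = carrier V"
      by (rule top)
  next
    fix U c assume "openin ?T U"
    then show "(\<lambda>_. c) \<in> sections V U"
      using const by (auto simp: sec_iff)
  next
    fix U f h assume U: "openin ?T U" and f: "f \<in> sections V U" and h: "h \<in> sections V U"
    have "\<exists>U'. openin ?T U' \<and> x \<in> U' \<and> U' \<subseteq> U \<and>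
        fraction_on (\<lambda>x. f x + h x) U' \<and> fraction_on (\<lambda>x. f x * h x) U'" if x: "x \<in> U" for x
    proof -
      obtain U1 U2 where U1: "openin ?T U1" "x \<in> U1" "U1 \<subseteq> U" "fraction_on f U1"
        and U2: "openin ?T U2" "x \<in> U2" "fraction_on h U2"
        using bspec[OF f[unfolded sec_iff[OF U]] x] bspec[OF h[unfolded sec_iff[OF U]] x] by (elim exE conjE)
      have "fraction_on f (U1 \<inter> U2)" "fraction_on h (U1 \<inter> U2)"
        by (rule fraction_subset[OF U1(4)], simp, rule fraction_subset[OF U2(3)], simp)
      then have "fraction_on (\<lambda>x. f x + h x) (U1 \<inter> U2) \<and> fraction_on (\<lambda>x. f x * h x) (U1 \<inter> U2)"
        by (rule fraction_add_mult)
      then show ?thesis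
        using U1 U2 by (intro exI[of _ "U1 \<inter> U2"] conjI) (simp_all add: openin_Int le_infI1)
    qed
    then show "(\<lambda>x. f x + h x) \<in> sections V U" "(\<lambda>x. f x * h x) \<in> sections V U"
      by (simp_all only: sec_iff[OF U]) blast+
  next
    fix U U' f assume U: "openin ?T U" and U': "openin ?T U'" "U' \<subseteq> U" and f: "f \<in> sections V U"
    show "f \<in> sections V U'"
      unfolding sec_iff[OF U'(1)]
    proof
      fix x assume "x \<in> U'"
      then obtain U1 where "openin ?T U1 \<and> x \<in> U1 \<and> U1 \<subseteq> U \<and> fraction_on f U1"
        using f[unfolded sec_iff[OF U]] U'(2) by blast
      then show "\<exists>U1. openin ?T U1 \<and> x \<in> U1 \<and> U1 \<subseteq> U' \<and> fraction_on f U1"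
        using U' \<open>x \<in> U'\<close> by (intro exI[of _ "U1 \<inter> U'"]) (auto intro: fraction_subset)
    qed
  next
    fix \<xi> assume \<xi>: "\<xi> \<in> carrier V"
    have \<rho>_mat: "\<rho> x \<in> carrier_mat n n" if "x \<in> carrier V" for x
      using hom_in_carrier[OF \<rho> that] by (auto simp: GL_def units_of_def Units_def ring_mat_def)
    have \<rho>_mult: "\<rho> (\<xi> \<otimes> x) = \<rho> \<xi> * \<rho> x" if "x \<in> carrier V" for x
      using hom_mult[OF \<rho> \<xi> that] by (simp add: GL_def units_of_def ring_mat_def)
    have translate: "\<exists>q\<in>poly_funs n. \<forall>x\<in>carrier V. q (\<rho> x) = p (\<rho> (\<xi> \<otimes> x))" if p: "p \<in> poly_funs n" for p
    proof -
      obtain q where "q \<in> poly_funs n" "\<forall>M\<in>carrier_mat n n. q M = p (\<rho> \<xi> * M)"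
        using poly_funs_translate[OF p \<rho>_mat[OF \<xi>]] by (rule bexE)
      then show ?thesis
        by (intro bexI[of _ q]) (simp_all add: \<rho>_mat \<rho>_mult)
    qed
    have open_pre: "openin ?T {x \<in> carrier V. \<xi> \<otimes> x \<in> U}" if U: "openin ?T U" for U
    proof -
      obtain P where P: "P \<subseteq> poly_funs n" and UP: "U = {x \<in> carrier V. \<exists>p\<in>P. p (\<rho> x) \<noteq> 0}"
        using U unfolding op by (elim exE conjE)
      define Q where "Q = {q \<in> poly_funs n. \<exists>p\<in>P. \<forall>x\<in>carrier V. q (\<rho> x) = p (\<rho> (\<xi> \<otimes> x))}"
      have "(\<exists>p\<in>P. p (\<rho> (\<xi> \<otimes> x)) \<noteq> 0) \<longleftrightarrow> (\<exists>q\<in>Q. q (\<rho> x) \<noteq> 0)" if "x \<in> carrier V" for x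
      proof
        assume "\<exists>p\<in>P. p (\<rho> (\<xi> \<otimes> x)) \<noteq> 0"
        then obtain p where p: "p \<in> P" "p (\<rho> (\<xi> \<otimes> x)) \<noteq> 0"
          by (rule bexE)
        obtain q where "q \<in> poly_funs n" "\<forall>x\<in>carrier V. q (\<rho> x) = p (\<rho> (\<xi> \<otimes> x))"
          using translate[OF subsetD[OF P p(1)]] by (rule bexE)
        then show "\<exists>q\<in>Q. q (\<rho> x) \<noteq> 0"
          using p that by (intro bexI[of _ q]) (auto simp: Q_def)
      next
        assume "\<exists>q\<in>Q. q (\<rho> x) \<noteq> 0"
        then show "\<exists>p\<in>P. p (\<rho> (\<xi> \<otimes> x)) \<noteq> 0"
          using that by (auto simp: Q_def)
      qed
      then have "{x \<in> carrier V. \<xi> \<otimes> x \<in> U} = {x \<in> carrier V. \<exists>q\<in>Q. q (\<rho> x) \<noteq> 0}"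
        using \<xi> UP by auto
      moreover have "Q \<subseteq> poly_funs n"
        by (auto simp: Q_def)
      ultimately show ?thesis
        unfolding op by (intro exI[of _ Q] conjI)
    qed
    have fraction_translate: "fraction_on (\<lambda>x. f (\<xi> \<otimes> x)) {x \<in> carrier V. \<xi> \<otimes> x \<in> U'}"
      if f: "fraction_on f U'" for f U'
    proof -
      obtain p q where pq: "p \<in> poly_funs n" "q \<in> poly_funs n"
        and eq: "\<forall>y\<in>U'. q (\<rho> y) \<noteq> 0 \<and> f y = p (\<rho> y) / q (\<rho> y)"
        using f unfolding fraction_on_def by blast
      obtain p' where p': "p' \<in> poly_funs n" and "\<forall>x\<in>carrier V. p' (\<rho> x) = p (\<rho> (\<xi> \<otimes> x))"
        using translate[OF pq(1)] by (rule bexE)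
      moreover obtain q' where q': "q' \<in> poly_funs n" and "\<forall>x\<in>carrier V. q' (\<rho> x) = q (\<rho> (\<xi> \<otimes> x))"
        using translate[OF pq(2)] by (rule bexE)
      ultimately have "\<forall>y\<in>{x \<in> carrier V. \<xi> \<otimes> x \<in> U'}.
          q' (\<rho> y) \<noteq> 0 \<and> f (\<xi> \<otimes> y) = p' (\<rho> y) / q' (\<rho> y)"
        using eq by simp
      then show ?thesis
        unfolding fraction_on_def by (rule bexI[OF bexI[OF _ q'] p'])
    qed
    have "(\<lambda>x. f (\<xi> \<otimes> x)) \<in> sections V {x \<in> carrier V. \<xi> \<otimes> x \<in> U}"
      if U: "openin ?T U" and f: "f \<in> sections V U" for f U
    proof (rule iffD2[OF sec_iff[OF open_pre[OF U]]], rule ballI)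
      fix x assume x: "x \<in> {x \<in> carrier V. \<xi> \<otimes> x \<in> U}"
      then obtain U' where U': "openin ?T U'" "\<xi> \<otimes> x \<in> U'" "U' \<subseteq> U" "fraction_on f U'"
        using bspec[OF f[unfolded sec_iff[OF U]], of "\<xi> \<otimes> x"] by blast
      then have "fraction_on (\<lambda>x. f (\<xi> \<otimes> x)) {x \<in> carrier V. \<xi> \<otimes> x \<in> U'}"
        by (intro fraction_translate)
      with U' x show "\<exists>U''. openin ?T U'' \<and> x \<in> U'' \<and> U'' \<subseteq> {x \<in> carrier V. \<xi> \<otimes> x \<in> U} \<and>
          fraction_on (\<lambda>x. f (\<xi> \<otimes> x)) U''"
        by (intro exI[of _ "{x \<in> carrier V. \<xi> \<otimes> x \<in> U'}"]) (auto intro: open_pre)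
    qed
    then show "morphism V (\<lambda>x. \<xi> \<otimes> x)"
      using \<xi> open_pre by (auto simp: morphism_def top continuous_map_def)
  qed
qed

section \<open>Stalks of meromorphic germs\<close>

context function_sheaf
begin

lemma openin_carrier: "openin (topo V) U \<Longrightarrow> U \<subseteq> carrier V"
  using openin_subset topspace_eq by blast

lemma near_all: "x \<in> carrier V \<Longrightarrow> (\<And>y. y \<in> carrier V \<Longrightarrow> P y) \<Longrightarrow> near V x P"
  unfolding near_def using topspace_eq by (metis openin_topspace)

lemma near_conj: "near V x P \<Longrightarrow> near V x Q \<Longrightarrow> near V x (\<lambda>y. P y \<and> Q y)"
  unfolding near_def
  by (elim exE conjE, rule_tac x = "U \<inter> Ua" in exI) auto

lemma near_mono: "near V x P \<Longrightarrow> (\<And>y. y \<in> carrier V \<Longrightarrow> P y \<Longrightarrow> Q y) \<Longrightarrow> near V x Q"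
  unfolding near_def using openin_carrier by blast

lemma near_mono2:
  assumes "near V x P" "near V x Q" "\<And>y. y \<in> carrier V \<Longrightarrow> P y \<Longrightarrow> Q y \<Longrightarrow> R y"
  shows "near V x R"
  by (rule near_mono[OF near_conj[OF assms(1,2)]]) (simp add: assms(3))

lemma regular_at_in: "regular_at V x f \<Longrightarrow> x \<in> carrier V"
  unfolding regular_at_def using openin_carrier by blast

lemma regular_at_const: "x \<in> carrier V \<Longrightarrow> regular_at V x (\<lambda>_. c)"
  unfolding regular_at_def using topspace_eq sections_const by (metis openin_topspace)

lemma regular_at_obtain2:
  assumes "regular_at V x f" "regular_at V x h"
  obtains U where "openin (topo V) U" "x \<in> U" "f \<in> sections V U" "h \<in> sections V U"
proof -
  obtain A B where A: "openin (topo V) A" "x \<in> A" "f \<in> sections V A"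
    and B: "openin (topo V) B" "x \<in> B" "h \<in> sections V B"
    using assms unfolding regular_at_def by blast
  have AB: "openin (topo V) (A \<inter> B)"
    using A B by blast
  show thesis
    by (rule that[OF AB]) (use A B sections_restrict[OF A(1) AB _ A(3)] sections_restrict[OF B(1) AB _ B(3)] in auto)
qed

lemma regular_at_add: "regular_at V x f \<Longrightarrow> regular_at V x h \<Longrightarrow> regular_at V x (\<lambda>y. f y + h y)"
  by (erule (1) regular_at_obtain2) (auto simp: regular_at_def intro: sections_add)

lemma regular_at_mult: "regular_at V x f \<Longrightarrow> regular_at V x h \<Longrightarrow> regular_at V x (\<lambda>y. f y * h y)"
  by (erule (1) regular_at_obtain2) (auto simp: regular_at_def intro: sections_mult)

lemma regular_at_uminus: "regular_at V x f \<Longrightarrow> regular_at V x (\<lambda>y. - f y)"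
  using regular_at_mult[OF regular_at_const[of x "-1"], of f] regular_at_in by simp

lemma nonzerodiv_at_regular: "nonzerodiv_at V x b \<Longrightarrow> regular_at V x b"
  by (simp add: nonzerodiv_at_def)

lemma nonzerodiv_at_cancel:
  "nonzerodiv_at V x b \<Longrightarrow> regular_at V x a \<Longrightarrow> near V x (\<lambda>y. b y * a y = 0) \<Longrightarrow> near V x (\<lambda>y. a y = 0)"
  by (simp add: nonzerodiv_at_def)

lemma nonzerodiv_at_one: "x \<in> carrier V \<Longrightarrow> nonzerodiv_at V x (\<lambda>_. 1)"
  by (simp add: nonzerodiv_at_def regular_at_const)

lemma nonzerodiv_at_mult:
  assumes b: "nonzerodiv_at V x b" and d: "nonzerodiv_at V x d"
  shows "nonzerodiv_at V x (\<lambda>y. b y * d y)"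
  unfolding nonzerodiv_at_def
proof (intro conjI allI impI, goal_cases)
  case 1
  then show ?case
    using b d by (simp add: regular_at_mult nonzerodiv_at_regular)
next
  case (2 a)
  then have a: "regular_at V x a" and near: "near V x (\<lambda>y. b y * (d y * a y) = 0)"
    by (simp_all add: mult.assoc)
  from near have "near V x (\<lambda>y. d y * a y = 0)"
    by (rule nonzerodiv_at_cancel[OF b regular_at_mult[OF nonzerodiv_at_regular[OF d] a]])
  then show ?case
    by (rule nonzerodiv_at_cancel[OF d a])
qed

definition fraction_at :: "'v \<Rightarrow> ('v \<Rightarrow> complex) \<Rightarrow> ('v \<Rightarrow> complex) \<Rightarrow> bool" where
  "fraction_at x a b \<longleftrightarrow> regular_at V x a \<and> nonzerodiv_at V x b"

lemma fraction_at_mult: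
  "fraction_at x a b \<Longrightarrow> fraction_at x c d \<Longrightarrow> fraction_at x (\<lambda>y. a y * c y) (\<lambda>y. b y * d y)"
  by (simp add: fraction_at_def regular_at_mult nonzerodiv_at_mult)

lemma fraction_at_add:
  "fraction_at x a b \<Longrightarrow> fraction_at x c d \<Longrightarrow> fraction_at x (\<lambda>y. a y * d y + c y * b y) (\<lambda>y. b y * d y)"
  by (simp add: fraction_at_def regular_at_add regular_at_mult nonzerodiv_at_mult nonzerodiv_at_regular)

lemma fraction_at_const: "x \<in> carrier V \<Longrightarrow> fraction_at x (\<lambda>_. c) (\<lambda>_. 1)"
  by (simp add: fraction_at_def regular_at_const nonzerodiv_at_one)

lemma fraction_at_in: "fraction_at x a b \<Longrightarrow> x \<in> carrier V"
  by (auto simp: fraction_at_def dest: regular_at_in)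

text \<open>
  That proportionality of fractions is transitive is the one place where it matters that denominators
  are not zero divisors.
\<close>

lemma mfrac_eq_iff:
  assumes "fraction_at x a b" "fraction_at x a' b'"
  shows "mfrac V x a b = mfrac V x a' b' \<longleftrightarrow> near V x (\<lambda>y. a y * b' y = a' y * b y)"
proof
  assume eq: "mfrac V x a b = mfrac V x a' b'"
  have "(a', b') \<in> mfrac V x a b"
    unfolding eq using assms fraction_at_in[OF assms(1)] by (simp add: mfrac_def fraction_at_def near_all)
  then show "near V x (\<lambda>y. a y * b' y = a' y * b y)"
    by (simp add: mfrac_def)
next
  assume eq: "near V x (\<lambda>y. a y * b' y = a' y * b y)"
  have step: "near V x (\<lambda>y. a' y * d y = c y * b' y)"
    if frac: "fraction_at x a b" "fraction_at x a' b'" "regular_at V x c" "nonzerodiv_at V x d"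
      and eq: "near V x (\<lambda>y. a y * b' y = a' y * b y)" and cd: "near V x (\<lambda>y. a y * d y = c y * b y)"
    for a b a' b' c d
  proof -
    have "near V x (\<lambda>y. b y * (a' y * d y + - (c y * b' y)) = 0)"
      using eq cd
    proof (rule near_mono2)
      fix y assume *: "a y * b' y = a' y * b y" "a y * d y = c y * b y"
      have "b y * (a' y * d y + - (c y * b' y)) = (a' y * b y) * d y - (c y * b y) * b' y"
        by (simp add: algebra_simps)
      also have "\<dots> = 0"
        by (simp add: * [symmetric])
      finally show "b y * (a' y * d y + - (c y * b' y)) = 0" .
    qed
    moreover have "regular_at V x (\<lambda>y. a' y * d y + - (c y * b' y))"
      using frac unfolding fraction_at_def
      by (intro regular_at_add[OF regular_at_mult regular_at_uminus[OF regular_at_mult]]) (auto intro: nonzerodiv_at_regular)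
    moreover have "nonzerodiv_at V x b"
      using frac by (simp add: fraction_at_def)
    ultimately have "near V x (\<lambda>y. a' y * d y + - (c y * b' y) = 0)"
      using nonzerodiv_at_cancel by blast
    then show ?thesis
      by (rule near_mono) simp
  qed
  have eq': "near V x (\<lambda>y. a' y * b y = a y * b' y)"
    using eq by (rule near_mono) simp
  show "mfrac V x a b = mfrac V x a' b'"
    unfolding mfrac_def using step[OF assms _ _ eq] step[OF assms(2,1) _ _ eq'] by blast
qed

lemma mfrac_eqI:
  assumes "fraction_at x a b" "fraction_at x a' b'"
    and "\<And>y. y \<in> carrier V \<Longrightarrow> a y * b' y = a' y * b y"
  shows "mfrac V x a b = mfrac V x a' b'"
  using assms by (simp add: mfrac_eq_iff near_all fraction_at_in)

lemma mfrac_cong: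
  assumes "near V x (\<lambda>y. a y = a' y)" "near V x (\<lambda>y. b y = b' y)"
  shows "mfrac V x a b = mfrac V x a' b'"
proof -
  have "near V x (\<lambda>y. a y * d y = c y * b y) \<longleftrightarrow> near V x (\<lambda>y. a' y * d y = c y * b' y)" for c d
  proof
    assume "near V x (\<lambda>y. a y * d y = c y * b y)"
    then show "near V x (\<lambda>y. a' y * d y = c y * b' y)"
      by (rule near_mono2[OF near_conj[OF assms], of "\<lambda>y. a y * d y = c y * b y"]) simp
  next
    assume "near V x (\<lambda>y. a' y * d y = c y * b' y)"
    then show "near V x (\<lambda>y. a y * d y = c y * b y)"
      by (rule near_mono2[OF near_conj[OF assms], of "\<lambda>y. a' y * d y = c y * b' y"]) simp
  qed
  then show ?thesis
    by (simp add: mfrac_def)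
qed

lemma mfrac_memD:
  assumes cd: "(c, d) \<in> mfrac V x a b" and ab: "fraction_at x a b"
  shows "fraction_at x c d" "mfrac V x c d = mfrac V x a b"
proof -
  have eq: "near V x (\<lambda>y. a y * d y = c y * b y)" and "fraction_at x c d"
    using cd by (simp_all add: mfrac_def fraction_at_def)
  then show "fraction_at x c d" "mfrac V x c d = mfrac V x a b"
    using ab by (simp_all add: mfrac_eq_iff[OF ab, symmetric])
qed

lemma mfrac_self: "fraction_at x a b \<Longrightarrow> (a, b) \<in> mfrac V x a b"
  by (auto simp: mfrac_def fraction_at_def intro: near_all dest: regular_at_in)

lemma mer_stalk_carrier: "P \<in> carrier (mer_stalk V x) \<longleftrightarrow> (\<exists>a b. P = mfrac V x a b \<and> fraction_at x a b)"
  by (auto simp: mer_stalk_def fraction_at_def)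

lemma mfrac_in_carrier: "fraction_at x a b \<Longrightarrow> mfrac V x a b \<in> carrier (mer_stalk V x)"
  by (auto simp: mer_stalk_carrier)

lemma UN_const_value: "p \<in> P \<Longrightarrow> (\<And>q. q \<in> P \<Longrightarrow> f q = X) \<Longrightarrow> (\<Union>q\<in>P. f q) = X"
  by auto

lemma mfrac_mult:
  assumes "fraction_at x a b" "fraction_at x c d"
  shows "mfrac V x a b \<otimes>\<^bsub>mer_stalk V x\<^esub> mfrac V x c d = mfrac V x (\<lambda>y. a y * c y) (\<lambda>y. b y * d y)"
proof -
  have "mfrac V x (\<lambda>y. a' y * c' y) (\<lambda>y. b' y * d' y) = mfrac V x (\<lambda>y. a y * c y) (\<lambda>y. b y * d y)"
    if "(a', b') \<in> mfrac V x a b" "(c', d') \<in> mfrac V x c d" for a' b' c' d'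
  proof -
    have 1: "fraction_at x a' b'" "fraction_at x c' d'"
      using that assms mfrac_memD by blast+
    have "near V x (\<lambda>y. a y * b' y = a' y * b y)" "near V x (\<lambda>y. c y * d' y = c' y * d y)"
      using that by (auto simp: mfrac_def)
    then have "near V x (\<lambda>y. (a' y * c' y) * (b y * d y) = (a y * c y) * (b' y * d' y))"
      by (rule near_mono2) (simp add: algebra_simps)
    then show ?thesis
      using assms 1 by (simp add: mfrac_eq_iff fraction_at_mult)
  qed
  then show ?thesis
    unfolding mer_stalk_def
    by (simp, intro UN_const_value[OF mfrac_self[OF assms(1)]])
       (auto intro!: UN_const_value[OF mfrac_self[OF assms(2)]])
qed

lemma mfrac_add:
  assumes "fraction_at x a b" "fraction_at x c d"
  shows "mfrac V x a b \<oplus>\<^bsub>mer_stalk V x\<^esub> mfrac V x c d = mfrac V x (\<lambda>y. a y * d y + c y * b y) (\<lambda>y. b y * d y)"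
proof -
  have "mfrac V x (\<lambda>y. a' y * d' y + c' y * b' y) (\<lambda>y. b' y * d' y)
        = mfrac V x (\<lambda>y. a y * d y + c y * b y) (\<lambda>y. b y * d y)"
    if "(a', b') \<in> mfrac V x a b" "(c', d') \<in> mfrac V x c d" for a' b' c' d'
  proof -
    have 1: "fraction_at x a' b'" "fraction_at x c' d'"
      using that assms mfrac_memD by blast+
    have "near V x (\<lambda>y. a y * b' y = a' y * b y)" "near V x (\<lambda>y. c y * d' y = c' y * d y)"
      using that by (auto simp: mfrac_def)
    then have "near V x (\<lambda>y. (a' y * d' y + c' y * b' y) * (b y * d y) = (a y * d y + c y * b y) * (b' y * d' y))"
    proof (rule near_mono2)
      fix y assume *: "a y * b' y = a' y * b y" "c y * d' y = c' y * d y"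
      have "(a y * d y + c y * b y) * (b' y * d' y) = (a y * b' y) * (d y * d' y) + (c y * d' y) * (b y * b' y)"
        by (simp add: algebra_simps)
      then show "(a' y * d' y + c' y * b' y) * (b y * d y) = (a y * d y + c y * b y) * (b' y * d' y)"
        unfolding * by (simp add: algebra_simps)
    qed
    then show ?thesis
      using assms 1 by (simp add: mfrac_eq_iff fraction_at_add)
  qed
  then show ?thesis
    unfolding mer_stalk_def
    by (simp, intro UN_const_value[OF mfrac_self[OF assms(1)]])
       (auto intro!: UN_const_value[OF mfrac_self[OF assms(2)]])
qed

lemma mer_stalk_one: "\<one>\<^bsub>mer_stalk V x\<^esub> = mfrac V x (\<lambda>_. 1) (\<lambda>_. 1)"
  and mer_stalk_zero: "\<zero>\<^bsub>mer_stalk V x\<^esub> = mfrac V x (\<lambda>_. 0) (\<lambda>_. 1)"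
  by (simp_all add: mer_stalk_def)

lemma mer_stalk_cring:
  assumes x: "x \<in> carrier V"
  shows "cring (mer_stalk V x)"
proof -
  let ?R = "mer_stalk V x"
  note frac = fraction_at_mult fraction_at_add fraction_at_const[OF x]
  have one_zero: "\<one>\<^bsub>?R\<^esub> \<in> carrier ?R" "\<zero>\<^bsub>?R\<^esub> \<in> carrier ?R"
    by (simp_all add: mer_stalk_one mer_stalk_zero mfrac_in_carrier frac)
  have unary: "\<one>\<^bsub>?R\<^esub> \<otimes>\<^bsub>?R\<^esub> P = P" "\<zero>\<^bsub>?R\<^esub> \<oplus>\<^bsub>?R\<^esub> P = P"
      "\<exists>Q\<in>carrier ?R. Q \<oplus>\<^bsub>?R\<^esub> P = \<zero>\<^bsub>?R\<^esub>"
    if P: "P \<in> carrier ?R" for P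
  proof -
    obtain a b where a: "P = mfrac V x a b" "fraction_at x a b"
      using P unfolding mer_stalk_carrier by blast
    then show "\<one>\<^bsub>?R\<^esub> \<otimes>\<^bsub>?R\<^esub> P = P" "\<zero>\<^bsub>?R\<^esub> \<oplus>\<^bsub>?R\<^esub> P = P"
      by (simp_all add: mer_stalk_one mer_stalk_zero mfrac_mult mfrac_add frac)
    have neg: "fraction_at x (\<lambda>y. - a y) b"
      using a by (simp add: fraction_at_def regular_at_uminus)
    have "mfrac V x (\<lambda>y. - a y) b \<oplus>\<^bsub>?R\<^esub> P = \<zero>\<^bsub>?R\<^esub>"
      unfolding a(1) mfrac_add[OF neg a(2)] mer_stalk_zero
      by (rule mfrac_eqI[OF fraction_at_add[OF neg a(2)] fraction_at_const[OF x]]) simp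
    then show "\<exists>Q\<in>carrier ?R. Q \<oplus>\<^bsub>?R\<^esub> P = \<zero>\<^bsub>?R\<^esub>"
      using mfrac_in_carrier[OF neg] by blast
  qed
  have binary: "P \<otimes>\<^bsub>?R\<^esub> Q \<in> carrier ?R" "P \<oplus>\<^bsub>?R\<^esub> Q \<in> carrier ?R"
      "P \<otimes>\<^bsub>?R\<^esub> Q = Q \<otimes>\<^bsub>?R\<^esub> P" "P \<oplus>\<^bsub>?R\<^esub> Q = Q \<oplus>\<^bsub>?R\<^esub> P"
    if P: "P \<in> carrier ?R" and Q: "Q \<in> carrier ?R" for P Q
  proof -
    obtain a b c d where *: "P = mfrac V x a b" "fraction_at x a b" "Q = mfrac V x c d" "fraction_at x c d"
      using P Q unfolding mer_stalk_carrier by blast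
    show "P \<otimes>\<^bsub>?R\<^esub> Q \<in> carrier ?R" "P \<oplus>\<^bsub>?R\<^esub> Q \<in> carrier ?R"
      by (simp_all add: * mfrac_mult mfrac_add mfrac_in_carrier frac)
    show "P \<otimes>\<^bsub>?R\<^esub> Q = Q \<otimes>\<^bsub>?R\<^esub> P" "P \<oplus>\<^bsub>?R\<^esub> Q = Q \<oplus>\<^bsub>?R\<^esub> P"
      by (simp_all add: * mfrac_mult mfrac_add ac_simps)
  qed
  have ternary: "P \<otimes>\<^bsub>?R\<^esub> Q \<otimes>\<^bsub>?R\<^esub> S = P \<otimes>\<^bsub>?R\<^esub> (Q \<otimes>\<^bsub>?R\<^esub> S)"
      "P \<oplus>\<^bsub>?R\<^esub> Q \<oplus>\<^bsub>?R\<^esub> S = P \<oplus>\<^bsub>?R\<^esub> (Q \<oplus>\<^bsub>?R\<^esub> S)"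
      "(P \<oplus>\<^bsub>?R\<^esub> Q) \<otimes>\<^bsub>?R\<^esub> S = P \<otimes>\<^bsub>?R\<^esub> S \<oplus>\<^bsub>?R\<^esub> Q \<otimes>\<^bsub>?R\<^esub> S"
    if P: "P \<in> carrier ?R" and Q: "Q \<in> carrier ?R" and S: "S \<in> carrier ?R" for P Q S
  proof -
    obtain a b c d e f where *: "P = mfrac V x a b" "Q = mfrac V x c d" "S = mfrac V x e f"
        "fraction_at x a b" "fraction_at x c d" "fraction_at x e f"
      using P Q S unfolding mer_stalk_carrier by blast
    show "P \<otimes>\<^bsub>?R\<^esub> Q \<otimes>\<^bsub>?R\<^esub> S = P \<otimes>\<^bsub>?R\<^esub> (Q \<otimes>\<^bsub>?R\<^esub> S)"
      by (simp add: * mfrac_mult frac) (simp add: ac_simps)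
    show "P \<oplus>\<^bsub>?R\<^esub> Q \<oplus>\<^bsub>?R\<^esub> S = P \<oplus>\<^bsub>?R\<^esub> (Q \<oplus>\<^bsub>?R\<^esub> S)"
      by (simp add: * mfrac_add frac) (simp add: algebra_simps)
    show "(P \<oplus>\<^bsub>?R\<^esub> Q) \<otimes>\<^bsub>?R\<^esub> S = P \<otimes>\<^bsub>?R\<^esub> S \<oplus>\<^bsub>?R\<^esub> Q \<otimes>\<^bsub>?R\<^esub> S"
      by (simp add: * mfrac_mult mfrac_add frac, intro mfrac_eqI frac *) (simp add: algebra_simps)
  qed
  show ?thesis
  proof (rule cringI)
    show "abelian_group ?R"
    proof (rule abelian_groupI)
      fix P Q assume "P \<in> carrier ?R" "Q \<in> carrier ?R"
      then show "P \<oplus>\<^bsub>?R\<^esub> Q = Q \<oplus>\<^bsub>?R\<^esub> P"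
        by (rule binary(4))
    qed (simp_all add: one_zero unary binary(2) ternary(2))
    show "comm_monoid ?R"
      by (rule comm_monoidI) (simp_all add: one_zero unary binary(1) ternary, simp add: binary(3))
  qed (rule ternary)
qed

subsection \<open>Regular germs and constants\<close>

lemma reg_stalk_carrier: "P \<in> carrier (reg_stalk V x) \<longleftrightarrow> (\<exists>a. P = mfrac V x a (\<lambda>_. 1) \<and> fraction_at x a (\<lambda>_. 1))"
  by (auto simp: reg_stalk_def fraction_at_def regular_at_in nonzerodiv_at_one)

lemma reg_stalk_ops [simp]:
  "(\<otimes>\<^bsub>reg_stalk V x\<^esub>) = (\<otimes>\<^bsub>mer_stalk V x\<^esub>)" "(\<oplus>\<^bsub>reg_stalk V x\<^esub>) = (\<oplus>\<^bsub>mer_stalk V x\<^esub>)"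
  "\<one>\<^bsub>reg_stalk V x\<^esub> = \<one>\<^bsub>mer_stalk V x\<^esub>" "\<zero>\<^bsub>reg_stalk V x\<^esub> = \<zero>\<^bsub>mer_stalk V x\<^esub>"
  by (simp_all add: reg_stalk_def)

lemma reg_stalk_subring:
  assumes x: "x \<in> carrier V"
  shows "subring (carrier (reg_stalk V x)) (mer_stalk V x)"
proof -
  interpret R: cring "mer_stalk V x"
    by (rule mer_stalk_cring[OF x])
  note frac = fraction_at_const[OF x]
  show ?thesis
  proof (rule R.subringI)
    show "carrier (reg_stalk V x) \<subseteq> carrier (mer_stalk V x)"
      unfolding reg_stalk_carrier[abs_def] mer_stalk_carrier subset_iff by blast
    show "\<one>\<^bsub>mer_stalk V x\<^esub> \<in> carrier (reg_stalk V x)"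
      using frac by (auto simp: reg_stalk_carrier mer_stalk_one)
    fix P assume "P \<in> carrier (reg_stalk V x)"
    then obtain a where a: "P = mfrac V x a (\<lambda>_. 1)" "fraction_at x a (\<lambda>_. 1)"
      by (auto simp: reg_stalk_carrier)
    then have neg: "fraction_at x (\<lambda>y. - a y) (\<lambda>_. 1)"
      by (simp add: fraction_at_def regular_at_uminus)
    then have "P \<oplus>\<^bsub>mer_stalk V x\<^esub> mfrac V x (\<lambda>y. - a y) (\<lambda>_. 1) = \<zero>\<^bsub>mer_stalk V x\<^esub>"
      using a by (simp add: mfrac_add mer_stalk_zero)
    then have "\<ominus>\<^bsub>mer_stalk V x\<^esub> P = mfrac V x (\<lambda>y. - a y) (\<lambda>_. 1)"
      using a neg by (intro R.minus_equality) (simp_all add: mfrac_in_carrier R.a_comm)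
    then show "\<ominus>\<^bsub>mer_stalk V x\<^esub> P \<in> carrier (reg_stalk V x)"
      using neg by (auto simp: reg_stalk_carrier)
    fix Q assume "Q \<in> carrier (reg_stalk V x)"
    then obtain c where c: "Q = mfrac V x c (\<lambda>_. 1)" "fraction_at x c (\<lambda>_. 1)"
      by (auto simp: reg_stalk_carrier)
    have "fraction_at x (\<lambda>y. a y * c y) (\<lambda>_. 1)" "fraction_at x (\<lambda>y. a y + c y) (\<lambda>_. 1)"
      using a c by (simp_all add: fraction_at_def regular_at_mult regular_at_add)
    then show "P \<otimes>\<^bsub>mer_stalk V x\<^esub> Q \<in> carrier (reg_stalk V x)" "P \<oplus>\<^bsub>mer_stalk V x\<^esub> Q \<in> carrier (reg_stalk V x)"
      using a c by (auto simp: reg_stalk_carrier mfrac_add mfrac_mult)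
  qed
qed

lemma mconst_reg: "x \<in> carrier V \<Longrightarrow> mconst V x c \<in> carrier (reg_stalk V x)"
  using fraction_at_const by (auto simp: reg_stalk_carrier mconst_def)

lemma mconst_carrier: "x \<in> carrier V \<Longrightarrow> mconst V x c \<in> carrier (mer_stalk V x)"
  using fraction_at_const by (auto simp: mer_stalk_carrier mconst_def)

lemma mconst_ops:
  assumes "x \<in> carrier V"
  shows "mconst V x (c + d) = mconst V x c \<oplus>\<^bsub>mer_stalk V x\<^esub> mconst V x d"
    and "mconst V x (c * d) = mconst V x c \<otimes>\<^bsub>mer_stalk V x\<^esub> mconst V x d"
    and "mconst V x 1 = \<one>\<^bsub>mer_stalk V x\<^esub>" "mconst V x 0 = \<zero>\<^bsub>mer_stalk V x\<^esub>"
  using assms by (simp_all add: mconst_def mfrac_add mfrac_mult fraction_at_const mer_stalk_one mer_stalk_zero)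

end


section \<open>Pull-back of germs\<close>

text \<open>Mutually inverse automorphisms of the space with its structure sheaf.\<close>

definition sheaf_auto :: "('v, 'z) sgroup_scheme \<Rightarrow> ('v \<Rightarrow> 'v) \<Rightarrow> ('v \<Rightarrow> 'v) \<Rightarrow> bool" where
  "sheaf_auto V s t \<longleftrightarrow> morphism V s \<and> morphism V t \<and>
     (\<forall>x\<in>carrier V. s x \<in> carrier V \<and> t x \<in> carrier V \<and> s (t x) = x \<and> t (s x) = x)"

lemma sheaf_auto_sym: "sheaf_auto V s t \<Longrightarrow> sheaf_auto V t s"
  by (auto simp: sheaf_auto_def)

context function_sheaf
begin

lemma sheaf_auto_carrier: "sheaf_auto V s t \<Longrightarrow> x \<in> carrier V \<Longrightarrow> s x \<in> carrier V"
  by (auto simp: sheaf_auto_def)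

lemma sheaf_auto_inverse: "sheaf_auto V s t \<Longrightarrow> x \<in> carrier V \<Longrightarrow> t (s x) = x"
  by (auto simp: sheaf_auto_def)

lemma openin_preimage:
  assumes "sheaf_auto V s t" "openin (topo V) U"
  shows "openin (topo V) {y \<in> carrier V. s y \<in> U}"
proof -
  have "continuous_map (topo V) (topo V) s"
    using assms(1) by (simp add: sheaf_auto_def morphism_def)
  from openin_continuous_map_preimage[OF this assms(2)] show ?thesis
    by (simp add: topspace_eq)
qed

lemma sections_preimage:
  assumes "sheaf_auto V s t" "openin (topo V) U" "f \<in> sections V U"
  shows "(\<lambda>y. f (s y)) \<in> sections V {y \<in> carrier V. s y \<in> U}"
  using assms by (simp add: sheaf_auto_def morphism_def topspace_eq)

lemma near_pull:
  assumes s: "sheaf_auto V s t" and x: "x \<in> carrier V" and P: "near V (s x) P"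
  shows "near V x (\<lambda>y. P (s y))"
proof -
  obtain U where U: "openin (topo V) U" "s x \<in> U" "\<forall>y\<in>U. P y"
    using P by (auto simp: near_def)
  then show ?thesis
    unfolding near_def using openin_preimage[OF s U(1)] x
    by (intro exI[of _ "{y \<in> carrier V. s y \<in> U}"]) simp
qed

lemma regular_at_pull:
  assumes s: "sheaf_auto V s t" and x: "x \<in> carrier V" and f: "regular_at V (s x) f"
  shows "regular_at V x (\<lambda>y. f (s y))"
proof -
  obtain U where U: "openin (topo V) U" "s x \<in> U" "f \<in> sections V U"
    using f by (auto simp: regular_at_def)
  then show ?thesis
    unfolding regular_at_def using openin_preimage[OF s U(1)] sections_preimage[OF s U(1,3)] x
    by (intro exI[of _ "{y \<in> carrier V. s y \<in> U}"]) simp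
qed

text \<open>
  A germ that annihilates the pull-back along \<open>s\<close> is moved back along the inverse of \<open>s\<close>.
\<close>

lemma nonzerodiv_at_pull:
  assumes s: "sheaf_auto V s t" and x: "x \<in> carrier V" and b: "nonzerodiv_at V (s x) b"
  shows "nonzerodiv_at V x (\<lambda>y. b (s y))"
  unfolding nonzerodiv_at_def
proof (intro conjI allI impI, goal_cases)
  case 1
  then show ?case
    using regular_at_pull[OF s x] b by (simp add: nonzerodiv_at_def)
next
  case (2 a)
  note t = sheaf_auto_sym[OF s] and sx = sheaf_auto_carrier[OF s x]
  have "regular_at V (s x) (\<lambda>y. a (t y))"
    using 2 by (intro regular_at_pull[OF t sx]) (simp add: sheaf_auto_inverse[OF s x])
  moreover have "near V (s x) (\<lambda>y. b (s (t y)) * a (t y) = 0)"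
    using 2 by (intro near_pull[OF t sx, where P = "\<lambda>y. b (s y) * a y = 0"])
      (simp add: sheaf_auto_inverse[OF s x])
  then have "near V (s x) (\<lambda>y. b y * a (t y) = 0)"
    by (rule near_mono) (simp add: sheaf_auto_inverse[OF t])
  ultimately have "near V (s x) (\<lambda>y. a (t y) = 0)"
    using nonzerodiv_at_cancel[OF b] by blast
  then have "near V x (\<lambda>y. a (t (s y)) = 0)"
    by (rule near_pull[OF s x])
  then show ?case
    by (rule near_mono) (simp add: sheaf_auto_inverse[OF s])
qed

lemma fraction_at_pull:
  "sheaf_auto V s t \<Longrightarrow> x \<in> carrier V \<Longrightarrow> fraction_at (s x) a b \<Longrightarrow> fraction_at x (\<lambda>y. a (s y)) (\<lambda>y. b (s y))"
  by (simp add: fraction_at_def regular_at_pull nonzerodiv_at_pull)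

lemma mpull_mfrac:
  assumes s: "sheaf_auto V s t" and x: "x \<in> carrier V" and ab: "fraction_at (s x) a b"
  shows "mpull V s x (mfrac V (s x) a b) = mfrac V x (\<lambda>y. a (s y)) (\<lambda>y. b (s y))"
  unfolding mpull_def
proof (rule UN_const_value[OF mfrac_self[OF ab]])
  fix q assume q: "q \<in> mfrac V (s x) a b"
  obtain c d where [simp]: "q = (c, d)"
    by (cases q)
  have cd: "fraction_at (s x) c d" "near V (s x) (\<lambda>y. a y * d y = c y * b y)"
    using q mfrac_memD[OF _ ab] by (auto simp: mfrac_def)
  have "near V x (\<lambda>y. a (s y) * d (s y) = c (s y) * b (s y))"
    using near_pull[OF s x cd(2)] .
  then show "(case q of (a, b) \<Rightarrow> mfrac V x (\<lambda>y. a (s y)) (\<lambda>y. b (s y))) = mfrac V x (\<lambda>y. a (s y)) (\<lambda>y. b (s y))"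
    using fraction_at_pull[OF s x ab] fraction_at_pull[OF s x cd(1)]
    by (auto simp: mfrac_eq_iff elim: near_mono)
qed

lemma mpull_hom:
  assumes s: "sheaf_auto V s t" and x: "x \<in> carrier V"
  shows "mpull V s x \<in> Ring.ring_hom (mer_stalk V (s x)) (mer_stalk V x)"
proof -
  have rep: "\<exists>a b. P = mfrac V (s x) a b \<and> fraction_at (s x) a b \<and>
      fraction_at x (\<lambda>y. a (s y)) (\<lambda>y. b (s y)) \<and> mpull V s x P = mfrac V x (\<lambda>y. a (s y)) (\<lambda>y. b (s y))"
    if P: "P \<in> carrier (mer_stalk V (s x))" for P
  proof -
    obtain a b where a: "P = mfrac V (s x) a b" "fraction_at (s x) a b"
      using P unfolding mer_stalk_carrier by blast
    show ?thesis
      using a fraction_at_pull[OF s x a(2)] mpull_mfrac[OF s x a(2)] by metis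
  qed
  show ?thesis
  proof (rule ring_hom_memI)
    fix P assume P: "P \<in> carrier (mer_stalk V (s x))"
    obtain a b where a: "P = mfrac V (s x) a b" "fraction_at (s x) a b"
        "fraction_at x (\<lambda>y. a (s y)) (\<lambda>y. b (s y))"
        "mpull V s x P = mfrac V x (\<lambda>y. a (s y)) (\<lambda>y. b (s y))"
      using rep[OF P] by (elim exE conjE)
    show "mpull V s x P \<in> carrier (mer_stalk V x)"
      unfolding a(4) by (rule mfrac_in_carrier[OF a(3)])
    fix Q assume Q: "Q \<in> carrier (mer_stalk V (s x))"
    obtain c d where c: "Q = mfrac V (s x) c d" "fraction_at (s x) c d"
        "fraction_at x (\<lambda>y. c (s y)) (\<lambda>y. d (s y))"
        "mpull V s x Q = mfrac V x (\<lambda>y. c (s y)) (\<lambda>y. d (s y))"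
      using rep[OF Q] by (elim exE conjE)
    show "mpull V s x (P \<otimes>\<^bsub>mer_stalk V (s x)\<^esub> Q) = mpull V s x P \<otimes>\<^bsub>mer_stalk V x\<^esub> mpull V s x Q"
      unfolding a(4) c(4) mfrac_mult[OF a(3) c(3)]
      unfolding a(1) c(1) mfrac_mult[OF a(2) c(2)]
      by (rule mpull_mfrac[OF s x fraction_at_mult[OF a(2) c(2)]])
    show "mpull V s x (P \<oplus>\<^bsub>mer_stalk V (s x)\<^esub> Q) = mpull V s x P \<oplus>\<^bsub>mer_stalk V x\<^esub> mpull V s x Q"
      unfolding a(4) c(4) mfrac_add[OF a(3) c(3)]
      unfolding a(1) c(1) mfrac_add[OF a(2) c(2)]
      by (rule mpull_mfrac[OF s x fraction_at_add[OF a(2) c(2)]])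
  next
    show "mpull V s x \<one>\<^bsub>mer_stalk V (s x)\<^esub> = \<one>\<^bsub>mer_stalk V x\<^esub>"
      unfolding mer_stalk_one
      by (rule mpull_mfrac[OF s x fraction_at_const[OF sheaf_auto_carrier[OF s x]]])
  qed
qed

lemma mpull_reg:
  assumes s: "sheaf_auto V s t" and x: "x \<in> carrier V" and P: "P \<in> carrier (reg_stalk V (s x))"
  shows "mpull V s x P \<in> carrier (reg_stalk V x)"
proof -
  obtain a where a: "P = mfrac V (s x) a (\<lambda>_. 1)" "fraction_at (s x) a (\<lambda>_. 1)"
    using P by (auto simp: reg_stalk_carrier)
  then show ?thesis
    using fraction_at_pull[OF s x a(2)] by (auto simp: mpull_mfrac[OF s x] reg_stalk_carrier)
qed

lemma mpull_mconst:
  "sheaf_auto V s t \<Longrightarrow> x \<in> carrier V \<Longrightarrow> mpull V s x (mconst V (s x) c) = mconst V x c"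
  by (simp add: mconst_def mpull_mfrac fraction_at_const sheaf_auto_carrier)

text \<open>
  The composite is given by a map \<open>u\<close> of its own, because the composites that occur agree with the
  expected map only on the carrier of the group.
\<close>

lemma mpull_mpull:
  assumes s: "sheaf_auto V s t" and s': "sheaf_auto V s' t'" and u: "sheaf_auto V u w"
    and x: "x \<in> carrier V" and P: "P \<in> carrier (mer_stalk V (s (s' x)))"
    and comp: "\<And>y. y \<in> carrier V \<Longrightarrow> s (s' y) = u y"
  shows "mpull V s' x (mpull V s (s' x) P) = mpull V u x P"
proof -
  obtain a b where a: "P = mfrac V (s (s' x)) a b" "fraction_at (s (s' x)) a b"
    using P by (auto simp: mer_stalk_carrier)
  note s'x = sheaf_auto_carrier[OF s' x]
  have "mpull V s' x (mpull V s (s' x) P) = mfrac V x (\<lambda>y. a (s (s' y))) (\<lambda>y. b (s (s' y)))"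
    by (simp add: a mpull_mfrac[OF s s'x] mpull_mfrac[OF s' x] fraction_at_pull[OF s s'x])
  also have "\<dots> = mfrac V x (\<lambda>y. a (u y)) (\<lambda>y. b (u y))"
    using comp by (intro mfrac_cong near_all[OF x]) simp_all
  also have "\<dots> = mpull V u x P"
    using a comp[OF x] mpull_mfrac[OF u x, of a b] by simp
  finally show ?thesis .
qed

lemma mpull_id:
  assumes s: "sheaf_auto V s t" and x: "x \<in> carrier V" and id: "\<And>y. y \<in> carrier V \<Longrightarrow> s y = y"
    and P: "P \<in> carrier (mer_stalk V x)"
  shows "mpull V s x P = P"
proof -
  obtain a b where a: "P = mfrac V x a b" "fraction_at x a b"
    using P by (auto simp: mer_stalk_carrier)
  then have "mpull V s x P = mfrac V x (\<lambda>y. a (s y)) (\<lambda>y. b (s y))"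
    using mpull_mfrac[OF s x, of a b] id[OF x] by simp
  also have "\<dots> = P"
    unfolding a(1) using id by (intro mfrac_cong near_all[OF x]) simp_all
  finally show ?thesis .
qed

end

section \<open>Families of germs\<close>

text \<open>
  The product of all stalks. It contains the global meromorphic functions as a subring and the
  finitely supported families as an ideal, so that all the actions and products below are operations
  of this one commutative ring.
\<close>

definition germ_families :: "('v, 'z) sgroup_scheme \<Rightarrow> ('v \<Rightarrow> 'v mgerm) ring" where
  "germ_families V = (mer_fun V)\<lparr>carrier := (\<Pi>\<^sub>E x\<in>carrier V. carrier (mer_stalk V x))\<rparr>"

definition const_family :: "('v, 'z) sgroup_scheme \<Rightarrow> complex \<Rightarrow> 'v \<Rightarrow> 'v mgerm" where
  "const_family V c = (\<lambda>x\<in>carrier V. mconst V x c)"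

definition family_pull ::
    "('v, 'z) sgroup_scheme \<Rightarrow> ('v \<Rightarrow> 'v) \<Rightarrow> ('v \<Rightarrow> 'v mgerm) \<Rightarrow> 'v \<Rightarrow> 'v mgerm" where
  "family_pull V s F = (\<lambda>x\<in>carrier V. mpull V s x (F (s x)))"

lemma germ_families_ops:
  "F \<otimes>\<^bsub>germ_families V\<^esub> H = (\<lambda>x\<in>carrier V. F x \<otimes>\<^bsub>mer_stalk V x\<^esub> H x)"
  "F \<oplus>\<^bsub>germ_families V\<^esub> H = (\<lambda>x\<in>carrier V. F x \<oplus>\<^bsub>mer_stalk V x\<^esub> H x)"
  "\<one>\<^bsub>germ_families V\<^esub> = (\<lambda>x\<in>carrier V. \<one>\<^bsub>mer_stalk V x\<^esub>)"
  "\<zero>\<^bsub>germ_families V\<^esub> = (\<lambda>x\<in>carrier V. \<zero>\<^bsub>mer_stalk V x\<^esub>)"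
  "carrier (germ_families V) = (\<Pi>\<^sub>E x\<in>carrier V. carrier (mer_stalk V x))"
  by (simp_all add: germ_families_def mer_fun_def)

lemma mer_fun_ops:
  "(\<otimes>\<^bsub>mer_fun V\<^esub>) = (\<otimes>\<^bsub>germ_families V\<^esub>)" "(\<oplus>\<^bsub>mer_fun V\<^esub>) = (\<oplus>\<^bsub>germ_families V\<^esub>)"
  "\<one>\<^bsub>mer_fun V\<^esub> = \<one>\<^bsub>germ_families V\<^esub>" "\<zero>\<^bsub>mer_fun V\<^esub> = \<zero>\<^bsub>germ_families V\<^esub>"
  by (simp_all add: germ_families_def)

context function_sheaf
begin

lemma families_eqI:
  assumes "F \<in> carrier (germ_families V)" "H \<in> carrier (germ_families V)"
    and "\<And>x. x \<in> carrier V \<Longrightarrow> F x = H x"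
  shows "F = H"
  using assms unfolding germ_families_ops by (rule PiE_ext)

lemma families_in: "F \<in> carrier (germ_families V) \<Longrightarrow> x \<in> carrier V \<Longrightarrow> F x \<in> carrier (mer_stalk V x)"
  by (auto simp: germ_families_ops)

lemma families_at:
  assumes "x \<in> carrier V"
  shows "(F \<otimes>\<^bsub>germ_families V\<^esub> H) x = F x \<otimes>\<^bsub>mer_stalk V x\<^esub> H x"
    and "(F \<oplus>\<^bsub>germ_families V\<^esub> H) x = F x \<oplus>\<^bsub>mer_stalk V x\<^esub> H x"
    and "\<one>\<^bsub>germ_families V\<^esub> x = \<one>\<^bsub>mer_stalk V x\<^esub>"
    and "\<zero>\<^bsub>germ_families V\<^esub> x = \<zero>\<^bsub>mer_stalk V x\<^esub>"
  using assms by (simp_all add: germ_families_ops)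

lemma families_cring: "cring (germ_families V)"
proof -
  let ?F = "germ_families V"
  have st: "cring (mer_stalk V x)" if "x \<in> carrier V" for x
    using that by (rule mer_stalk_cring)
  note stR = cring.axioms(1)[OF st] and stM = cring.axioms(2)[OF st]
  note stG = ring.is_abelian_group[OF stR] and stm = ring.is_monoid[OF stR]
  note abg = abelian_group.axioms(1)[OF stG]
  have closed: "F \<otimes>\<^bsub>?F\<^esub> H \<in> carrier ?F" "F \<oplus>\<^bsub>?F\<^esub> H \<in> carrier ?F"
    if "F \<in> carrier ?F" "H \<in> carrier ?F" for F H
    using that abelian_monoid.a_closed[OF abg] monoid.m_closed[OF stm]
    by (auto simp: germ_families_ops PiE_iff)
  have units: "\<one>\<^bsub>?F\<^esub> \<in> carrier ?F" "\<zero>\<^bsub>?F\<^esub> \<in> carrier ?F"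
    using abelian_monoid.zero_closed[OF abg] monoid.one_closed[OF stm]
    by (auto simp: germ_families_ops)
  show ?thesis
  proof (rule cringI)
    show "abelian_group ?F"
    proof (rule abelian_groupI)
      fix F H assume F: "F \<in> carrier ?F" and H: "H \<in> carrier ?F"
      show "F \<oplus>\<^bsub>?F\<^esub> H \<in> carrier ?F"
        using F H by (rule closed)
      show "F \<oplus>\<^bsub>?F\<^esub> H = H \<oplus>\<^bsub>?F\<^esub> F"
        using abelian_monoid.a_comm[OF abg] families_in F H
        by (intro families_eqI closed F H) (simp add: families_at)
      fix K assume K: "K \<in> carrier ?F"
      show "F \<oplus>\<^bsub>?F\<^esub> H \<oplus>\<^bsub>?F\<^esub> K = F \<oplus>\<^bsub>?F\<^esub> (H \<oplus>\<^bsub>?F\<^esub> K)"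
        using abelian_monoid.a_assoc[OF abg] families_in F H K
        by (intro families_eqI closed F H K) (simp add: families_at)
    next
      show "\<zero>\<^bsub>?F\<^esub> \<in> carrier ?F"
        by (rule units)
    next
      fix F assume F: "F \<in> carrier ?F"
      show "\<zero>\<^bsub>?F\<^esub> \<oplus>\<^bsub>?F\<^esub> F = F"
        using abelian_monoid.l_zero[OF abg] families_in F
        by (intro families_eqI closed F units) (simp add: families_at)
      define H where "H = (\<lambda>x\<in>carrier V. \<ominus>\<^bsub>mer_stalk V x\<^esub> F x)"
      have H: "H \<in> carrier ?F"
        using abelian_group.a_inv_closed[OF stG] families_in F by (simp add: germ_families_ops H_def)
      have "H \<oplus>\<^bsub>?F\<^esub> F = \<zero>\<^bsub>?F\<^esub>"
        using abelian_group.l_neg[OF stG] families_in F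
        by (intro families_eqI closed F H units) (simp add: families_at H_def)
      with H show "\<exists>H\<in>carrier ?F. H \<oplus>\<^bsub>?F\<^esub> F = \<zero>\<^bsub>?F\<^esub>"
        by blast
    qed
    show "comm_monoid ?F"
    proof (rule comm_monoidI)
      fix F H assume F: "F \<in> carrier ?F" and H: "H \<in> carrier ?F"
      show "F \<otimes>\<^bsub>?F\<^esub> H \<in> carrier ?F"
        using F H by (rule closed)
      show "F \<otimes>\<^bsub>?F\<^esub> H = H \<otimes>\<^bsub>?F\<^esub> F"
        using comm_monoid.m_comm[OF stM] families_in F H
        by (intro families_eqI closed F H) (simp add: families_at)
      fix K assume K: "K \<in> carrier ?F"
      show "F \<otimes>\<^bsub>?F\<^esub> H \<otimes>\<^bsub>?F\<^esub> K = F \<otimes>\<^bsub>?F\<^esub> (H \<otimes>\<^bsub>?F\<^esub> K)"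
        using monoid.m_assoc[OF stm] families_in F H K
        by (intro families_eqI closed F H K) (simp add: families_at)
    next
      show "\<one>\<^bsub>?F\<^esub> \<in> carrier ?F"
        by (rule units)
    next
      fix F assume F: "F \<in> carrier ?F"
      show "\<one>\<^bsub>?F\<^esub> \<otimes>\<^bsub>?F\<^esub> F = F"
        using monoid.l_one[OF stm] families_in F
        by (intro families_eqI closed F units) (simp add: families_at)
    qed
    fix F H K assume F: "F \<in> carrier ?F" and H: "H \<in> carrier ?F" and K: "K \<in> carrier ?F"
    show "(F \<oplus>\<^bsub>?F\<^esub> H) \<otimes>\<^bsub>?F\<^esub> K = F \<otimes>\<^bsub>?F\<^esub> K \<oplus>\<^bsub>?F\<^esub> H \<otimes>\<^bsub>?F\<^esub> K"
      using ring.ring_simprules(13)[OF stR] families_in F H K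
      by (intro families_eqI closed F H K) (simp add: families_at)
  qed
qed

sublocale fam: cring "germ_families V"
  by (rule families_cring)

lemma finsum_families_at:
  assumes x: "x \<in> carrier V" and f: "f \<in> S \<rightarrow> carrier (germ_families V)"
  shows "(\<Oplus>\<^bsub>germ_families V\<^esub>i\<in>S. f i) x = (\<Oplus>\<^bsub>mer_stalk V x\<^esub>i\<in>S. f i x)"
proof -
  interpret R: cring "mer_stalk V x"
    by (rule mer_stalk_cring[OF x])
  interpret h: ring_hom_cring "germ_families V" "mer_stalk V x" "\<lambda>F. F x"
    by unfold_locales (auto intro!: ring_hom_memI simp: families_at[OF x] families_in[OF _ x])
  show ?thesis
    using h.hom_finsum[OF f] by (simp add: o_def)
qed

lemma const_family_closed: "const_family V c \<in> carrier (germ_families V)"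
  by (simp add: const_family_def germ_families_ops mconst_carrier)

lemma const_family_at: "x \<in> carrier V \<Longrightarrow> const_family V c x = mconst V x c"
  by (simp add: const_family_def)

lemma const_family_ops:
  "const_family V (c + d) = const_family V c \<oplus>\<^bsub>germ_families V\<^esub> const_family V d"
  "const_family V (c * d) = const_family V c \<otimes>\<^bsub>germ_families V\<^esub> const_family V d"
  "const_family V 1 = \<one>\<^bsub>germ_families V\<^esub>" "const_family V 0 = \<zero>\<^bsub>germ_families V\<^esub>"
  unfolding const_family_def germ_families_ops
  by (rule restrict_ext, simp add: mconst_ops)+

subsection \<open>Global meromorphic functions\<close>

lemma mer_fun_carrier:
  "f \<in> carrier (mer_fun V) \<longleftrightarrow> f \<in> extensional (carrier V) \<and> (\<forall>x\<in>carrier V. \<exists>U a b.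
      openin (topo V) U \<and> x \<in> U \<and> a \<in> sections V U \<and> b \<in> sections V U \<and>
      (\<forall>y\<in>U. fraction_at y a b \<and> f y = mfrac V y a b))"
proof -
  have "(openin (topo V) U \<and> x \<in> U \<and> a \<in> sections V U \<and> b \<in> sections V U \<and>
          (\<forall>y\<in>U. nonzerodiv_at V y b \<and> f y = mfrac V y a b))
      \<longleftrightarrow> (openin (topo V) U \<and> x \<in> U \<and> a \<in> sections V U \<and> b \<in> sections V U \<and>
          (\<forall>y\<in>U. fraction_at y a b \<and> f y = mfrac V y a b))" for U x a b
    by (auto simp: fraction_at_def regular_at_def)
  then show ?thesis
    unfolding mer_fun_def partial_object.select_convs mem_Collect_eq by (simp only:)
qed

lemma mer_fun_families: "f \<in> carrier (mer_fun V) \<Longrightarrow> f \<in> carrier (germ_families V)"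
  by (fastforce simp: mer_fun_carrier germ_families_ops PiE_iff mer_stalk_carrier)

lemma mer_fun_obtain2:
  assumes f: "f \<in> carrier (mer_fun V)" and h: "h \<in> carrier (mer_fun V)" and x: "x \<in> carrier V"
  obtains U a b c d where "openin (topo V) U" "x \<in> U"
    "a \<in> sections V U" "b \<in> sections V U" "c \<in> sections V U" "d \<in> sections V U"
    "\<And>y. y \<in> U \<Longrightarrow> fraction_at y a b" "\<And>y. y \<in> U \<Longrightarrow> fraction_at y c d"
    "\<And>y. y \<in> U \<Longrightarrow> f y = mfrac V y a b" "\<And>y. y \<in> U \<Longrightarrow> h y = mfrac V y c d"
proof -
  obtain A a b where A: "openin (topo V) A" "x \<in> A" "a \<in> sections V A" "b \<in> sections V A"
    "\<forall>y\<in>A. fraction_at y a b \<and> f y = mfrac V y a b"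
    using f x unfolding mer_fun_carrier by blast
  obtain B c d where B: "openin (topo V) B" "x \<in> B" "c \<in> sections V B" "d \<in> sections V B"
    "\<forall>y\<in>B. fraction_at y c d \<and> h y = mfrac V y c d"
    using h x unfolding mer_fun_carrier by blast
  have AB: "openin (topo V) (A \<inter> B)"
    using A B by blast
  note ra = sections_restrict[OF A(1) AB Int_lower1] and rb = sections_restrict[OF B(1) AB Int_lower2]
  show thesis
    by (rule that[OF AB _ ra[OF A(3)] ra[OF A(4)] rb[OF B(3)] rb[OF B(4)]]) (use A B in auto)
qed

lemma mer_fun_closed:
  assumes f: "f \<in> carrier (mer_fun V)" and h: "h \<in> carrier (mer_fun V)"
  shows "f \<oplus>\<^bsub>germ_families V\<^esub> h \<in> carrier (mer_fun V)" (is ?add)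
    and "f \<otimes>\<^bsub>germ_families V\<^esub> h \<in> carrier (mer_fun V)" (is ?mult)
proof -
  have "(\<exists>U a b. openin (topo V) U \<and> x \<in> U \<and> a \<in> sections V U \<and> b \<in> sections V U \<and>
      (\<forall>y\<in>U. fraction_at y a b \<and> (f \<oplus>\<^bsub>germ_families V\<^esub> h) y = mfrac V y a b))
    \<and> (\<exists>U a b. openin (topo V) U \<and> x \<in> U \<and> a \<in> sections V U \<and> b \<in> sections V U \<and>
      (\<forall>y\<in>U. fraction_at y a b \<and> (f \<otimes>\<^bsub>germ_families V\<^esub> h) y = mfrac V y a b))" (is "?A \<and> ?M")
    if x: "x \<in> carrier V" for x
  proof -
    obtain U a b c d where U: "openin (topo V) U" "x \<in> U"
      and s: "a \<in> sections V U" "b \<in> sections V U" "c \<in> sections V U" "d \<in> sections V U"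
      and fr: "\<And>y. y \<in> U \<Longrightarrow> fraction_at y a b" "\<And>y. y \<in> U \<Longrightarrow> fraction_at y c d"
      and eq: "\<And>y. y \<in> U \<Longrightarrow> f y = mfrac V y a b" "\<And>y. y \<in> U \<Longrightarrow> h y = mfrac V y c d"
      using mer_fun_obtain2[OF f h x] by blast
    have in_V: "y \<in> carrier V" if "y \<in> U" for y
      using that U openin_carrier by blast
    have ?A
      using U s fr eq in_V
      by (intro exI[of _ U] exI[of _ "\<lambda>y. a y * d y + c y * b y"] exI[of _ "\<lambda>y. b y * d y"] conjI ballI)
         (simp_all add: sections_add sections_mult fraction_at_add families_at mfrac_add)
    moreover have ?M
      using U s fr eq in_V
      by (intro exI[of _ U] exI[of _ "\<lambda>y. a y * c y"] exI[of _ "\<lambda>y. b y * d y"] conjI ballI)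
         (simp_all add: sections_mult fraction_at_mult families_at mfrac_mult)
    ultimately show ?thesis ..
  qed
  then show ?add ?mult
    unfolding mer_fun_carrier by (simp_all add: germ_families_ops)
qed

lemma const_family_mer_fun: "const_family V c \<in> carrier (mer_fun V)"
  unfolding mer_fun_carrier
proof (intro conjI ballI)
  fix x assume x: "x \<in> carrier V"
  have V: "openin (topo V) (carrier V)"
    using openin_topspace[of "topo V"] by (simp add: topspace_eq)
  show "\<exists>U a b. openin (topo V) U \<and> x \<in> U \<and> a \<in> sections V U \<and> b \<in> sections V U \<and>
      (\<forall>y\<in>U. fraction_at y a b \<and> const_family V c y = mfrac V y a b)"
    using V x
    by (intro exI[of _ "carrier V"] exI[of _ "\<lambda>_. c"] exI[of _ "\<lambda>_. 1"])
       (simp add: sections_const fraction_at_const const_family_def mconst_def)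
qed (simp add: const_family_def)

text \<open>
  The coefficients of a product in the skew-group ring are sums in the ring of meromorphic functions;
  they may be computed in the product of the stalks.
\<close>

lemma finsum_mer_fun:
  assumes "finite S" "f \<in> S \<rightarrow> carrier (mer_fun V)"
  shows "(\<Oplus>\<^bsub>mer_fun V\<^esub>i\<in>S. f i) = (\<Oplus>\<^bsub>germ_families V\<^esub>i\<in>S. f i)
    \<and> (\<Oplus>\<^bsub>mer_fun V\<^esub>i\<in>S. f i) \<in> carrier (mer_fun V)"
proof -
  have zero: "\<zero>\<^bsub>germ_families V\<^esub> \<in> carrier (mer_fun V)"
    using const_family_mer_fun[of 0] by (simp add: const_family_ops)
  interpret M: abelian_monoid "mer_fun V"
  proof (rule abelian_monoidI)
    show "\<zero>\<^bsub>mer_fun V\<^esub> \<in> carrier (mer_fun V)"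
      by (simp add: mer_fun_ops zero)
    fix f h k assume f: "f \<in> carrier (mer_fun V)"
    show "\<zero>\<^bsub>mer_fun V\<^esub> \<oplus>\<^bsub>mer_fun V\<^esub> f = f"
      using mer_fun_families[OF f] by (simp add: mer_fun_ops)
    assume h: "h \<in> carrier (mer_fun V)"
    show "f \<oplus>\<^bsub>mer_fun V\<^esub> h \<in> carrier (mer_fun V)"
      using mer_fun_closed[OF f h] by (simp add: mer_fun_ops)
    show "f \<oplus>\<^bsub>mer_fun V\<^esub> h = h \<oplus>\<^bsub>mer_fun V\<^esub> f"
      using f h by (simp add: mer_fun_ops fam.a_comm mer_fun_families)
    assume k: "k \<in> carrier (mer_fun V)"
    show "f \<oplus>\<^bsub>mer_fun V\<^esub> h \<oplus>\<^bsub>mer_fun V\<^esub> k = f \<oplus>\<^bsub>mer_fun V\<^esub> (h \<oplus>\<^bsub>mer_fun V\<^esub> k)"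
      using f h k by (simp add: mer_fun_ops fam.a_assoc mer_fun_families)
  qed
  from assms show ?thesis
  proof (induction S)
    case empty
    then show ?case by (simp add: mer_fun_ops zero)
  next
    case (insert i S)
    have fi: "f i \<in> carrier (mer_fun V)" and fS: "f \<in> S \<rightarrow> carrier (mer_fun V)"
      using insert.prems by auto
    note IH = insert.IH[OF fS]
    have fams: "f i \<in> carrier (germ_families V)" "f \<in> S \<rightarrow> carrier (germ_families V)"
      using fi fS mer_fun_families by auto
    have mer: "(\<Oplus>\<^bsub>mer_fun V\<^esub>i\<in>insert i S. f i) = f i \<oplus>\<^bsub>germ_families V\<^esub> (\<Oplus>\<^bsub>mer_fun V\<^esub>i\<in>S. f i)"
      using insert.hyps fi fS by (simp add: M.finsum_insert mer_fun_ops)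
    also have "\<dots> = (\<Oplus>\<^bsub>germ_families V\<^esub>i\<in>insert i S. f i)"
      using insert.hyps fams IH by (simp add: fam.finsum_insert)
    finally have "(\<Oplus>\<^bsub>mer_fun V\<^esub>i\<in>insert i S. f i) = (\<Oplus>\<^bsub>germ_families V\<^esub>i\<in>insert i S. f i)" .
    moreover have "(\<Oplus>\<^bsub>mer_fun V\<^esub>i\<in>insert i S. f i) \<in> carrier (mer_fun V)"
      unfolding mer using fi IH by (intro mer_fun_closed(1)) auto
    ultimately show ?case ..
  qed
qed

subsection \<open>Pull-back of families\<close>

lemma family_pull_at: "x \<in> carrier V \<Longrightarrow> family_pull V s F x = mpull V s x (F (s x))"
  by (simp add: family_pull_def)

lemma family_pull_hom:
  assumes s: "sheaf_auto V s t"
  shows "family_pull V s \<in> Ring.ring_hom (germ_families V) (germ_families V)"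
proof -
  have closed: "family_pull V s F \<in> carrier (germ_families V)" if F: "F \<in> carrier (germ_families V)" for F
    using ring_hom_closed[OF mpull_hom[OF s]] families_in[OF F] sheaf_auto_carrier[OF s]
    by (simp add: germ_families_ops family_pull_def)
  note hom = mpull_hom[OF s] and sc = sheaf_auto_carrier[OF s]
  show ?thesis
  proof (rule ring_hom_memI)
    fix F H assume F: "F \<in> carrier (germ_families V)" and H: "H \<in> carrier (germ_families V)"
    show "family_pull V s F \<in> carrier (germ_families V)"
      using F by (rule closed)
    show "family_pull V s (F \<otimes>\<^bsub>germ_families V\<^esub> H) = family_pull V s F \<otimes>\<^bsub>germ_families V\<^esub> family_pull V s H"
      and "family_pull V s (F \<oplus>\<^bsub>germ_families V\<^esub> H) = family_pull V s F \<oplus>\<^bsub>germ_families V\<^esub> family_pull V s H"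
      using families_in[OF F sc] families_in[OF H sc]
      by (auto intro!: families_eqI closed F H
          simp: families_at family_pull_at sc ring_hom_mult[OF hom] ring_hom_add[OF hom])
  next
    show "family_pull V s \<one>\<^bsub>germ_families V\<^esub> = \<one>\<^bsub>germ_families V\<^esub>"
      by (intro families_eqI closed) (simp_all add: families_at family_pull_at sc ring_hom_one[OF hom])
  qed
qed

lemma family_pull_closed:
  "sheaf_auto V s t \<Longrightarrow> F \<in> carrier (germ_families V) \<Longrightarrow> family_pull V s F \<in> carrier (germ_families V)"
  using ring_hom_closed[OF family_pull_hom] .

lemma family_pull_comp:
  assumes s: "sheaf_auto V s t" and s': "sheaf_auto V s' t'" and u: "sheaf_auto V u w"
    and F: "F \<in> carrier (germ_families V)" and comp: "\<And>y. y \<in> carrier V \<Longrightarrow> s (s' y) = u y"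
  shows "family_pull V s' (family_pull V s F) = family_pull V u F"
proof (intro families_eqI family_pull_closed[OF s'] family_pull_closed[OF s] family_pull_closed[OF u] F)
  fix x assume x: "x \<in> carrier V"
  then have "s' x \<in> carrier V" "s (s' x) \<in> carrier V"
    using sheaf_auto_carrier[OF s] sheaf_auto_carrier[OF s'] by auto
  then have "mpull V s' x (mpull V s (s' x) (F (s (s' x)))) = mpull V u x (F (s (s' x)))"
    using x comp F by (intro mpull_mpull[OF s s' u]) (auto intro: families_in)
  then show "family_pull V s' (family_pull V s F) x = family_pull V u F x"
    using x \<open>s' x \<in> carrier V\<close> comp by (simp add: family_pull_at)
qed

lemma family_pull_id:
  assumes s: "sheaf_auto V s t" and F: "F \<in> carrier (germ_families V)"
    and id: "\<And>y. y \<in> carrier V \<Longrightarrow> s y = y"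
  shows "family_pull V s F = F"
  using mpull_id[OF s] id families_in[OF F]
  by (intro families_eqI family_pull_closed[OF s] F) (simp add: family_pull_at)

lemma family_pull_const: "sheaf_auto V s t \<Longrightarrow> family_pull V s (const_family V c) = const_family V c"
  unfolding family_pull_def const_family_def
  by (rule restrict_ext) (simp add: sheaf_auto_carrier mpull_mconst)

lemma family_pull_mer_fun:
  assumes s: "sheaf_auto V s t" and f: "f \<in> carrier (mer_fun V)"
  shows "family_pull V s f \<in> carrier (mer_fun V)"
  unfolding mer_fun_carrier
proof (intro conjI ballI)
  fix x assume x: "x \<in> carrier V"
  obtain U a b where U: "openin (topo V) U" "s x \<in> U" and ab: "a \<in> sections V U" "b \<in> sections V U"
    and fr: "\<forall>y\<in>U. fraction_at y a b \<and> f y = mfrac V y a b"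
    using f sheaf_auto_carrier[OF s x] unfolding mer_fun_carrier by blast
  let ?U = "{y \<in> carrier V. s y \<in> U}"
  have "fraction_at y (\<lambda>y. a (s y)) (\<lambda>y. b (s y)) \<and>
      family_pull V s f y = mfrac V y (\<lambda>y. a (s y)) (\<lambda>y. b (s y))" if y: "y \<in> ?U" for y
  proof -
    have "y \<in> carrier V" and sy: "fraction_at (s y) a b" "f (s y) = mfrac V (s y) a b"
      using y fr by auto
    then show ?thesis
      using fraction_at_pull[OF s _ sy(1)] mpull_mfrac[OF s _ sy(1)] by (simp add: family_pull_at)
  qed
  then have "\<forall>y\<in>?U. fraction_at y (\<lambda>y. a (s y)) (\<lambda>y. b (s y)) \<and>
      family_pull V s f y = mfrac V y (\<lambda>y. a (s y)) (\<lambda>y. b (s y))"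
    by simp
  moreover have "x \<in> ?U"
    using U x by simp
  ultimately show "\<exists>U a b. openin (topo V) U \<and> x \<in> U \<and> a \<in> sections V U \<and> b \<in> sections V U \<and>
      (\<forall>y\<in>U. fraction_at y a b \<and> family_pull V s f y = mfrac V y a b)"
    using openin_preimage[OF s U(1)] sections_preimage[OF s U(1) ab(1)] sections_preimage[OF s U(1) ab(2)]
    by (intro exI[of _ ?U] exI[of _ "\<lambda>y. a (s y)"] exI[of _ "\<lambda>y. b (s y)"] conjI)
qed (simp add: family_pull_def)

end

section \<open>The skew-group ring acting on families of germs\<close>

context sheaf_group
begin

lemma left_mult_auto:
  assumes "\<xi> \<in> carrier V"
  shows "sheaf_auto V (\<lambda>y. inv \<xi> \<otimes> y) (\<lambda>y. \<xi> \<otimes> y)"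
  using assms morphism_left_mult[of \<xi>] morphism_left_mult[of "inv \<xi>"]
  by (simp add: sheaf_auto_def m_assoc [symmetric])

lemma left_mult_cancel: "\<xi> \<in> carrier V \<Longrightarrow> x \<in> carrier V \<Longrightarrow> inv \<xi> \<otimes> (\<xi> \<otimes> x) = x"
  "\<xi> \<in> carrier V \<Longrightarrow> x \<in> carrier V \<Longrightarrow> \<xi> \<otimes> (inv \<xi> \<otimes> x) = x"
  by (simp_all add: m_assoc [symmetric])

lemma germ_trans_hom:
  assumes "\<xi> \<in> carrier V" "x \<in> carrier V"
  shows "germ_trans V \<xi> x \<in> Ring.ring_hom (mer_stalk V x) (mer_stalk V (\<xi> \<otimes> x))"
  using mpull_hom[OF left_mult_auto[OF assms(1)], of "\<xi> \<otimes> x"] assms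
  by (simp add: germ_trans_def left_mult_cancel)

lemma germ_trans_reg:
  assumes "\<xi> \<in> carrier V" "x \<in> carrier V" "P \<in> carrier (reg_stalk V x)"
  shows "germ_trans V \<xi> x P \<in> carrier (reg_stalk V (\<xi> \<otimes> x))"
  using mpull_reg[OF left_mult_auto[OF assms(1)], of "\<xi> \<otimes> x" P] assms
  by (simp add: germ_trans_def left_mult_cancel)

lemma germ_trans_comp:
  assumes \<xi>: "\<xi> \<in> carrier V" and \<eta>: "\<eta> \<in> carrier V" and x: "x \<in> carrier V"
    and P: "P \<in> carrier (mer_stalk V x)"
  shows "germ_trans V \<xi> (\<eta> \<otimes> x) (germ_trans V \<eta> x P) = germ_trans V (\<xi> \<otimes> \<eta>) x P"
  using mpull_mpull[OF left_mult_auto[OF \<eta>] left_mult_auto[OF \<xi>] left_mult_auto[OF m_closed[OF \<xi> \<eta>]],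
      of "\<xi> \<otimes> (\<eta> \<otimes> x)" P] assms
  by (simp add: germ_trans_def left_mult_cancel m_assoc inv_mult_group)

lemma germ_trans_one:
  assumes "x \<in> carrier V" "P \<in> carrier (mer_stalk V x)"
  shows "germ_trans V \<one> x P = P"
  using mpull_id[OF left_mult_auto[OF one_closed], of x P] assms by (simp add: germ_trans_def)

lemma family_trans_pull:
  assumes "\<xi> \<in> carrier V"
  shows "family_trans V \<xi> F = family_pull V (\<lambda>y. inv \<xi> \<otimes> y) F"
  unfolding family_trans_def family_pull_def germ_trans_def
  by (rule restrict_ext) (simp add: assms left_mult_cancel)

lemma family_trans_hom:
  assumes "\<xi> \<in> carrier V"
  shows "family_trans V \<xi> \<in> Ring.ring_hom (germ_families V) (germ_families V)"
proof -
  have "family_trans V \<xi> = family_pull V (\<lambda>y. inv \<xi> \<otimes> y)"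
    by (rule ext) (rule family_trans_pull[OF assms])
  then show ?thesis
    using family_pull_hom[OF left_mult_auto[OF assms]] by simp
qed

lemma family_trans_ring_hom:
  "\<xi> \<in> carrier V \<Longrightarrow> ring_hom_cring (germ_families V) (germ_families V) (family_trans V \<xi>)"
  by (rule ring_hom_cringI, unfold_locales) (auto intro: family_trans_hom)

lemma family_trans_closed:
  "\<xi> \<in> carrier V \<Longrightarrow> F \<in> carrier (germ_families V) \<Longrightarrow> family_trans V \<xi> F \<in> carrier (germ_families V)"
  using ring_hom_closed[OF family_trans_hom] .

lemma family_trans_comp:
  assumes \<xi>: "\<xi> \<in> carrier V" and \<eta>: "\<eta> \<in> carrier V" and F: "F \<in> carrier (germ_families V)"
  shows "family_trans V \<xi> (family_trans V \<eta> F) = family_trans V (\<xi> \<otimes> \<eta>) F"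
  using family_pull_comp[OF left_mult_auto[OF \<eta>] left_mult_auto[OF \<xi>] left_mult_auto[OF m_closed[OF \<xi> \<eta>]] F] assms
  by (simp add: family_trans_pull inv_mult_group m_assoc)

lemma family_trans_one: "F \<in> carrier (germ_families V) \<Longrightarrow> family_trans V \<one> F = F"
  using family_pull_id[OF left_mult_auto[OF one_closed]] by (simp add: family_trans_pull)

lemma family_trans_const: "\<xi> \<in> carrier V \<Longrightarrow> family_trans V \<xi> (const_family V c) = const_family V c"
  using family_pull_const[OF left_mult_auto] by (simp add: family_trans_pull)

lemma family_trans_mer_fun: "\<xi> \<in> carrier V \<Longrightarrow> f \<in> carrier (mer_fun V) \<Longrightarrow> family_trans V \<xi> f \<in> carrier (mer_fun V)"
  using family_pull_mer_fun[OF left_mult_auto] by (simp add: family_trans_pull)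

text \<open>The spread of a germ at the identity over the whole group by left translation.\<close>

definition spread_germ :: "'v mgerm \<Rightarrow> 'v \<Rightarrow> 'v mgerm" where
  "spread_germ P = (\<lambda>x\<in>carrier V. germ_trans V x \<one> P)"

lemma spread_germ_closed:
  "P \<in> carrier (mer_stalk V \<one>) \<Longrightarrow> spread_germ P \<in> carrier (germ_families V)"
  using ring_hom_closed[OF germ_trans_hom[OF _ one_closed]] by (auto simp: spread_germ_def germ_families_ops)

text \<open>
  At \<open>x\<close> this is \<open>\<phi>\<^sub>\<xi> \<circ> \<phi>\<^bsub>\<xi>\<^sup>-\<^sup>1x\<^esub> = \<phi>\<^sub>x\<close>.
\<close>

lemma spread_germ_invariant:
  assumes P: "P \<in> carrier (mer_stalk V \<one>)" and \<xi>: "\<xi> \<in> carrier V"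
  shows "family_trans V \<xi> (spread_germ P) = spread_germ P"
proof (intro families_eqI family_trans_closed spread_germ_closed P \<xi>)
  fix x assume x: "x \<in> carrier V"
  then have y: "inv \<xi> \<otimes> x \<in> carrier V"
    using \<xi> by simp
  from germ_trans_comp[OF \<xi> y one_closed P] show "family_trans V \<xi> (spread_germ P) x = spread_germ P x"
    using x y \<xi> by (simp add: family_trans_def spread_germ_def left_mult_cancel)
qed

end

locale translation_subgroup = sheaf_group V for V :: "('v, 'z) sgroup_scheme" (structure) +
  fixes \<Gamma> :: "'v set"
  assumes subgroup: "subgroup \<Gamma> V"
begin

lemma \<Gamma>_carrier: "\<xi> \<in> \<Gamma> \<Longrightarrow> \<xi> \<in> carrier V"
  using subgroup.subset[OF subgroup] by blast

abbreviation "\<FF> \<equiv> germ_families V"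

lemma skew_coeff:
  "A \<in> \<Gamma> \<rightarrow>\<^sub>E carrier (mer_fun V) \<Longrightarrow> \<xi> \<in> \<Gamma> \<Longrightarrow> A \<xi> \<in> carrier \<FF>"
  by (rule mer_fun_families) (erule PiE_mem)

lemma skew_term_closed:
  assumes "A \<in> \<Gamma> \<rightarrow>\<^sub>E carrier (mer_fun V)" "F \<in> carrier \<FF>" "\<xi> \<in> \<Gamma>"
  shows "A \<xi> \<otimes>\<^bsub>\<FF>\<^esub> family_trans V \<xi> F \<in> carrier \<FF>"
  by (rule fam.m_closed[OF skew_coeff[OF assms(1,3)] family_trans_closed[OF \<Gamma>_carrier[OF assms(3)] assms(2)]])

text \<open>
  The sum may be taken over any finite set containing the support. For sums and products of ring elements
  this avoids having to determine the support exactly.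
\<close>

lemma skew_act_eq:
  assumes A: "A \<in> \<Gamma> \<rightarrow>\<^sub>E carrier (mer_fun V)" and F: "F \<in> carrier \<FF>"
    and S: "finite S" "skew_support V \<Gamma> A \<subseteq> S" "S \<subseteq> \<Gamma>"
  shows "skew_act V \<Gamma> A F = (\<Oplus>\<^bsub>\<FF>\<^esub>\<xi>\<in>S. A \<xi> \<otimes>\<^bsub>\<FF>\<^esub> family_trans V \<xi> F)"
proof -
  let ?t = "\<lambda>\<xi>. A \<xi> \<otimes>\<^bsub>\<FF>\<^esub> family_trans V \<xi> F"
  have t: "?t \<in> S \<rightarrow> carrier \<FF>"
    using skew_term_closed[OF A F] S by blast
  have t': "?t \<in> skew_support V \<Gamma> A \<rightarrow> carrier \<FF>"
    using t S by blast
  have "skew_act V \<Gamma> A F = (\<Oplus>\<^bsub>\<FF>\<^esub>\<xi>\<in>skew_support V \<Gamma> A. ?t \<xi>)"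
  proof (rule extensionalityI[of _ "carrier V"])
    show "skew_act V \<Gamma> A F \<in> extensional (carrier V)"
      by (simp add: skew_act_def)
    show "(\<Oplus>\<^bsub>\<FF>\<^esub>\<xi>\<in>skew_support V \<Gamma> A. ?t \<xi>) \<in> extensional (carrier V)"
      using fam.finsum_closed[OF t'] by (simp add: germ_families_ops(5) PiE_iff)
    fix x assume x: "x \<in> carrier V"
    show "skew_act V \<Gamma> A F x = (\<Oplus>\<^bsub>\<FF>\<^esub>\<xi>\<in>skew_support V \<Gamma> A. ?t \<xi>) x"
      unfolding finsum_families_at[OF x t'] using x by (simp add: skew_act_def families_at)
  qed
  also have "\<dots> = (\<Oplus>\<^bsub>\<FF>\<^esub>\<xi>\<in>S. ?t \<xi>)"
  proof (rule fam.add.finprod_mono_neutral_cong_left)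
    fix \<xi> assume \<xi>: "\<xi> \<in> S - skew_support V \<Gamma> A"
    then have "A \<xi> = \<zero>\<^bsub>\<FF>\<^esub>" "\<xi> \<in> \<Gamma>"
      using S by (auto simp: skew_support_def mer_fun_ops)
    then show "?t \<xi> = \<zero>\<^bsub>\<FF>\<^esub>"
      using F by (simp add: family_trans_closed \<Gamma>_carrier)
  qed (use S t in auto)
  finally show ?thesis .
qed

lemma skew_ring_carrier:
  "A \<in> carrier (skew_ring V \<Gamma>) \<longleftrightarrow> A \<in> \<Gamma> \<rightarrow>\<^sub>E carrier (mer_fun V) \<and> finite (skew_support V \<Gamma> A)"
  by (simp add: skew_ring_def)

lemma skew_support_subset: "skew_support V \<Gamma> A \<subseteq> \<Gamma>"
  by (auto simp: skew_support_def)

context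
  fixes A assumes A: "A \<in> carrier (skew_ring V \<Gamma>)"
begin

private lemma A_fun: "A \<in> \<Gamma> \<rightarrow>\<^sub>E carrier (mer_fun V)" and A_fin: "finite (skew_support V \<Gamma> A)"
  using A by (simp_all add: skew_ring_carrier)

lemma skew_act_sum:
  "F \<in> carrier \<FF> \<Longrightarrow>
    skew_act V \<Gamma> A F = (\<Oplus>\<^bsub>\<FF>\<^esub>\<xi>\<in>skew_support V \<Gamma> A. A \<xi> \<otimes>\<^bsub>\<FF>\<^esub> family_trans V \<xi> F)"
  by (rule skew_act_eq[OF A_fun _ A_fin subset_refl skew_support_subset])

private lemma term_closed:
  "F \<in> carrier \<FF> \<Longrightarrow> (\<lambda>\<xi>. A \<xi> \<otimes>\<^bsub>\<FF>\<^esub> family_trans V \<xi> F) \<in> skew_support V \<Gamma> A \<rightarrow> carrier \<FF>"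
  using skew_term_closed[OF A_fun] skew_support_subset by blast

lemma skew_act_closed: "F \<in> carrier \<FF> \<Longrightarrow> skew_act V \<Gamma> A F \<in> carrier \<FF>"
  by (simp add: skew_act_sum fam.finsum_closed term_closed)

private lemma support_carrier:
  "\<xi> \<in> skew_support V \<Gamma> A \<Longrightarrow> \<xi> \<in> carrier V \<and> A \<xi> \<in> carrier \<FF>"
  using skew_support_subset skew_coeff[OF A_fun] \<Gamma>_carrier by blast

lemma skew_act_add:
  assumes F: "F \<in> carrier \<FF>" and H: "H \<in> carrier \<FF>"
  shows "skew_act V \<Gamma> A (F \<oplus>\<^bsub>\<FF>\<^esub> H) = skew_act V \<Gamma> A F \<oplus>\<^bsub>\<FF>\<^esub> skew_act V \<Gamma> A H"
proof -
  have "skew_act V \<Gamma> A (F \<oplus>\<^bsub>\<FF>\<^esub> H) =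
    (\<Oplus>\<^bsub>\<FF>\<^esub>\<xi>\<in>skew_support V \<Gamma> A. A \<xi> \<otimes>\<^bsub>\<FF>\<^esub> family_trans V \<xi> F \<oplus>\<^bsub>\<FF>\<^esub> A \<xi> \<otimes>\<^bsub>\<FF>\<^esub> family_trans V \<xi> H)"
    unfolding skew_act_sum[OF fam.a_closed[OF F H]]
  proof (rule fam.finsum_cong'[OF refl])
    fix \<xi> assume "\<xi> \<in> skew_support V \<Gamma> A"
    note \<xi> = support_carrier[OF this]
    show "A \<xi> \<otimes>\<^bsub>\<FF>\<^esub> family_trans V \<xi> (F \<oplus>\<^bsub>\<FF>\<^esub> H) =
        A \<xi> \<otimes>\<^bsub>\<FF>\<^esub> family_trans V \<xi> F \<oplus>\<^bsub>\<FF>\<^esub> A \<xi> \<otimes>\<^bsub>\<FF>\<^esub> family_trans V \<xi> H"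
      using \<xi> F H by (simp add: ring_hom_add[OF family_trans_hom] fam.r_distr family_trans_closed)
  qed (use term_closed F H in \<open>auto simp: Pi_iff\<close>)
  also have "\<dots> = skew_act V \<Gamma> A F \<oplus>\<^bsub>\<FF>\<^esub> skew_act V \<Gamma> A H"
    unfolding skew_act_sum[OF F] skew_act_sum[OF H]
    by (rule fam.finsum_addf) (use term_closed F H in auto)
  finally show ?thesis .
qed

text \<open>
  Multiplication by a translation invariant family commutes with the whole skew-group ring. Both the
  scalars and the spread germs are such families.
\<close>

lemma skew_act_invariant_mult:
  assumes F: "F \<in> carrier \<FF>" and L: "L \<in> carrier \<FF>"
    and inv: "\<And>\<xi>. \<xi> \<in> carrier V \<Longrightarrow> family_trans V \<xi> L = L"
  shows "skew_act V \<Gamma> A (L \<otimes>\<^bsub>\<FF>\<^esub> F) = L \<otimes>\<^bsub>\<FF>\<^esub> skew_act V \<Gamma> A F"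
proof -
  have "skew_act V \<Gamma> A (L \<otimes>\<^bsub>\<FF>\<^esub> F) =
    (\<Oplus>\<^bsub>\<FF>\<^esub>\<xi>\<in>skew_support V \<Gamma> A. L \<otimes>\<^bsub>\<FF>\<^esub> (A \<xi> \<otimes>\<^bsub>\<FF>\<^esub> family_trans V \<xi> F))"
    unfolding skew_act_sum[OF fam.m_closed[OF L F]]
  proof (rule fam.finsum_cong'[OF refl])
    fix \<xi> assume "\<xi> \<in> skew_support V \<Gamma> A"
    note \<xi> = support_carrier[OF this]
    show "A \<xi> \<otimes>\<^bsub>\<FF>\<^esub> family_trans V \<xi> (L \<otimes>\<^bsub>\<FF>\<^esub> F) = L \<otimes>\<^bsub>\<FF>\<^esub> (A \<xi> \<otimes>\<^bsub>\<FF>\<^esub> family_trans V \<xi> F)"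
      using \<xi> F L by (simp add: ring_hom_mult[OF family_trans_hom] inv fam.m_lcomm family_trans_closed)
  qed (use term_closed[OF F] L in \<open>auto simp: Pi_iff\<close>)
  also have "\<dots> = L \<otimes>\<^bsub>\<FF>\<^esub> skew_act V \<Gamma> A F"
    unfolding skew_act_sum[OF F]
    by (rule fam.finsum_rdistr [symmetric]) (use A_fin L term_closed[OF F] in auto)
  finally show ?thesis .
qed

lemma skew_act_smult_arg:
  "F \<in> carrier \<FF> \<Longrightarrow>
    skew_act V \<Gamma> A (const_family V c \<otimes>\<^bsub>\<FF>\<^esub> F) = const_family V c \<otimes>\<^bsub>\<FF>\<^esub> skew_act V \<Gamma> A F"
  by (rule skew_act_invariant_mult) (simp_all add: const_family_closed family_trans_const)

lemma skew_act_smult: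
  assumes F: "F \<in> carrier \<FF>"
  shows "skew_act V \<Gamma> (c \<odot>\<^bsub>skew_ring V \<Gamma>\<^esub> A) F = const_family V c \<otimes>\<^bsub>\<FF>\<^esub> skew_act V \<Gamma> A F"
proof -
  let ?B = "c \<odot>\<^bsub>skew_ring V \<Gamma>\<^esub> A"
  have B: "?B \<xi> = const_family V c \<otimes>\<^bsub>\<FF>\<^esub> A \<xi>" if "\<xi> \<in> \<Gamma>" for \<xi>
    using that by (simp add: skew_ring_def const_family_def mer_fun_ops)
  have "?B \<in> \<Gamma> \<rightarrow>\<^sub>E carrier (mer_fun V)"
    using B A_fun mer_fun_closed(2)[OF const_family_mer_fun]
    by (auto simp: PiE_iff skew_ring_def const_family_def[symmetric] mer_fun_ops)
  moreover have "skew_support V \<Gamma> ?B \<subseteq> skew_support V \<Gamma> A"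
    using B by (auto simp: skew_support_def mer_fun_ops const_family_closed)
  ultimately have "skew_act V \<Gamma> ?B F = (\<Oplus>\<^bsub>\<FF>\<^esub>\<xi>\<in>skew_support V \<Gamma> A. ?B \<xi> \<otimes>\<^bsub>\<FF>\<^esub> family_trans V \<xi> F)"
    using F A_fin skew_support_subset by (intro skew_act_eq) auto
  also have "\<dots> = (\<Oplus>\<^bsub>\<FF>\<^esub>\<xi>\<in>skew_support V \<Gamma> A. const_family V c \<otimes>\<^bsub>\<FF>\<^esub> (A \<xi> \<otimes>\<^bsub>\<FF>\<^esub> family_trans V \<xi> F))"
  proof (rule fam.finsum_cong'[OF refl])
    fix \<xi> assume \<xi>: "\<xi> \<in> skew_support V \<Gamma> A"
    with skew_support_subset have "\<xi> \<in> \<Gamma>" by blast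
    with support_carrier[OF \<xi>] show "?B \<xi> \<otimes>\<^bsub>\<FF>\<^esub> family_trans V \<xi> F =
        const_family V c \<otimes>\<^bsub>\<FF>\<^esub> (A \<xi> \<otimes>\<^bsub>\<FF>\<^esub> family_trans V \<xi> F)"
      using F by (simp add: B fam.m_assoc const_family_closed family_trans_closed)
  qed (use term_closed[OF F] const_family_closed in \<open>auto simp: Pi_iff\<close>)
  also have "\<dots> = const_family V c \<otimes>\<^bsub>\<FF>\<^esub> skew_act V \<Gamma> A F"
    unfolding skew_act_sum[OF F]
    by (rule fam.finsum_rdistr [symmetric]) (use A_fin const_family_closed term_closed[OF F] in auto)
  finally show ?thesis .
qed

end

lemma skew_act_add_ring:
  assumes A: "A \<in> carrier (skew_ring V \<Gamma>)" and B: "B \<in> carrier (skew_ring V \<Gamma>)" and F: "F \<in> carrier \<FF>"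
  shows "skew_act V \<Gamma> (A \<oplus>\<^bsub>skew_ring V \<Gamma>\<^esub> B) F = skew_act V \<Gamma> A F \<oplus>\<^bsub>\<FF>\<^esub> skew_act V \<Gamma> B F"
proof -
  let ?C = "A \<oplus>\<^bsub>skew_ring V \<Gamma>\<^esub> B" and ?S = "skew_support V \<Gamma> A \<union> skew_support V \<Gamma> B"
  have A': "A \<in> \<Gamma> \<rightarrow>\<^sub>E carrier (mer_fun V)" and B': "B \<in> \<Gamma> \<rightarrow>\<^sub>E carrier (mer_fun V)"
    and S: "finite ?S" "?S \<subseteq> \<Gamma>"
    using A B skew_support_subset by (auto simp: skew_ring_carrier)
  have C: "?C \<xi> = A \<xi> \<oplus>\<^bsub>\<FF>\<^esub> B \<xi>" if "\<xi> \<in> \<Gamma>" for \<xi>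
    using that by (simp add: skew_ring_def mer_fun_ops)
  have "?C \<in> \<Gamma> \<rightarrow>\<^sub>E carrier (mer_fun V)"
    using A' B' mer_fun_closed(1) by (auto simp: PiE_iff skew_ring_def mer_fun_ops)
  moreover have "skew_support V \<Gamma> ?C \<subseteq> ?S"
    using C by (auto simp: skew_support_def mer_fun_ops)
  ultimately have "skew_act V \<Gamma> ?C F = (\<Oplus>\<^bsub>\<FF>\<^esub>\<xi>\<in>?S. ?C \<xi> \<otimes>\<^bsub>\<FF>\<^esub> family_trans V \<xi> F)"
    using F S by (intro skew_act_eq) auto
  also have "\<dots> = (\<Oplus>\<^bsub>\<FF>\<^esub>\<xi>\<in>?S. A \<xi> \<otimes>\<^bsub>\<FF>\<^esub> family_trans V \<xi> F \<oplus>\<^bsub>\<FF>\<^esub> B \<xi> \<otimes>\<^bsub>\<FF>\<^esub> family_trans V \<xi> F)"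
  proof (rule fam.finsum_cong'[OF refl])
    fix \<xi> assume "\<xi> \<in> ?S"
    with S have \<xi>: "\<xi> \<in> \<Gamma>" by blast
    then show "?C \<xi> \<otimes>\<^bsub>\<FF>\<^esub> family_trans V \<xi> F =
        A \<xi> \<otimes>\<^bsub>\<FF>\<^esub> family_trans V \<xi> F \<oplus>\<^bsub>\<FF>\<^esub> B \<xi> \<otimes>\<^bsub>\<FF>\<^esub> family_trans V \<xi> F"
      using skew_coeff[OF A' \<xi>] skew_coeff[OF B' \<xi>] family_trans_closed[OF \<Gamma>_carrier[OF \<xi>] F]
      by (simp add: C fam.l_distr)
  qed (use skew_term_closed[OF A' F] skew_term_closed[OF B' F] S in \<open>auto simp: Pi_iff\<close>)
  also have "\<dots> = (\<Oplus>\<^bsub>\<FF>\<^esub>\<xi>\<in>?S. A \<xi> \<otimes>\<^bsub>\<FF>\<^esub> family_trans V \<xi> F) \<oplus>\<^bsub>\<FF>\<^esub> (\<Oplus>\<^bsub>\<FF>\<^esub>\<xi>\<in>?S. B \<xi> \<otimes>\<^bsub>\<FF>\<^esub> family_trans V \<xi> F)"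
    by (rule fam.finsum_addf) (use skew_term_closed[OF A' F] skew_term_closed[OF B' F] S in \<open>auto simp: Pi_iff\<close>)
  also have "\<dots> = skew_act V \<Gamma> A F \<oplus>\<^bsub>\<FF>\<^esub> skew_act V \<Gamma> B F"
    using skew_act_eq[OF A' F S(1) _ S(2)] skew_act_eq[OF B' F S(1) _ S(2)] by simp
  finally show ?thesis .
qed

lemma skew_act_one:
  assumes F: "F \<in> carrier \<FF>"
  shows "skew_act V \<Gamma> \<one>\<^bsub>skew_ring V \<Gamma>\<^esub> F = F"
proof -
  let ?I = "\<one>\<^bsub>skew_ring V \<Gamma>\<^esub>"
  have \<Gamma>1: "\<one> \<in> \<Gamma>"
    using subgroup.one_closed[OF subgroup] .
  have I: "?I = (\<lambda>\<xi>\<in>\<Gamma>. if \<xi> = \<one> then \<one>\<^bsub>\<FF>\<^esub> else \<zero>\<^bsub>\<FF>\<^esub>)"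
    unfolding mer_fun_ops [symmetric] by (simp add: skew_ring_def)
  have "?I \<in> \<Gamma> \<rightarrow>\<^sub>E carrier (mer_fun V)"
    using const_family_mer_fun[of 0] const_family_mer_fun[of 1] by (auto simp: I const_family_ops)
  moreover have "skew_support V \<Gamma> ?I \<subseteq> {\<one>}"
    by (auto simp: skew_support_def I mer_fun_ops)
  ultimately have "skew_act V \<Gamma> ?I F = (\<Oplus>\<^bsub>\<FF>\<^esub>\<xi>\<in>{\<one>}. ?I \<xi> \<otimes>\<^bsub>\<FF>\<^esub> family_trans V \<xi> F)"
    using F \<Gamma>1 by (intro skew_act_eq) auto
  also have "\<dots> = F"
    using F \<Gamma>1 by (simp add: I family_trans_one)
  finally show ?thesis .
qed


lemma finsum_swap:
  assumes "finite S" "finite T" "\<And>i j. i \<in> S \<Longrightarrow> j \<in> T \<Longrightarrow> f i j \<in> carrier \<FF>"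
  shows "(\<Oplus>\<^bsub>\<FF>\<^esub>i\<in>S. \<Oplus>\<^bsub>\<FF>\<^esub>j\<in>T. f i j) = (\<Oplus>\<^bsub>\<FF>\<^esub>j\<in>T. \<Oplus>\<^bsub>\<FF>\<^esub>i\<in>S. f i j)"
  using assms(1,3)
proof (induction S)
  case empty
  then show ?case by simp
next
  case (insert i S)
  have fi: "f i \<in> T \<rightarrow> carrier \<FF>" and inner: "(\<lambda>j. \<Oplus>\<^bsub>\<FF>\<^esub>i\<in>S. f i j) \<in> T \<rightarrow> carrier \<FF>"
    using insert.prems by (auto intro!: fam.finsum_closed)
  have "(\<Oplus>\<^bsub>\<FF>\<^esub>i\<in>insert i S. \<Oplus>\<^bsub>\<FF>\<^esub>j\<in>T. f i j)
      = (\<Oplus>\<^bsub>\<FF>\<^esub>j\<in>T. f i j) \<oplus>\<^bsub>\<FF>\<^esub> (\<Oplus>\<^bsub>\<FF>\<^esub>i\<in>S. \<Oplus>\<^bsub>\<FF>\<^esub>j\<in>T. f i j)"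
    using insert by (intro fam.finsum_insert) (auto intro!: fam.finsum_closed)
  also have "\<dots> = (\<Oplus>\<^bsub>\<FF>\<^esub>j\<in>T. f i j) \<oplus>\<^bsub>\<FF>\<^esub> (\<Oplus>\<^bsub>\<FF>\<^esub>j\<in>T. \<Oplus>\<^bsub>\<FF>\<^esub>i\<in>S. f i j)"
    using insert by simp
  also have "\<dots> = (\<Oplus>\<^bsub>\<FF>\<^esub>j\<in>T. f i j \<oplus>\<^bsub>\<FF>\<^esub> (\<Oplus>\<^bsub>\<FF>\<^esub>i\<in>S. f i j))"
    by (rule fam.finsum_addf[OF fi inner, symmetric])
  also have "\<dots> = (\<Oplus>\<^bsub>\<FF>\<^esub>j\<in>T. \<Oplus>\<^bsub>\<FF>\<^esub>i\<in>insert i S. f i j)"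
  proof (rule fam.finsum_cong'[OF refl])
    show "(\<lambda>j. \<Oplus>\<^bsub>\<FF>\<^esub>i\<in>insert i S. f i j) \<in> T \<rightarrow> carrier \<FF>"
      using insert.prems by (auto intro!: fam.finsum_closed)
    fix j assume j: "j \<in> T"
    show "f i j \<oplus>\<^bsub>\<FF>\<^esub> (\<Oplus>\<^bsub>\<FF>\<^esub>i\<in>S. f i j) = (\<Oplus>\<^bsub>\<FF>\<^esub>i\<in>insert i S. f i j)"
      using insert j by (intro fam.finsum_insert[symmetric]) auto
  qed
  finally show ?case .
qed

text \<open>
  Both sides are the double sum over \<open>\<xi>\<close> and \<open>\<zeta> = \<xi> \<eta>\<close> of the germs
  \<open>A \<xi> \<phi>\<^sub>\<xi>(B \<eta> \<phi>\<^sub>\<eta>(F))\<close>, taken in the two orders.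
\<close>

lemma skew_act_mult_ring:
  assumes A: "A \<in> carrier (skew_ring V \<Gamma>)" and B: "B \<in> carrier (skew_ring V \<Gamma>)" and F: "F \<in> carrier \<FF>"
  shows "skew_act V \<Gamma> (A \<otimes>\<^bsub>skew_ring V \<Gamma>\<^esub> B) F = skew_act V \<Gamma> A (skew_act V \<Gamma> B F)"
proof -
  let ?C = "A \<otimes>\<^bsub>skew_ring V \<Gamma>\<^esub> B" and ?SA = "skew_support V \<Gamma> A" and ?SB = "skew_support V \<Gamma> B"
  let ?S = "(\<lambda>(\<xi>, \<eta>). \<xi> \<otimes> \<eta>) ` (?SA \<times> ?SB)"
  have A': "A \<in> \<Gamma> \<rightarrow>\<^sub>E carrier (mer_fun V)" and B': "B \<in> \<Gamma> \<rightarrow>\<^sub>E carrier (mer_fun V)"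
    and fin: "finite ?SA" "finite ?SB"
    using A B by (auto simp: skew_ring_carrier)
  have SA: "\<xi> \<in> \<Gamma>" if "\<xi> \<in> ?SA" for \<xi>
    using that skew_support_subset by blast
  have SB: "\<eta> \<in> \<Gamma>" if "\<eta> \<in> ?SB" for \<eta>
    using that skew_support_subset by blast
  have S: "finite ?S" "?S \<subseteq> \<Gamma>"
    using fin SA SB subgroup.m_closed[OF subgroup] by auto
  have quot: "inv \<xi> \<otimes> \<zeta> \<in> \<Gamma>" if "\<xi> \<in> \<Gamma>" "\<zeta> \<in> \<Gamma>" for \<xi> \<zeta>
    using that subgroup.m_closed[OF subgroup] subgroup.m_inv_closed[OF subgroup] by blast
  define T where "T \<xi> \<zeta> = A \<xi> \<otimes>\<^bsub>\<FF>\<^esub> family_trans V \<xi> (B (inv \<xi> \<otimes> \<zeta>))" for \<xi> \<zeta>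
  have T_mer: "T \<xi> \<zeta> \<in> carrier (mer_fun V)" if "\<xi> \<in> \<Gamma>" "\<zeta> \<in> \<Gamma>" for \<xi> \<zeta>
    unfolding T_def
    by (rule mer_fun_closed(2)[OF PiE_mem[OF A' that(1)]
          family_trans_mer_fun[OF \<Gamma>_carrier[OF that(1)] PiE_mem[OF B' quot[OF that]]]])
  note T_fam = mer_fun_families[OF T_mer]
  have C_eq: "?C \<zeta> = (\<Oplus>\<^bsub>\<FF>\<^esub>\<xi>\<in>?SA. T \<xi> \<zeta>)" and C_mer: "?C \<zeta> \<in> carrier (mer_fun V)" if \<zeta>: "\<zeta> \<in> \<Gamma>" for \<zeta>
  proof -
    have C\<zeta>: "?C \<zeta> = (\<Oplus>\<^bsub>mer_fun V\<^esub>\<xi>\<in>?SA. T \<xi> \<zeta>)"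
      using \<zeta> unfolding T_def mer_fun_ops(1)[symmetric] by (simp add: skew_ring_def)
    have "(\<lambda>\<xi>. T \<xi> \<zeta>) \<in> ?SA \<rightarrow> carrier (mer_fun V)"
      using T_mer SA \<zeta> by blast
    from finsum_mer_fun[OF fin(1) this] show "?C \<zeta> = (\<Oplus>\<^bsub>\<FF>\<^esub>\<xi>\<in>?SA. T \<xi> \<zeta>)" "?C \<zeta> \<in> carrier (mer_fun V)"
      unfolding C\<zeta> by blast+
  qed
  have "?C \<in> extensional \<Gamma>"
    by (simp add: skew_ring_def)
  then have C: "?C \<in> \<Gamma> \<rightarrow>\<^sub>E carrier (mer_fun V)"
    using C_mer by (simp add: PiE_iff)
  have T_zero: "T \<xi> \<zeta> = \<zero>\<^bsub>\<FF>\<^esub>" if "\<xi> \<in> ?SA" "\<zeta> \<in> \<Gamma>" "inv \<xi> \<otimes> \<zeta> \<notin> ?SB" for \<xi> \<zeta>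
  proof -
    have "B (inv \<xi> \<otimes> \<zeta>) = \<zero>\<^bsub>\<FF>\<^esub>"
      using that quot[OF SA] by (auto simp: skew_support_def mer_fun_ops)
    moreover have "family_trans V \<xi> \<zero>\<^bsub>\<FF>\<^esub> = \<zero>\<^bsub>\<FF>\<^esub>"
      using family_trans_const[OF \<Gamma>_carrier[OF SA[OF that(1)]], of 0] by (simp add: const_family_ops)
    ultimately show ?thesis
      using skew_coeff[OF A' SA[OF that(1)]] by (simp add: T_def)
  qed
  have "skew_support V \<Gamma> ?C \<subseteq> ?S"
  proof
    fix \<zeta> assume "\<zeta> \<in> skew_support V \<Gamma> ?C"
    then have \<zeta>: "\<zeta> \<in> \<Gamma>" "?C \<zeta> \<noteq> \<zero>\<^bsub>\<FF>\<^esub>"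
      by (simp_all add: skew_support_def mer_fun_ops)
    have "\<exists>\<xi>\<in>?SA. inv \<xi> \<otimes> \<zeta> \<in> ?SB"
    proof (rule ccontr)
      assume "\<not> (\<exists>\<xi>\<in>?SA. inv \<xi> \<otimes> \<zeta> \<in> ?SB)"
      then have "(\<Oplus>\<^bsub>\<FF>\<^esub>\<xi>\<in>?SA. T \<xi> \<zeta>) = (\<Oplus>\<^bsub>\<FF>\<^esub>\<xi>\<in>?SA. \<zero>\<^bsub>\<FF>\<^esub>)"
        using T_zero \<zeta> by (intro fam.finsum_cong') auto
      then show False
        using \<zeta> C_eq by simp
    qed
    then obtain \<xi> where \<xi>: "\<xi> \<in> ?SA" "inv \<xi> \<otimes> \<zeta> \<in> ?SB" ..
    then have "\<zeta> = \<xi> \<otimes> (inv \<xi> \<otimes> \<zeta>)"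
      using \<zeta> by (simp add: left_mult_cancel \<Gamma>_carrier SA)
    then show "\<zeta> \<in> ?S"
      using \<xi> by (intro image_eqI[of _ _ "(\<xi>, inv \<xi> \<otimes> \<zeta>)"]) simp_all
  qed
  then have "skew_act V \<Gamma> ?C F = (\<Oplus>\<^bsub>\<FF>\<^esub>\<zeta>\<in>?S. ?C \<zeta> \<otimes>\<^bsub>\<FF>\<^esub> family_trans V \<zeta> F)"
    by (rule skew_act_eq[OF C F S(1) _ S(2)])
  also have "\<dots> = (\<Oplus>\<^bsub>\<FF>\<^esub>\<zeta>\<in>?S. \<Oplus>\<^bsub>\<FF>\<^esub>\<xi>\<in>?SA. T \<xi> \<zeta> \<otimes>\<^bsub>\<FF>\<^esub> family_trans V \<zeta> F)"
  proof (rule fam.finsum_cong'[OF refl])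
    show "(\<lambda>\<zeta>. \<Oplus>\<^bsub>\<FF>\<^esub>\<xi>\<in>?SA. T \<xi> \<zeta> \<otimes>\<^bsub>\<FF>\<^esub> family_trans V \<zeta> F) \<in> ?S \<rightarrow> carrier \<FF>"
      using T_fam SA S(2) F by (auto intro!: fam.finsum_closed fam.m_closed family_trans_closed \<Gamma>_carrier)
    fix \<zeta> assume "\<zeta> \<in> ?S"
    then have \<zeta>: "\<zeta> \<in> \<Gamma>" using S by blast
    show "?C \<zeta> \<otimes>\<^bsub>\<FF>\<^esub> family_trans V \<zeta> F = (\<Oplus>\<^bsub>\<FF>\<^esub>\<xi>\<in>?SA. T \<xi> \<zeta> \<otimes>\<^bsub>\<FF>\<^esub> family_trans V \<zeta> F)"
      unfolding C_eq[OF \<zeta>]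
      by (rule fam.finsum_ldistr[OF fin(1) family_trans_closed[OF \<Gamma>_carrier[OF \<zeta>] F]]) (use T_fam SA \<zeta> in auto)
  qed
  also have "\<dots> = (\<Oplus>\<^bsub>\<FF>\<^esub>\<xi>\<in>?SA. \<Oplus>\<^bsub>\<FF>\<^esub>\<zeta>\<in>?S. T \<xi> \<zeta> \<otimes>\<^bsub>\<FF>\<^esub> family_trans V \<zeta> F)"
    using fin S SA F by (intro finsum_swap fam.m_closed T_fam family_trans_closed \<Gamma>_carrier) auto
  also have "\<dots> = (\<Oplus>\<^bsub>\<FF>\<^esub>\<xi>\<in>?SA. A \<xi> \<otimes>\<^bsub>\<FF>\<^esub> family_trans V \<xi> (skew_act V \<Gamma> B F))"
  proof (rule fam.finsum_cong'[OF refl])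
    show "(\<lambda>\<xi>. A \<xi> \<otimes>\<^bsub>\<FF>\<^esub> family_trans V \<xi> (skew_act V \<Gamma> B F)) \<in> ?SA \<rightarrow> carrier \<FF>"
      using skew_term_closed[OF A' skew_act_closed[OF B F]] SA by blast
    fix \<xi> assume \<xi>S: "\<xi> \<in> ?SA"
    have \<xi>: "\<xi> \<in> \<Gamma>" "\<xi> \<in> carrier V" and A\<xi>: "A \<xi> \<in> carrier \<FF>"
      using SA[OF \<xi>S] \<Gamma>_carrier skew_coeff[OF A'] by auto
    interpret h: ring_hom_cring \<FF> \<FF> "family_trans V \<xi>"
      by (rule family_trans_ring_hom[OF \<xi>(2)])
    have U: "T \<xi> (\<xi> \<otimes> \<eta>) \<otimes>\<^bsub>\<FF>\<^esub> family_trans V (\<xi> \<otimes> \<eta>) F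
        = A \<xi> \<otimes>\<^bsub>\<FF>\<^esub> family_trans V \<xi> (B \<eta> \<otimes>\<^bsub>\<FF>\<^esub> family_trans V \<eta> F)" if "\<eta> \<in> ?SB" for \<eta>
    proof -
      have \<eta>: "\<eta> \<in> \<Gamma>" "\<eta> \<in> carrier V" and B\<eta>: "B \<eta> \<in> carrier \<FF>"
        using SB[OF that] \<Gamma>_carrier skew_coeff[OF B'] by auto
      show ?thesis
        using \<xi> \<eta> A\<xi> B\<eta> F
        by (simp add: T_def left_mult_cancel fam.m_assoc family_trans_closed family_trans_comp[symmetric])
    qed
    have term_in: "T \<xi> \<zeta> \<otimes>\<^bsub>\<FF>\<^esub> family_trans V \<zeta> F \<in> carrier \<FF>" if "\<zeta> \<in> \<Gamma>" for \<zeta>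
      by (rule fam.m_closed[OF T_fam[OF \<xi>(1) that] family_trans_closed[OF \<Gamma>_carrier[OF that] F]])
    have sub: "(\<lambda>\<eta>. \<xi> \<otimes> \<eta>) ` ?SB \<subseteq> ?S"
      using \<xi>S by auto
    have inj: "inj_on (\<lambda>\<eta>. \<xi> \<otimes> \<eta>) ?SB"
      using \<xi>(2) SB \<Gamma>_carrier by (auto intro!: inj_onI)
    have "(\<Oplus>\<^bsub>\<FF>\<^esub>\<zeta>\<in>?S. T \<xi> \<zeta> \<otimes>\<^bsub>\<FF>\<^esub> family_trans V \<zeta> F)
        = (\<Oplus>\<^bsub>\<FF>\<^esub>\<zeta>\<in>(\<lambda>\<eta>. \<xi> \<otimes> \<eta>) ` ?SB. T \<xi> \<zeta> \<otimes>\<^bsub>\<FF>\<^esub> family_trans V \<zeta> F)"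
    proof (rule fam.add.finprod_mono_neutral_cong_left[OF S(1) sub, symmetric])
      fix \<zeta> assume \<zeta>: "\<zeta> \<in> ?S - (\<lambda>\<eta>. \<xi> \<otimes> \<eta>) ` ?SB"
      then have \<zeta>\<Gamma>: "\<zeta> \<in> \<Gamma>" using S by blast
      have "inv \<xi> \<otimes> \<zeta> \<notin> ?SB"
      proof
        assume "inv \<xi> \<otimes> \<zeta> \<in> ?SB"
        then have "\<xi> \<otimes> (inv \<xi> \<otimes> \<zeta>) \<in> (\<lambda>\<eta>. \<xi> \<otimes> \<eta>) ` ?SB"
          by blast
        with \<zeta> show False
          using left_mult_cancel(2)[OF \<xi>(2) \<Gamma>_carrier[OF \<zeta>\<Gamma>]] by simp
      qed
      from T_zero[OF \<xi>S \<zeta>\<Gamma> this] show "T \<xi> \<zeta> \<otimes>\<^bsub>\<FF>\<^esub> family_trans V \<zeta> F = \<zero>\<^bsub>\<FF>\<^esub>"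
        using F \<zeta>\<Gamma> by (simp add: family_trans_closed \<Gamma>_carrier)
    qed (use term_in S(2) in auto)
    also have "\<dots> = (\<Oplus>\<^bsub>\<FF>\<^esub>\<eta>\<in>?SB. T \<xi> (\<xi> \<otimes> \<eta>) \<otimes>\<^bsub>\<FF>\<^esub> family_trans V (\<xi> \<otimes> \<eta>) F)"
      by (rule fam.finsum_reindex[OF _ inj]) (use term_in S(2) sub in blast)
    also have "\<dots> = (\<Oplus>\<^bsub>\<FF>\<^esub>\<eta>\<in>?SB. A \<xi> \<otimes>\<^bsub>\<FF>\<^esub> family_trans V \<xi> (B \<eta> \<otimes>\<^bsub>\<FF>\<^esub> family_trans V \<eta> F))"
      using U A\<xi> skew_term_closed[OF B' F] SB by (intro fam.finsum_cong'[OF refl]) auto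
    also have "\<dots> = A \<xi> \<otimes>\<^bsub>\<FF>\<^esub> (\<Oplus>\<^bsub>\<FF>\<^esub>\<eta>\<in>?SB. family_trans V \<xi> (B \<eta> \<otimes>\<^bsub>\<FF>\<^esub> family_trans V \<eta> F))"
      by (rule fam.finsum_rdistr[OF fin(2) A\<xi>, symmetric]) (use skew_term_closed[OF B' F] SB in auto)
    also have "(\<Oplus>\<^bsub>\<FF>\<^esub>\<eta>\<in>?SB. family_trans V \<xi> (B \<eta> \<otimes>\<^bsub>\<FF>\<^esub> family_trans V \<eta> F))
        = family_trans V \<xi> (skew_act V \<Gamma> B F)"
      unfolding skew_act_sum[OF B F]
      by (subst h.hom_finsum) (use skew_term_closed[OF B' F] SB in \<open>auto simp: o_def\<close>)
    finally show "(\<Oplus>\<^bsub>\<FF>\<^esub>\<zeta>\<in>?S. T \<xi> \<zeta> \<otimes>\<^bsub>\<FF>\<^esub> family_trans V \<zeta> F)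
        = A \<xi> \<otimes>\<^bsub>\<FF>\<^esub> family_trans V \<xi> (skew_act V \<Gamma> B F)" .
  qed
  also have "\<dots> = skew_act V \<Gamma> A (skew_act V \<Gamma> B F)"
    by (rule skew_act_sum[OF A skew_act_closed[OF B F], symmetric])
  finally show ?thesis .
qed

end

section \<open>Finite groups acting on germs\<close>

lemma (in cring) ideal_of_closed:
  assumes "I \<subseteq> carrier R" "\<zero> \<in> I" "\<And>a b. a \<in> I \<Longrightarrow> b \<in> I \<Longrightarrow> a \<oplus> b \<in> I"
    and mult: "\<And>a x. a \<in> I \<Longrightarrow> x \<in> carrier R \<Longrightarrow> x \<otimes> a \<in> I"
  shows "ideal I R"
proof (rule idealI[OF ring_axioms])
  have neg: "\<ominus> a \<in> I" if "a \<in> I" for a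
  proof -
    have a: "a \<in> carrier R"
      using that assms(1) by blast
    have "(\<ominus> \<one>) \<otimes> a = \<ominus> a"
      using a by (simp add: l_minus)
    moreover have "(\<ominus> \<one>) \<otimes> a \<in> I"
      by (rule mult[OF that]) simp
    ultimately show ?thesis by simp
  qed
  show "subgroup I (add_monoid R)"
    using assms neg by (intro subgroup.intro) (auto simp: a_inv_def)
  fix a x assume "a \<in> I" "x \<in> carrier R"
  then show "x \<otimes> a \<in> I" "a \<otimes> x \<in> I"
    using mult assms(1) m_comm[of a x] by auto
qed

lemma (in cring) subring_cring: "subring H R \<Longrightarrow> cring (R\<lparr>carrier := H\<rparr>)"
  using subcring_iff[of H] subcringI'[of H] subringE(1)[of H R] by blast

context function_sheaf
begin

lemma reg_stalk_cring: "x \<in> carrier V \<Longrightarrow> cring (reg_stalk V x)"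
  using cring.subring_cring[OF mer_stalk_cring reg_stalk_subring, of x] by (simp add: reg_stalk_def)

lemma reg_stalk_mer: "x \<in> carrier V \<Longrightarrow> P \<in> carrier (reg_stalk V x) \<Longrightarrow> P \<in> carrier (mer_stalk V x)"
  using subringE(1)[OF reg_stalk_subring] by blast

lemma reg_stalk_closed:
  assumes "x \<in> carrier V" "P \<in> carrier (reg_stalk V x)" "Q \<in> carrier (reg_stalk V x)"
  shows "P \<oplus>\<^bsub>mer_stalk V x\<^esub> Q \<in> carrier (reg_stalk V x)" "P \<otimes>\<^bsub>mer_stalk V x\<^esub> Q \<in> carrier (reg_stalk V x)"
  using subringE(6,7)[OF reg_stalk_subring] assms by blast+

lemma zero_reg: "x \<in> carrier V \<Longrightarrow> \<zero>\<^bsub>mer_stalk V x\<^esub> \<in> carrier (reg_stalk V x)"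
  using subringE(2)[OF reg_stalk_subring] by blast

lemma morphism_comp:
  assumes s: "morphism V s" and s': "morphism V s'"
  shows "morphism V (\<lambda>x. s (s' x))"
  unfolding morphism_def
proof (intro conjI allI ballI impI)
  have cs: "continuous_map (topo V) (topo V) s" and cs': "continuous_map (topo V) (topo V) s'"
    using s s' by (simp_all add: morphism_def)
  show "continuous_map (topo V) (topo V) (\<lambda>x. s (s' x))"
    using continuous_map_compose[OF cs' cs] by (simp add: o_def)
  fix U f assume f: "f \<in> sections V U" and U: "openin (topo V) U"
  let ?U = "{x \<in> topspace (topo V). s x \<in> U}"
  have 1: "(\<lambda>x. f (s x)) \<in> sections V ?U"
    using s f U by (simp add: morphism_def)
  have 2: "openin (topo V) ?U"
    using openin_continuous_map_preimage[OF cs U] .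
  have "\<forall>U. \<forall>f\<in>sections V U. openin (topo V) U \<longrightarrow>
      (\<lambda>x. f (s' x)) \<in> sections V {x \<in> topspace (topo V). s' x \<in> U}"
    using s' by (simp add: morphism_def)
  from mp[OF bspec[OF spec[OF this] 1] 2]
  have "(\<lambda>x. f (s (s' x))) \<in> sections V {x \<in> topspace (topo V). s' x \<in> ?U}" .
  moreover have "{x \<in> topspace (topo V). s' x \<in> ?U} = {x \<in> topspace (topo V). s (s' x) \<in> U}"
    using continuous_map_image_subset_topspace[OF cs'] by auto
  ultimately show "(\<lambda>x. f (s (s' x))) \<in> sections V {x \<in> topspace (topo V). s (s' x) \<in> U}"
    by simp
qed

lemma sheaf_auto_comp:
  "sheaf_auto V s t \<Longrightarrow> sheaf_auto V s' t' \<Longrightarrow> sheaf_auto V (\<lambda>x. s (s' x)) (\<lambda>x. t' (t x))"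
  unfolding sheaf_auto_def using morphism_comp by auto

end

locale sheaf_group_action = sheaf_group V + G: group G
  for V :: "('v, 'z) sgroup_scheme" (structure) and G :: "('g, 'y) monoid_scheme" +
  fixes act :: "'g \<Rightarrow> 'v \<Rightarrow> 'v"
  assumes finite_G: "finite (carrier G)"
    and act_closed: "g \<in> carrier G \<Longrightarrow> x \<in> carrier V \<Longrightarrow> act g x \<in> carrier V"
    and act_one: "x \<in> carrier V \<Longrightarrow> act \<one>\<^bsub>G\<^esub> x = x"
    and act_act: "g \<in> carrier G \<Longrightarrow> h \<in> carrier G \<Longrightarrow> x \<in> carrier V \<Longrightarrow> act g (act h x) = act (g \<otimes>\<^bsub>G\<^esub> h) x"
    and act_mult: "g \<in> carrier G \<Longrightarrow> x \<in> carrier V \<Longrightarrow> y \<in> carrier V \<Longrightarrow> act g (x \<otimes> y) = act g x \<otimes> act g y"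
    and act_morphism: "g \<in> carrier G \<Longrightarrow> morphism V (act g)"
begin

abbreviation "\<FF> \<equiv> germ_families V"

lemma act_cancel:
  assumes "g \<in> carrier G" "x \<in> carrier V"
  shows "act (inv\<^bsub>G\<^esub> g) (act g x) = x" "act g (act (inv\<^bsub>G\<^esub> g) x) = x"
  using assms by (simp_all add: act_act act_one)

lemma act_unit: "g \<in> carrier G \<Longrightarrow> act g \<one> = \<one>"
  using act_mult[of g \<one> \<one>] act_closed[of g \<one>] by (simp add: l_cancel_one')

lemma act_inv:
  assumes "g \<in> carrier G" "x \<in> carrier V"
  shows "act g (inv x) = inv (act g x)"
  using assms act_mult[of g "inv x" x] act_unit[of g]
  by (intro inv_equality[symmetric]) (simp_all add: act_closed)

lemma act_auto:
  assumes "g \<in> carrier G"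
  shows "sheaf_auto V (act (inv\<^bsub>G\<^esub> g)) (act g)"
  using assms by (simp add: sheaf_auto_def act_morphism act_closed act_cancel)

lemma germ_act_hom:
  assumes "g \<in> carrier G" "x \<in> carrier V"
  shows "germ_act V G act g x \<in> Ring.ring_hom (mer_stalk V x) (mer_stalk V (act g x))"
  using mpull_hom[OF act_auto[OF assms(1)] act_closed[OF assms]] assms by (simp add: germ_act_def act_cancel)

lemma germ_act_reg:
  assumes "g \<in> carrier G" "x \<in> carrier V" "P \<in> carrier (reg_stalk V x)"
  shows "germ_act V G act g x P \<in> carrier (reg_stalk V (act g x))"
  using mpull_reg[OF act_auto[OF assms(1)] act_closed[OF assms(1,2)]] assms by (simp add: germ_act_def act_cancel)

lemma germ_act_comp:
  assumes g: "g \<in> carrier G" and h: "h \<in> carrier G" and x: "x \<in> carrier V" and P: "P \<in> carrier (mer_stalk V x)"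
  shows "germ_act V G act g (act h x) (germ_act V G act h x P) = germ_act V G act (g \<otimes>\<^bsub>G\<^esub> h) x P"
  using mpull_mpull[OF act_auto[OF h] act_auto[OF g] act_auto[OF G.m_closed[OF g h]],
      of "act g (act h x)" P] assms
  by (simp add: germ_act_def act_cancel act_act act_closed G.inv_mult_group G.m_assoc[symmetric] act_one)

lemma germ_act_one:
  assumes "x \<in> carrier V" "P \<in> carrier (mer_stalk V x)"
  shows "germ_act V G act \<one>\<^bsub>G\<^esub> x P = P"
  using mpull_id[OF act_auto[OF G.one_closed], of x P] assms by (simp add: germ_act_def act_one)

text \<open>
  \<open>g \<circ> \<phi>\<^sub>\<xi> = \<phi>\<^bsub>g\<cdot>\<xi>\<^esub> \<circ> g\<close>, since \<open>g\<^sup>-\<^sup>1 \<cdot> ((g\<cdot>\<xi>)\<^sup>-\<^sup>1 y) = \<xi>\<^sup>-\<^sup>1 (g\<^sup>-\<^sup>1 \<cdot> y)\<close>.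
\<close>

lemma germ_act_trans:
  assumes g: "g \<in> carrier G" and \<xi>: "\<xi> \<in> carrier V" and x: "x \<in> carrier V" and P: "P \<in> carrier (mer_stalk V x)"
  shows "germ_act V G act g (\<xi> \<otimes> x) (germ_trans V \<xi> x P) = germ_trans V (act g \<xi>) (act g x) (germ_act V G act g x P)"
proof -
  let ?h = "inv\<^bsub>G\<^esub> g"
  note sg = act_auto[OF g] and s\<xi> = left_mult_auto[OF \<xi>] and sg\<xi> = left_mult_auto[OF act_closed[OF g \<xi>]]
  note u = sheaf_auto_comp[OF s\<xi> sg]
  have point: "act g (\<xi> \<otimes> x) \<in> carrier V" "act g (\<xi> \<otimes> x) = act g \<xi> \<otimes> act g x"
    using g \<xi> x by (simp_all add: act_closed act_mult)
  have "mpull V (act ?h) (act g (\<xi> \<otimes> x)) (mpull V (\<lambda>y. inv \<xi> \<otimes> y) (act ?h (act g (\<xi> \<otimes> x))) P)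
      = mpull V (\<lambda>y. inv \<xi> \<otimes> act ?h y) (act g (\<xi> \<otimes> x)) P"
    using g \<xi> x P by (intro mpull_mpull[OF s\<xi> sg u point(1)]) (simp_all add: act_cancel left_mult_cancel)
  then have 1: "germ_act V G act g (\<xi> \<otimes> x) (germ_trans V \<xi> x P)
      = mpull V (\<lambda>y. inv \<xi> \<otimes> act ?h y) (act g (\<xi> \<otimes> x)) P"
    using g \<xi> x by (simp add: germ_act_def germ_trans_def act_cancel)
  have shift: "act ?h (inv (act g \<xi>) \<otimes> y) = inv \<xi> \<otimes> act ?h y" if "y \<in> carrier V" for y
    using g \<xi> that by (simp add: act_mult act_inv[symmetric] act_closed act_cancel)
  have at: "inv (act g \<xi>) \<otimes> act g (\<xi> \<otimes> x) = act g x"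
    using g \<xi> x by (simp add: point(2) left_mult_cancel act_closed)
  have "mpull V (\<lambda>y. inv (act g \<xi>) \<otimes> y) (act g (\<xi> \<otimes> x))
        (mpull V (act ?h) (inv (act g \<xi>) \<otimes> act g (\<xi> \<otimes> x)) P)
      = mpull V (\<lambda>y. inv \<xi> \<otimes> act ?h y) (act g (\<xi> \<otimes> x)) P"
    using g \<xi> x P shift by (intro mpull_mpull[OF sg sg\<xi> u point(1)]) (simp_all add: at act_cancel)
  then have "germ_trans V (act g \<xi>) (act g x) (germ_act V G act g x P)
      = mpull V (\<lambda>y. inv \<xi> \<otimes> act ?h y) (act g (\<xi> \<otimes> x)) P"
    by (simp add: germ_act_def germ_trans_def at point(2)[symmetric])
  with 1 show ?thesis by simp
qed

text \<open>The action of \<open>G\<close> on families.\<close>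

definition family_act :: "'g \<Rightarrow> ('v \<Rightarrow> 'v mgerm) \<Rightarrow> 'v \<Rightarrow> 'v mgerm" where
  "family_act g = family_pull V (act (inv\<^bsub>G\<^esub> g))"

lemma family_act_at:
  assumes "g \<in> carrier G" "x \<in> carrier V"
  shows "family_act g F (act g x) = germ_act V G act g x (F x)"
  using assms by (simp add: family_act_def family_pull_def germ_act_def act_closed act_cancel)

lemma family_act_hom: "g \<in> carrier G \<Longrightarrow> family_act g \<in> Ring.ring_hom \<FF> \<FF>"
  unfolding family_act_def by (rule family_pull_hom[OF act_auto])

lemma family_act_closed: "g \<in> carrier G \<Longrightarrow> F \<in> carrier \<FF> \<Longrightarrow> family_act g F \<in> carrier \<FF>"
  using ring_hom_closed[OF family_act_hom] .

lemma family_act_comp: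
  assumes g: "g \<in> carrier G" and h: "h \<in> carrier G" and F: "F \<in> carrier \<FF>"
  shows "family_act g (family_act h F) = family_act (g \<otimes>\<^bsub>G\<^esub> h) F"
  unfolding family_act_def
  using assms by (intro family_pull_comp[OF act_auto act_auto act_auto F]) (simp_all add: act_act G.inv_mult_group)

lemma family_act_const: "g \<in> carrier G \<Longrightarrow> family_act g (const_family V c) = const_family V c"
  unfolding family_act_def by (rule family_pull_const[OF act_auto])

lemma families_eqI_act:
  assumes "g \<in> carrier G" "F \<in> carrier \<FF>" "H \<in> carrier \<FF>"
    and "\<And>x. x \<in> carrier V \<Longrightarrow> F (act g x) = H (act g x)"
  shows "F = H"
proof (rule families_eqI[OF assms(2,3)])
  fix x assume x: "x \<in> carrier V"
  show "F x = H x"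
    using assms(4)[of "act (inv\<^bsub>G\<^esub> g) x"] assms(1) x by (simp add: act_closed act_cancel)
qed

lemma family_act_fixed_iff:
  assumes F: "F \<in> carrier \<FF>" and g: "g \<in> carrier G"
  shows "family_act g F = F \<longleftrightarrow> (\<forall>x\<in>carrier V. F (act g x) = germ_act V G act g x (F x))"
proof
  assume "family_act g F = F"
  then show "\<forall>x\<in>carrier V. F (act g x) = germ_act V G act g x (F x)"
    using family_act_at[OF g, of _ F] by simp
next
  assume "\<forall>x\<in>carrier V. F (act g x) = germ_act V G act g x (F x)"
  then show "family_act g F = F"
    by (intro families_eqI_act[OF g family_act_closed[OF g F] F]) (simp add: family_act_at[OF g])
qed

text \<open>
  Since \<open>G\<close> fixes \<open>e\<close>, \<open>g \<circ> \<phi>\<^sub>x = \<phi>\<^bsub>g\<cdot>x\<^esub> \<circ> g\<close> at \<open>e\<close> shows that the spread of a germ is as invariant as the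
  germ itself.
\<close>

lemma family_act_spread:
  assumes P: "P \<in> carrier (mer_stalk V \<one>)" and g: "g \<in> carrier G" and inv: "germ_act V G act g \<one> P = P"
  shows "family_act g (spread_germ P) = spread_germ P"
  unfolding family_act_fixed_iff[OF spread_germ_closed[OF P] g]
proof
  fix x assume x: "x \<in> carrier V"
  show "spread_germ P (act g x) = germ_act V G act g x (spread_germ P x)"
    using germ_act_trans[OF g x one_closed P] x g
    by (simp add: spread_germ_def act_closed act_unit inv)
qed

subsection \<open>Averages\<close>

definition average :: "('v \<Rightarrow> 'v mgerm) \<Rightarrow> 'v \<Rightarrow> 'v mgerm" where
  "average F = const_family V (1 / of_nat (card (carrier G))) \<otimes>\<^bsub>\<FF>\<^esub> (\<Oplus>\<^bsub>\<FF>\<^esub>g\<in>carrier G. family_act g F)"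

lemma family_act_funcset: "F \<in> carrier \<FF> \<Longrightarrow> (\<lambda>g. family_act g F) \<in> carrier G \<rightarrow> carrier \<FF>"
  by (simp add: family_act_closed)

lemma average_closed: "F \<in> carrier \<FF> \<Longrightarrow> average F \<in> carrier \<FF>"
  unfolding average_def by (intro fam.m_closed const_family_closed fam.finsum_closed family_act_funcset)

lemma family_act_average:
  assumes F: "F \<in> carrier \<FF>" and h: "h \<in> carrier G"
  shows "family_act h (average F) = average F"
proof -
  interpret h: ring_hom_cring \<FF> \<FF> "family_act h"
    by (rule ring_hom_cringI, unfold_locales) (rule family_act_hom[OF h])
  have "family_act h (\<Oplus>\<^bsub>\<FF>\<^esub>g\<in>carrier G. family_act g F) = (\<Oplus>\<^bsub>\<FF>\<^esub>g\<in>carrier G. family_act (h \<otimes>\<^bsub>G\<^esub> g) F)"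
    unfolding h.hom_finsum[OF family_act_funcset[OF F]] o_def
    using h F by (intro fam.finsum_cong') (auto simp: family_act_comp family_act_closed)
  also have "\<dots> = (\<Oplus>\<^bsub>\<FF>\<^esub>g\<in>(\<lambda>g. h \<otimes>\<^bsub>G\<^esub> g) ` carrier G. family_act g F)"
    using h F by (intro fam.finsum_reindex[symmetric]) (auto intro!: inj_onI simp: family_act_closed)
  also have "(\<lambda>g. h \<otimes>\<^bsub>G\<^esub> g) ` carrier G = carrier G"
    by (rule G.surj_const_mult[OF h])
  finally show ?thesis
    unfolding average_def
    using F h by (simp add: const_family_closed family_act_const fam.finsum_closed family_act_funcset)
qed

lemma const_family_sum:
  assumes "finite S" "F \<in> carrier \<FF>"
  shows "(\<Oplus>\<^bsub>\<FF>\<^esub>i\<in>S. F) = const_family V (of_nat (card S)) \<otimes>\<^bsub>\<FF>\<^esub> F"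
  using assms(1)
proof (induction S)
  case empty
  then show ?case using assms(2) by (simp add: const_family_ops)
next
  case (insert i S)
  then show ?case
    using assms(2) by (simp add: fam.finsum_insert const_family_ops fam.l_distr const_family_closed)
qed

lemma average_fixed:
  assumes F: "F \<in> carrier \<FF>" and inv: "\<And>g. g \<in> carrier G \<Longrightarrow> family_act g F = F"
  shows "average F = F"
proof -
  have card: "card (carrier G) > 0"
    using finite_G G.one_closed card_gt_0_iff by blast
  have "(\<Oplus>\<^bsub>\<FF>\<^esub>g\<in>carrier G. family_act g F) = (\<Oplus>\<^bsub>\<FF>\<^esub>g\<in>carrier G. F)"
    using F inv by (intro fam.finsum_cong') auto
  also have "\<dots> = const_family V (of_nat (card (carrier G))) \<otimes>\<^bsub>\<FF>\<^esub> F"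
    by (rule const_family_sum[OF finite_G F])
  finally show ?thesis
    unfolding average_def
    using F card by (simp add: fam.m_assoc[symmetric] const_family_closed const_family_ops(2)[symmetric] const_family_ops(3))
qed

lemma average_add:
  assumes F: "F \<in> carrier \<FF>" and H: "H \<in> carrier \<FF>"
  shows "average (F \<oplus>\<^bsub>\<FF>\<^esub> H) = average F \<oplus>\<^bsub>\<FF>\<^esub> average H"
proof -
  have "(\<Oplus>\<^bsub>\<FF>\<^esub>g\<in>carrier G. family_act g (F \<oplus>\<^bsub>\<FF>\<^esub> H))
      = (\<Oplus>\<^bsub>\<FF>\<^esub>g\<in>carrier G. family_act g F \<oplus>\<^bsub>\<FF>\<^esub> family_act g H)"
    using F H by (intro fam.finsum_cong') (auto simp: ring_hom_add[OF family_act_hom] family_act_closed)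
  also have "\<dots> = (\<Oplus>\<^bsub>\<FF>\<^esub>g\<in>carrier G. family_act g F) \<oplus>\<^bsub>\<FF>\<^esub> (\<Oplus>\<^bsub>\<FF>\<^esub>g\<in>carrier G. family_act g H)"
    by (rule fam.finsum_addf[OF family_act_funcset[OF F] family_act_funcset[OF H]])
  finally show ?thesis
    unfolding average_def
    using F H by (simp add: fam.r_distr const_family_closed fam.finsum_closed family_act_funcset)
qed

lemma average_invariant_mult:
  assumes L: "L \<in> carrier \<FF>" and F: "F \<in> carrier \<FF>" and inv: "\<And>g. g \<in> carrier G \<Longrightarrow> family_act g L = L"
  shows "average (L \<otimes>\<^bsub>\<FF>\<^esub> F) = L \<otimes>\<^bsub>\<FF>\<^esub> average F"
proof -
  have "(\<Oplus>\<^bsub>\<FF>\<^esub>g\<in>carrier G. family_act g (L \<otimes>\<^bsub>\<FF>\<^esub> F)) = (\<Oplus>\<^bsub>\<FF>\<^esub>g\<in>carrier G. L \<otimes>\<^bsub>\<FF>\<^esub> family_act g F)"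
    using L F inv by (intro fam.finsum_cong') (auto simp: ring_hom_mult[OF family_act_hom] family_act_closed)
  also have "\<dots> = L \<otimes>\<^bsub>\<FF>\<^esub> (\<Oplus>\<^bsub>\<FF>\<^esub>g\<in>carrier G. family_act g F)"
    by (rule fam.finsum_rdistr[OF finite_G L family_act_funcset[OF F], symmetric])
  finally show ?thesis
    unfolding average_def
    using F L by (simp add: fam.m_lcomm const_family_closed fam.finsum_closed family_act_funcset)
qed

end

section \<open>The ideals that are divided out\<close>

context sheaf_group_action
begin

abbreviation stab_inv :: "'v \<Rightarrow> 'v mgerm ring" where
  "stab_inv \<equiv> stab_inv_stalk V G act"

abbreviation inv_ideal' :: "'v mgerm set" ("\<J>") where
  "\<J> \<equiv> inv_ideal V G act"

definition invariant_generators :: "'v mgerm set" where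
  "invariant_generators = {mfrac V \<one> a (\<lambda>_. 1) | a. regular_at V \<one> a \<and> a \<one> = 0 \<and>
     (\<forall>g\<in>carrier G. germ_act V G act g \<one> (mfrac V \<one> a (\<lambda>_. 1)) = mfrac V \<one> a (\<lambda>_. 1))}"

lemma invariant_generatorsD:
  assumes "L \<in> invariant_generators"
  shows "L \<in> carrier (reg_stalk V \<one>)" "g \<in> carrier G \<Longrightarrow> germ_act V G act g \<one> L = L"
  using assms unfolding invariant_generators_def
  by (auto simp: reg_stalk_carrier fraction_at_def nonzerodiv_at_one)

interpretation O_e: cring "reg_stalk V \<one>"
  by (rule reg_stalk_cring[OF one_closed])

lemma inv_ideal_eq: "\<J> = genideal (reg_stalk V \<one>) invariant_generators"
  unfolding inv_ideal_def invariant_generators_def ..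

lemma inv_ideal_ideal: "ideal \<J> (reg_stalk V \<one>)"
  unfolding inv_ideal_eq using invariant_generatorsD by (intro O_e.genideal_ideal) blast

lemma inv_ideal_gen: "L \<in> invariant_generators \<Longrightarrow> L \<in> \<J>"
  unfolding inv_ideal_eq using invariant_generatorsD O_e.genideal_self[of invariant_generators] by blast

lemma inv_ideal_least:
  "ideal I (reg_stalk V \<one>) \<Longrightarrow> invariant_generators \<subseteq> I \<Longrightarrow> \<J> \<subseteq> I"
  unfolding inv_ideal_eq by (rule O_e.genideal_minimal)

lemma inv_ideal_reg: "P \<in> \<J> \<Longrightarrow> P \<in> carrier (reg_stalk V \<one>)"
  using ideal.Icarr[OF inv_ideal_ideal] .

lemma inv_ideal_add: "P \<in> \<J> \<Longrightarrow> Q \<in> \<J> \<Longrightarrow> P \<oplus>\<^bsub>mer_stalk V \<one>\<^esub> Q \<in> \<J>"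
  using additive_subgroup.a_closed[OF ideal.axioms(1)[OF inv_ideal_ideal]] by simp

lemma inv_ideal_zero: "\<zero>\<^bsub>mer_stalk V \<one>\<^esub> \<in> \<J>"
  using additive_subgroup.zero_closed[OF ideal.axioms(1)[OF inv_ideal_ideal]] by simp

lemma inv_ideal_mult:
  "P \<in> \<J> \<Longrightarrow> Q \<in> carrier (reg_stalk V \<one>) \<Longrightarrow> Q \<otimes>\<^bsub>mer_stalk V \<one>\<^esub> P \<in> \<J>"
  "P \<in> \<J> \<Longrightarrow> Q \<in> carrier (reg_stalk V \<one>) \<Longrightarrow> P \<otimes>\<^bsub>mer_stalk V \<one>\<^esub> Q \<in> \<J>"
  using ideal.I_l_closed[OF inv_ideal_ideal] ideal.I_r_closed[OF inv_ideal_ideal] by simp_all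

text \<open>
  \<open>G\<close> fixes the generators, and the preimage of the ideal under a ring automorphism is an ideal.
\<close>

lemma germ_act_inv_ideal:
  assumes g: "g \<in> carrier G" and P: "P \<in> \<J>"
  shows "germ_act V G act g \<one> P \<in> \<J>"
proof -
  let ?\<gamma> = "germ_act V G act g \<one>"
  note hom = germ_act_hom[OF g one_closed, unfolded act_unit[OF g]]
  note reg = reg_stalk_mer[OF one_closed]
  have \<gamma>_reg: "?\<gamma> P \<in> carrier (reg_stalk V \<one>)" if "P \<in> carrier (reg_stalk V \<one>)" for P
    using germ_act_reg[OF g one_closed that] by (simp add: act_unit[OF g])
  let ?I = "{P \<in> carrier (reg_stalk V \<one>). ?\<gamma> P \<in> \<J>}"
  have "ideal ?I (reg_stalk V \<one>)"
  proof (rule O_e.ideal_of_closed)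
    have "?\<gamma> \<zero>\<^bsub>mer_stalk V \<one>\<^esub> = \<zero>\<^bsub>mer_stalk V \<one>\<^esub>"
      using mer_stalk_cring[OF one_closed] by (intro ring_hom_zero[OF hom]) (simp_all add: cring.axioms(1))
    then show "\<zero>\<^bsub>reg_stalk V \<one>\<^esub> \<in> ?I"
      using inv_ideal_zero by (simp add: zero_reg)
    fix P Q assume P: "P \<in> ?I"
    {
      assume "Q \<in> ?I"
      then show "P \<oplus>\<^bsub>reg_stalk V \<one>\<^esub> Q \<in> ?I"
        using P by (simp add: ring_hom_add[OF hom] reg inv_ideal_add reg_stalk_closed)
    next
      assume "Q \<in> carrier (reg_stalk V \<one>)"
      then show "Q \<otimes>\<^bsub>reg_stalk V \<one>\<^esub> P \<in> ?I"
        using P by (simp add: ring_hom_mult[OF hom] reg inv_ideal_mult reg_stalk_closed \<gamma>_reg)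
    }
  qed auto
  moreover have "invariant_generators \<subseteq> ?I"
    using invariant_generatorsD(1) invariant_generatorsD(2)[OF _ g] by (auto intro: inv_ideal_gen)
  ultimately show ?thesis
    using inv_ideal_least P by blast
qed

text \<open>The germ at the identity that is carried to \<open>P\<close> by the translation to \<open>x\<close>.\<close>

definition to_unit :: "'v \<Rightarrow> 'v mgerm \<Rightarrow> 'v mgerm" where
  "to_unit x = germ_trans V (inv x) x"

lemma to_unit_hom: "x \<in> carrier V \<Longrightarrow> to_unit x \<in> Ring.ring_hom (mer_stalk V x) (mer_stalk V \<one>)"
  using germ_trans_hom[of "inv x" x] by (simp add: to_unit_def)

lemma to_unit_reg: "x \<in> carrier V \<Longrightarrow> P \<in> carrier (reg_stalk V x) \<Longrightarrow> to_unit x P \<in> carrier (reg_stalk V \<one>)"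
  using germ_trans_reg[of "inv x" x P] by (simp add: to_unit_def)

lemma trans_to_unit:
  assumes x: "x \<in> carrier V" and P: "P \<in> carrier (mer_stalk V x)"
  shows "germ_trans V x \<one> (to_unit x P) = P"
  using germ_trans_comp[OF x inv_closed[OF x] x P] x P by (simp add: to_unit_def germ_trans_one)

lemma to_unit_trans:
  assumes x: "x \<in> carrier V" and P: "P \<in> carrier (mer_stalk V \<one>)"
  shows "to_unit x (germ_trans V x \<one> P) = P"
  using germ_trans_comp[OF inv_closed[OF x] x one_closed P] x P by (simp add: to_unit_def germ_trans_one)

lemma germ_act_to_unit:
  assumes g: "g \<in> carrier G" and x: "x \<in> carrier V" and P: "P \<in> carrier (mer_stalk V x)"
  shows "to_unit (act g x) (germ_act V G act g x P) = germ_act V G act g \<one> (to_unit x P)"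
  using germ_act_trans[OF g inv_closed[OF x] x P] g x by (simp add: to_unit_def act_inv)

lemma stab_inv_carrier:
  "P \<in> carrier (stab_inv x) \<longleftrightarrow>
    P \<in> carrier (reg_stalk V x) \<and> (\<forall>g\<in>carrier G. act g x = x \<longrightarrow> germ_act V G act g x P = P)"
  by (auto simp: stab_inv_stalk_def stabilizer_def)

lemma stab_inv_ops [simp]:
  "(\<otimes>\<^bsub>stab_inv x\<^esub>) = (\<otimes>\<^bsub>mer_stalk V x\<^esub>)" "(\<oplus>\<^bsub>stab_inv x\<^esub>) = (\<oplus>\<^bsub>mer_stalk V x\<^esub>)"
  "\<one>\<^bsub>stab_inv x\<^esub> = \<one>\<^bsub>mer_stalk V x\<^esub>" "\<zero>\<^bsub>stab_inv x\<^esub> = \<zero>\<^bsub>mer_stalk V x\<^esub>"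
  by (simp_all add: stab_inv_stalk_def)

lemma stab_inv_mer: "x \<in> carrier V \<Longrightarrow> P \<in> carrier (stab_inv x) \<Longrightarrow> P \<in> carrier (mer_stalk V x)"
  by (simp add: stab_inv_carrier reg_stalk_mer)

lemma stab_inv_cring:
  assumes x: "x \<in> carrier V"
  shows "cring (stab_inv x)"
proof -
  interpret R: cring "mer_stalk V x"
    by (rule mer_stalk_cring[OF x])
  have hom: "germ_act V G act g x \<in> Ring.ring_hom (mer_stalk V x) (mer_stalk V x)"
    if "g \<in> carrier G" "act g x = x" for g
    using germ_act_hom[OF that(1) x] that(2) by simp
  have "subring (carrier (stab_inv x)) (mer_stalk V x)"
  proof (rule R.subringI)
    show "carrier (stab_inv x) \<subseteq> carrier (mer_stalk V x)"
      using stab_inv_mer[OF x] by blast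
    show "\<one>\<^bsub>mer_stalk V x\<^esub> \<in> carrier (stab_inv x)"
      using subringE(3)[OF reg_stalk_subring[OF x]] ring_hom_one[OF hom] by (simp add: stab_inv_carrier)
    fix P assume P: "P \<in> carrier (stab_inv x)"
    have "germ_act V G act g x (\<ominus>\<^bsub>mer_stalk V x\<^esub> P) = \<ominus>\<^bsub>mer_stalk V x\<^esub> P"
      if "g \<in> carrier G" "act g x = x" for g
    proof -
      interpret h: ring_hom_cring "mer_stalk V x" "mer_stalk V x" "germ_act V G act g x"
        by (rule ring_hom_cringI, unfold_locales) (rule hom[OF that])
      show ?thesis
        using P that stab_inv_mer[OF x P] by (simp add: stab_inv_carrier)
    qed
    then show "\<ominus>\<^bsub>mer_stalk V x\<^esub> P \<in> carrier (stab_inv x)"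
      using P subringE(5)[OF reg_stalk_subring[OF x]] by (simp add: stab_inv_carrier)
    fix Q assume Q: "Q \<in> carrier (stab_inv x)"
    show "P \<otimes>\<^bsub>mer_stalk V x\<^esub> Q \<in> carrier (stab_inv x)" "P \<oplus>\<^bsub>mer_stalk V x\<^esub> Q \<in> carrier (stab_inv x)"
      using P Q stab_inv_mer[OF x P] stab_inv_mer[OF x Q]
      by (simp_all add: stab_inv_carrier reg_stalk_closed[OF x] ring_hom_mult[OF hom] ring_hom_add[OF hom])
  qed
  from R.subring_cring[OF this] show ?thesis
    by (simp add: stab_inv_stalk_def reg_stalk_def)
qed

text \<open>
  Translation to \<open>e\<close> intertwines the actions of the stabilizer of \<open>x\<close> at \<open>x\<close> and at \<open>e\<close>, so invariance under
  the stabilizer can be tested at \<open>x\<close>, and membership in the ideal at \<open>e\<close>.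
\<close>

lemma trans_ideal_iff:
  assumes x: "x \<in> carrier V"
  shows "P \<in> trans_ideal V G act x \<longleftrightarrow> P \<in> carrier (stab_inv x) \<and> to_unit x P \<in> \<J>"
proof
  assume "P \<in> trans_ideal V G act x"
  then obtain p where p: "P = germ_trans V x \<one> p" "p \<in> carrier (reg_stalk V \<one>)" "p \<in> \<J>"
    "\<And>g. g \<in> carrier G \<Longrightarrow> act g x = x \<Longrightarrow> germ_act V G act g \<one> p = p"
    by (auto simp: trans_ideal_def stabilizer_def)
  have p': "p \<in> carrier (mer_stalk V \<one>)"
    using p(2) by (simp add: reg_stalk_mer)
  have "germ_act V G act g x P = P" if "g \<in> carrier G" "act g x = x" for g
    using germ_act_trans[OF that(1) x one_closed p'] that p(1,4) x by (simp add: act_unit)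
  moreover have "P \<in> carrier (reg_stalk V x)"
    using germ_trans_reg[OF x one_closed p(2)] p(1) x by simp
  ultimately show "P \<in> carrier (stab_inv x) \<and> to_unit x P \<in> \<J>"
    using p to_unit_trans[OF x p'] by (simp add: stab_inv_carrier)
next
  assume P: "P \<in> carrier (stab_inv x) \<and> to_unit x P \<in> \<J>"
  then have P': "P \<in> carrier (mer_stalk V x)"
    using stab_inv_mer[OF x] by blast
  have "germ_act V G act g \<one> (to_unit x P) = to_unit x P" if "g \<in> carrier G" "act g x = x" for g
    using germ_act_to_unit[OF that(1) x P'] that P by (simp add: stab_inv_carrier)
  then have "germ_trans V x \<one> (to_unit x P) \<in> trans_ideal V G act x"
    unfolding trans_ideal_def using P inv_ideal_reg by (intro imageI) (auto simp: stabilizer_def)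
  then show "P \<in> trans_ideal V G act x"
    by (simp add: trans_to_unit[OF x P'])
qed

lemma trans_ideal_ideal:
  assumes x: "x \<in> carrier V"
  shows "ideal (trans_ideal V G act x) (stab_inv x)"
proof -
  interpret R: cring "stab_inv x"
    by (rule stab_inv_cring[OF x])
  note hom = to_unit_hom[OF x]
  note mer = stab_inv_mer[OF x]
  show ?thesis
  proof (rule R.ideal_of_closed)
    show "trans_ideal V G act x \<subseteq> carrier (stab_inv x)"
      using trans_ideal_iff[OF x] by blast
    have "to_unit x \<zero>\<^bsub>mer_stalk V x\<^esub> = \<zero>\<^bsub>mer_stalk V \<one>\<^esub>"
      using mer_stalk_cring[OF one_closed] mer_stalk_cring[OF x]
      by (intro ring_hom_zero[OF hom]) (simp_all add: cring.axioms(1))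
    then show "\<zero>\<^bsub>stab_inv x\<^esub> \<in> trans_ideal V G act x"
      using R.zero_closed inv_ideal_zero by (simp add: trans_ideal_iff[OF x])
    fix P Q assume P: "P \<in> trans_ideal V G act x"
    {
      assume Q: "Q \<in> trans_ideal V G act x"
      then show "P \<oplus>\<^bsub>stab_inv x\<^esub> Q \<in> trans_ideal V G act x"
        using P R.a_closed[of P Q] by (simp add: trans_ideal_iff[OF x] ring_hom_add[OF hom] mer inv_ideal_add)
    next
      assume Q: "Q \<in> carrier (stab_inv x)"
      then have "to_unit x Q \<in> carrier (reg_stalk V \<one>)"
        by (intro to_unit_reg[OF x]) (simp add: stab_inv_carrier)
      then show "Q \<otimes>\<^bsub>stab_inv x\<^esub> P \<in> trans_ideal V G act x"
        using P Q R.m_closed[of Q P] by (simp add: trans_ideal_iff[OF x] ring_hom_mult[OF hom] mer inv_ideal_mult)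
    }
  qed
qed

text \<open>
  The stabilizer of \<open>g\<cdot>x\<close> is the conjugate by \<open>g\<close> of the stabilizer of \<open>x\<close>.
\<close>

lemma germ_act_stab_inv:
  assumes g: "g \<in> carrier G" and x: "x \<in> carrier V" and P: "P \<in> carrier (stab_inv x)"
  shows "germ_act V G act g x P \<in> carrier (stab_inv (act g x))"
  unfolding stab_inv_carrier
proof (intro conjI ballI impI)
  note P' = stab_inv_mer[OF x P]
  show "germ_act V G act g x P \<in> carrier (reg_stalk V (act g x))"
    using P by (intro germ_act_reg[OF g x]) (simp add: stab_inv_carrier)
  fix h assume h: "h \<in> carrier G" "act h (act g x) = act g x"
  let ?k = "inv\<^bsub>G\<^esub> g \<otimes>\<^bsub>G\<^esub> (h \<otimes>\<^bsub>G\<^esub> g)"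
  have k: "?k \<in> carrier G" "act ?k x = x" "g \<otimes>\<^bsub>G\<^esub> ?k = h \<otimes>\<^bsub>G\<^esub> g"
    using g h x by (simp_all add: act_act[symmetric] act_closed act_cancel G.m_assoc[symmetric])
  have "germ_act V G act h (act g x) (germ_act V G act g x P) = germ_act V G act (g \<otimes>\<^bsub>G\<^esub> ?k) x P"
    unfolding k(3) by (rule germ_act_comp[OF h(1) g x P'])
  also have "\<dots> = germ_act V G act g x (germ_act V G act ?k x P)"
    using germ_act_comp[OF g k(1) x P'] k(2) by simp
  also have "germ_act V G act ?k x P = P"
    using P k by (simp add: stab_inv_carrier)
  finally show "germ_act V G act h (act g x) (germ_act V G act g x P) = germ_act V G act g x P" .
qed

lemma germ_act_trans_ideal:
  assumes g: "g \<in> carrier G" and x: "x \<in> carrier V"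
  shows "germ_act V G act g x ` trans_ideal V G act x = trans_ideal V G act (act g x)"
proof -
  have sub: "germ_act V G act g x P \<in> trans_ideal V G act (act g x)"
    if "g \<in> carrier G" "x \<in> carrier V" "P \<in> trans_ideal V G act x" for g x P
    using that stab_inv_mer[OF that(2)]
    by (simp add: trans_ideal_iff act_closed germ_act_stab_inv germ_act_to_unit germ_act_inv_ideal)
  show ?thesis
  proof (intro equalityI subsetI)
    fix Q assume "Q \<in> germ_act V G act g x ` trans_ideal V G act x"
    then show "Q \<in> trans_ideal V G act (act g x)"
      using sub[OF g x] by blast
  next
    fix Q assume Q: "Q \<in> trans_ideal V G act (act g x)"
    let ?h = "inv\<^bsub>G\<^esub> g" and ?y = "act g x"
    have y: "?y \<in> carrier V" and h: "?h \<in> carrier G" "act ?h ?y = x"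
      using g x by (simp_all add: act_closed act_cancel)
    have Q': "Q \<in> carrier (mer_stalk V ?y)"
      using Q y stab_inv_mer by (simp add: trans_ideal_iff)
    have "germ_act V G act ?h ?y Q \<in> trans_ideal V G act x"
      using sub[OF h(1) y Q] h(2) by simp
    moreover have "germ_act V G act g x (germ_act V G act ?h ?y Q) = Q"
      using germ_act_comp[OF g h(1) y Q'] g y Q' h(2) by (simp add: germ_act_one)
    ultimately show "Q \<in> germ_act V G act g x ` trans_ideal V G act x"
      by (metis imageI)
  qed
qed

subsection \<open>Cosets\<close>

abbreviation "E_cls \<equiv> E_class V G act"
abbreviation "E_rng \<equiv> E_ring V G act"

lemma E_class_hom: "x \<in> carrier V \<Longrightarrow> E_cls x \<in> Ring.ring_hom (stab_inv x) (E_rng x)"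
  using ideal.rcos_ring_hom[OF trans_ideal_ideal, of x]
  by (simp add: E_ring_def E_class_def[abs_def])

lemma E_ring_ring: "x \<in> carrier V \<Longrightarrow> ring (E_rng x)"
  unfolding E_ring_def by (rule ideal.quotient_is_ring[OF trans_ideal_ideal])

lemma E_ring_carrier: "carrier (E_rng x) = E_cls x ` carrier (stab_inv x)"
  by (auto simp: E_ring_def E_class_def FactRing_def A_RCOSETS_def')

lemma E_ring_zero: "\<zero>\<^bsub>E_rng x\<^esub> = trans_ideal V G act x"
  by (simp add: E_ring_def FactRing_def)

lemma E_class_set: "E_cls x P = (\<lambda>i. i \<oplus>\<^bsub>mer_stalk V x\<^esub> P) ` trans_ideal V G act x"
  by (auto simp: E_class_def a_r_coset_def')

lemma E_class_zero_iff:
  assumes x: "x \<in> carrier V" and P: "P \<in> carrier (stab_inv x)"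
  shows "E_cls x P = \<zero>\<^bsub>E_rng x\<^esub> \<longleftrightarrow> P \<in> trans_ideal V G act x"
proof -
  interpret R: cring "stab_inv x"
    by (rule stab_inv_cring[OF x])
  have "P = \<zero>\<^bsub>mer_stalk V x\<^esub> \<oplus>\<^bsub>mer_stalk V x\<^esub> P"
    using R.l_zero[OF P] by simp
  then have "P \<in> E_cls x P"
    using ideal.axioms(1)[OF trans_ideal_ideal[OF x], THEN additive_subgroup.zero_closed]
    unfolding E_class_set by auto
  moreover have "E_cls x P = trans_ideal V G act x" if "P \<in> trans_ideal V G act x"
    unfolding E_class_def using that
    by (intro abelian_subgroup.a_rcos_const abelian_subgroupI3 ideal.axioms(1)[OF trans_ideal_ideal[OF x]] R.is_abelian_group)
  ultimately show ?thesis
    unfolding E_ring_zero by blast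
qed

lemma E_class_eqD:
  assumes x: "x \<in> carrier V" and P: "P \<in> carrier (stab_inv x)" and Q: "Q \<in> carrier (stab_inv x)"
    and eq: "E_cls x P = E_cls x Q"
  obtains i where "i \<in> trans_ideal V G act x" "P = i \<oplus>\<^bsub>mer_stalk V x\<^esub> Q"
proof -
  interpret R: cring "stab_inv x"
    by (rule stab_inv_cring[OF x])
  have "P = \<zero>\<^bsub>mer_stalk V x\<^esub> \<oplus>\<^bsub>mer_stalk V x\<^esub> P"
    using R.l_zero[OF P] by simp
  then have "P \<in> E_cls x P"
    using ideal.axioms(1)[OF trans_ideal_ideal[OF x], THEN additive_subgroup.zero_closed]
    unfolding E_class_set by auto
  then have "P \<in> E_cls x Q"
    by (simp add: eq)
  then show thesis
    using that unfolding E_class_set by blast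
qed

lemma E_class_shift:
  assumes x: "x \<in> carrier V" and i: "i \<in> trans_ideal V G act x" and Q: "Q \<in> carrier (stab_inv x)"
  shows "E_cls x (i \<oplus>\<^bsub>mer_stalk V x\<^esub> Q) = E_cls x Q"
proof -
  interpret E: ring "E_rng x"
    by (rule E_ring_ring[OF x])
  have i': "i \<in> carrier (stab_inv x)"
    using i trans_ideal_iff[OF x] by blast
  have "E_cls x (i \<oplus>\<^bsub>mer_stalk V x\<^esub> Q) = E_cls x i \<oplus>\<^bsub>E_rng x\<^esub> E_cls x Q"
    using ring_hom_add[OF E_class_hom[OF x] i' Q] by simp
  also have "\<dots> = E_cls x Q"
    using E_class_zero_iff[OF x i'] i Q ring_hom_closed[OF E_class_hom[OF x] Q] by simp
  finally show ?thesis .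
qed

lemma germ_act_E_class:
  assumes g: "g \<in> carrier G" and x: "x \<in> carrier V" and P: "P \<in> carrier (stab_inv x)"
  shows "germ_act V G act g x ` E_cls x P = E_cls (act g x) (germ_act V G act g x P)"
proof -
  have "germ_act V G act g x (i \<oplus>\<^bsub>mer_stalk V x\<^esub> P)
      = germ_act V G act g x i \<oplus>\<^bsub>mer_stalk V (act g x)\<^esub> germ_act V G act g x P"
    if "i \<in> trans_ideal V G act x" for i
    using that stab_inv_mer[OF x] P by (intro ring_hom_add[OF germ_act_hom[OF g x]]) (auto simp: trans_ideal_iff[OF x])
  then show ?thesis
    unfolding E_class_set germ_act_trans_ideal[OF g x, symmetric] by (auto simp: image_image)
qed

end

section \<open>Invariant families of regular germs\<close>

context sheaf_group_action
begin

definition delta :: "'v \<Rightarrow> 'v mgerm \<Rightarrow> 'v \<Rightarrow> 'v mgerm" where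
  "delta x P = (\<lambda>y\<in>carrier V. if y = x then P else \<zero>\<^bsub>mer_stalk V y\<^esub>)"

lemma mer_stalk_zero_closed: "x \<in> carrier V \<Longrightarrow> \<zero>\<^bsub>mer_stalk V x\<^esub> \<in> carrier (mer_stalk V x)"
  by (simp add: zero_reg reg_stalk_mer)

lemma germ_hom_zero:
  assumes "h \<in> Ring.ring_hom (mer_stalk V x) (mer_stalk V y)" "x \<in> carrier V" "y \<in> carrier V"
  shows "h \<zero>\<^bsub>mer_stalk V x\<^esub> = \<zero>\<^bsub>mer_stalk V y\<^esub>"
  using assms mer_stalk_cring by (intro ring_hom_zero) (auto simp: cring.axioms(1))

lemma mer_stalk_zero_simps:
  assumes "x \<in> carrier V"
  shows "P \<in> carrier (mer_stalk V x) \<Longrightarrow> P \<otimes>\<^bsub>mer_stalk V x\<^esub> \<zero>\<^bsub>mer_stalk V x\<^esub> = \<zero>\<^bsub>mer_stalk V x\<^esub>"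
    and "\<zero>\<^bsub>mer_stalk V x\<^esub> \<oplus>\<^bsub>mer_stalk V x\<^esub> \<zero>\<^bsub>mer_stalk V x\<^esub> = \<zero>\<^bsub>mer_stalk V x\<^esub>"
proof -
  interpret R: cring "mer_stalk V x"
    by (rule mer_stalk_cring[OF assms])
  show "P \<in> carrier (mer_stalk V x) \<Longrightarrow> P \<otimes>\<^bsub>mer_stalk V x\<^esub> \<zero>\<^bsub>mer_stalk V x\<^esub> = \<zero>\<^bsub>mer_stalk V x\<^esub>"
    and "\<zero>\<^bsub>mer_stalk V x\<^esub> \<oplus>\<^bsub>mer_stalk V x\<^esub> \<zero>\<^bsub>mer_stalk V x\<^esub> = \<zero>\<^bsub>mer_stalk V x\<^esub>"
    by simp_all
qed

lemma delta_closed: "x \<in> carrier V \<Longrightarrow> P \<in> carrier (mer_stalk V x) \<Longrightarrow> delta x P \<in> carrier \<FF>"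
  by (auto simp: delta_def germ_families_ops mer_stalk_zero_closed)

lemma delta_add:
  assumes "x \<in> carrier V" "P \<in> carrier (mer_stalk V x)" "Q \<in> carrier (mer_stalk V x)"
  shows "delta x (P \<oplus>\<^bsub>mer_stalk V x\<^esub> Q) = delta x P \<oplus>\<^bsub>\<FF>\<^esub> delta x Q"
  unfolding delta_def germ_families_ops
  by (rule restrict_ext) (auto simp: mer_stalk_zero_simps)

lemma delta_zero: "delta x \<zero>\<^bsub>mer_stalk V x\<^esub> = \<zero>\<^bsub>\<FF>\<^esub>"
  unfolding delta_def germ_families_ops by (rule restrict_ext) simp

lemma spread_germ_reg:
  "P \<in> carrier (reg_stalk V \<one>) \<Longrightarrow> x \<in> carrier V \<Longrightarrow> spread_germ P x \<in> carrier (reg_stalk V x)"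
  using germ_trans_reg[of x \<one> P] by (simp add: spread_germ_def)

text \<open>
  A multiple of \<open>p\<close> placed at \<open>x\<close> is the spread of \<open>p\<close> times the coefficient placed at \<open>x\<close>.
\<close>

lemma spread_germ_delta:
  assumes x: "x \<in> carrier V" and a: "a \<in> carrier (mer_stalk V \<one>)" and p: "p \<in> carrier (mer_stalk V \<one>)"
  shows "delta x (germ_trans V x \<one> (a \<otimes>\<^bsub>mer_stalk V \<one>\<^esub> p)) = spread_germ p \<otimes>\<^bsub>\<FF>\<^esub> delta x (germ_trans V x \<one> a)"
proof -
  note hom = germ_trans_hom[OF x one_closed, unfolded r_one[OF x]]
  have tr: "germ_trans V y \<one> p \<in> carrier (mer_stalk V y)" if "y \<in> carrier V" for y
    using ring_hom_closed[OF germ_trans_hom[OF that one_closed] p] that by simp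
  have "germ_trans V x \<one> (a \<otimes>\<^bsub>mer_stalk V \<one>\<^esub> p) = germ_trans V x \<one> p \<otimes>\<^bsub>mer_stalk V x\<^esub> germ_trans V x \<one> a"
    unfolding ring_hom_mult[OF hom a p]
    by (rule comm_monoid.m_comm[OF cring.axioms(2)[OF mer_stalk_cring[OF x]]]) (simp_all add: ring_hom_closed[OF hom] a p)
  then show ?thesis
    unfolding delta_def germ_families_ops spread_germ_def
    by (intro restrict_ext) (auto simp: mer_stalk_zero_simps tr)
qed

end

locale invariant_set = sheaf_group_action V G act
  for V :: "('v, 'z) sgroup_scheme" (structure) and G :: "('g, 'y) monoid_scheme" and act +
  fixes W :: "'v set"
  assumes W_carrier: "W \<subseteq> carrier V"
    and W_invariant: "g \<in> carrier G \<Longrightarrow> x \<in> W \<Longrightarrow> act g x \<in> W"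
begin

lemma act_W_iff: "g \<in> carrier G \<Longrightarrow> x \<in> carrier V \<Longrightarrow> act g x \<in> W \<longleftrightarrow> x \<in> W"
  using W_invariant[of g x] W_invariant[of "inv\<^bsub>G\<^esub> g" "act g x"] by (auto simp: act_cancel)

text \<open>
  Finitely supported families of regular germs on \<open>W\<close>, before invariance is imposed: this is where
  single germs live and where averaging starts.
\<close>

definition reg_families :: "('v \<Rightarrow> 'v mgerm) set" where
  "reg_families = {F \<in> carrier \<FF>. finite {x \<in> carrier V. F x \<noteq> \<zero>\<^bsub>mer_stalk V x\<^esub>} \<and>
     (\<forall>x\<in>carrier V - W. F x = \<zero>\<^bsub>mer_stalk V x\<^esub>) \<and> (\<forall>x\<in>carrier V. F x \<in> carrier (reg_stalk V x))}"

definition inv_families :: "('v \<Rightarrow> 'v mgerm) set" where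
  "inv_families = {F \<in> reg_families. \<forall>g\<in>carrier G. family_act g F = F}"

definition kernel :: "('v \<Rightarrow> 'v mgerm) set" where
  "kernel = {F \<in> inv_families. \<forall>x\<in>carrier V. F x \<in> trans_ideal V G act x}"

lemma reg_familiesD:
  assumes "F \<in> reg_families"
  shows "F \<in> carrier \<FF>" "finite {x \<in> carrier V. F x \<noteq> \<zero>\<^bsub>mer_stalk V x\<^esub>}"
    "x \<in> carrier V - W \<Longrightarrow> F x = \<zero>\<^bsub>mer_stalk V x\<^esub>" "x \<in> carrier V \<Longrightarrow> F x \<in> carrier (reg_stalk V x)"
  using assms by (auto simp: reg_families_def)

lemma inv_familiesD: "F \<in> inv_families \<Longrightarrow> F \<in> reg_families" "F \<in> inv_families \<Longrightarrow> F \<in> carrier \<FF>"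
  by (auto simp: inv_families_def reg_families_def)

lemma reg_families_zero: "\<zero>\<^bsub>\<FF>\<^esub> \<in> reg_families"
proof -
  have fin: "finite {x \<in> carrier V. \<zero>\<^bsub>\<FF>\<^esub> x \<noteq> \<zero>\<^bsub>mer_stalk V x\<^esub>}"
    by (rule finite_subset[of _ "{}"]) (auto simp: families_at)
  show ?thesis
    unfolding reg_families_def by (intro CollectI conjI fin ballI) (simp_all add: families_at zero_reg)
qed

lemma reg_families_add:
  assumes F: "F \<in> reg_families" and H: "H \<in> reg_families"
  shows "F \<oplus>\<^bsub>\<FF>\<^esub> H \<in> reg_families"
proof -
  have "{x \<in> carrier V. (F \<oplus>\<^bsub>\<FF>\<^esub> H) x \<noteq> \<zero>\<^bsub>mer_stalk V x\<^esub>}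
      \<subseteq> {x \<in> carrier V. F x \<noteq> \<zero>\<^bsub>mer_stalk V x\<^esub>} \<union> {x \<in> carrier V. H x \<noteq> \<zero>\<^bsub>mer_stalk V x\<^esub>}"
    by (auto simp: families_at mer_stalk_zero_simps)
  then have "finite {x \<in> carrier V. (F \<oplus>\<^bsub>\<FF>\<^esub> H) x \<noteq> \<zero>\<^bsub>mer_stalk V x\<^esub>}"
    using reg_familiesD(2)[OF F] reg_familiesD(2)[OF H] finite_subset by blast
  then show ?thesis
    using F H by (auto simp: reg_families_def families_at mer_stalk_zero_simps reg_stalk_closed)
qed

lemma reg_families_mult:
  assumes L: "L \<in> carrier \<FF>" "\<And>x. x \<in> carrier V \<Longrightarrow> L x \<in> carrier (reg_stalk V x)" and F: "F \<in> reg_families"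
  shows "L \<otimes>\<^bsub>\<FF>\<^esub> F \<in> reg_families"
proof -
  have "{x \<in> carrier V. (L \<otimes>\<^bsub>\<FF>\<^esub> F) x \<noteq> \<zero>\<^bsub>mer_stalk V x\<^esub>} \<subseteq> {x \<in> carrier V. F x \<noteq> \<zero>\<^bsub>mer_stalk V x\<^esub>}"
    using families_in[OF L(1)] by (auto simp: families_at mer_stalk_zero_simps)
  then have "finite {x \<in> carrier V. (L \<otimes>\<^bsub>\<FF>\<^esub> F) x \<noteq> \<zero>\<^bsub>mer_stalk V x\<^esub>}"
    using reg_familiesD(2)[OF F] finite_subset by blast
  then show ?thesis
    using L F families_in[OF L(1)] by (auto simp: reg_families_def families_at mer_stalk_zero_simps reg_stalk_closed)
qed

lemma reg_families_smult: "F \<in> reg_families \<Longrightarrow> const_family V c \<otimes>\<^bsub>\<FF>\<^esub> F \<in> reg_families"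
  by (rule reg_families_mult) (simp_all add: const_family_closed const_family_at mconst_reg)

lemma reg_families_sum:
  assumes "finite S" "\<And>i. i \<in> S \<Longrightarrow> f i \<in> reg_families"
  shows "(\<Oplus>\<^bsub>\<FF>\<^esub>i\<in>S. f i) \<in> reg_families"
  using assms
proof (induction S)
  case empty
  then show ?case by (simp add: reg_families_zero)
next
  case (insert i S)
  then show ?case
    using reg_familiesD(1) by (subst fam.finsum_insert) (auto intro!: reg_families_add)
qed

lemma family_act_reg:
  assumes F: "F \<in> reg_families" and g: "g \<in> carrier G"
  shows "family_act g F \<in> reg_families"
proof -
  let ?h = "inv\<^bsub>G\<^esub> g"
  have at: "family_act g F x = germ_act V G act g (act ?h x) (F (act ?h x))" if "x \<in> carrier V" for x
    using family_act_at[OF g, of "act ?h x" F] that g by (simp add: act_closed act_cancel)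
  have zero: "family_act g F x = \<zero>\<^bsub>mer_stalk V x\<^esub>"
    if x: "x \<in> carrier V" and "F (act ?h x) = \<zero>\<^bsub>mer_stalk V (act ?h x)\<^esub>" for x
    using germ_hom_zero[OF germ_act_hom[OF g, of "act ?h x"]] that g by (simp add: at act_closed act_cancel)
  have "{x \<in> carrier V. family_act g F x \<noteq> \<zero>\<^bsub>mer_stalk V x\<^esub>} \<subseteq> act g ` {x \<in> carrier V. F x \<noteq> \<zero>\<^bsub>mer_stalk V x\<^esub>}"
  proof
    fix x assume x: "x \<in> {x \<in> carrier V. family_act g F x \<noteq> \<zero>\<^bsub>mer_stalk V x\<^esub>}"
    then show "x \<in> act g ` {x \<in> carrier V. F x \<noteq> \<zero>\<^bsub>mer_stalk V x\<^esub>}"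
      using zero g by (intro image_eqI[of _ _ "act ?h x"]) (auto simp: act_cancel act_closed)
  qed
  then have fin: "finite {x \<in> carrier V. family_act g F x \<noteq> \<zero>\<^bsub>mer_stalk V x\<^esub>}"
    using reg_familiesD(2)[OF F] finite_surj by blast
  have off: "family_act g F x = \<zero>\<^bsub>mer_stalk V x\<^esub>" if "x \<in> carrier V - W" for x
    using that g by (intro zero reg_familiesD(3)[OF F]) (auto simp: act_W_iff act_closed)
  have reg: "family_act g F x \<in> carrier (reg_stalk V x)" if x: "x \<in> carrier V" for x
    using germ_act_reg[OF g _ reg_familiesD(4)[OF F], of "act ?h x"] x g by (simp add: at act_closed act_cancel)
  show ?thesis
    using fin off reg family_act_closed[OF g reg_familiesD(1)[OF F]] by (simp add: reg_families_def)
qed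

lemma average_inv_families:
  assumes F: "F \<in> reg_families"
  shows "average F \<in> inv_families"
proof -
  have "average F \<in> reg_families"
    unfolding average_def using F finite_G by (intro reg_families_smult reg_families_sum family_act_reg)
  then show ?thesis
    using reg_familiesD(1)[OF F] by (simp add: inv_families_def family_act_average)
qed

lemma average_inv: "F \<in> inv_families \<Longrightarrow> average F = F"
  using inv_familiesD(2) by (intro average_fixed) (auto simp: inv_families_def)

lemma delta_reg_families:
  assumes "x \<in> W" "P \<in> carrier (reg_stalk V x)"
  shows "delta x P \<in> reg_families"
proof -
  have x: "x \<in> carrier V"
    using assms W_carrier by blast
  have "finite {y \<in> carrier V. delta x P y \<noteq> \<zero>\<^bsub>mer_stalk V y\<^esub>}"
    by (rule finite_subset[of _ "{x}"]) (auto simp: delta_def)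
  then show ?thesis
    using assms x delta_closed[OF x reg_stalk_mer[OF x assms(2)]] by (auto simp: reg_families_def delta_def zero_reg)
qed

lemma delta_decomposition:
  assumes F: "F \<in> reg_families"
  shows "F = (\<Oplus>\<^bsub>\<FF>\<^esub>x\<in>{x \<in> carrier V. F x \<noteq> \<zero>\<^bsub>mer_stalk V x\<^esub>}. delta x (F x))"
proof -
  let ?S = "{x \<in> carrier V. F x \<noteq> \<zero>\<^bsub>mer_stalk V x\<^esub>}"
  have d: "(\<lambda>x. delta x (F x)) \<in> ?S \<rightarrow> carrier \<FF>"
    using families_in[OF reg_familiesD(1)[OF F]] by (auto intro: delta_closed)
  show ?thesis
  proof (rule families_eqI[OF reg_familiesD(1)[OF F] fam.finsum_closed[OF d]])
    fix x assume x: "x \<in> carrier V"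
    interpret R: cring "mer_stalk V x"
      by (rule mer_stalk_cring[OF x])
    have Fx: "F x \<in> carrier (mer_stalk V x)"
      using families_in[OF reg_familiesD(1)[OF F] x] .
    have "(\<Oplus>\<^bsub>\<FF>\<^esub>y\<in>?S. delta y (F y)) x = (\<Oplus>\<^bsub>mer_stalk V x\<^esub>y\<in>?S. if x = y then F x else \<zero>\<^bsub>mer_stalk V x\<^esub>)"
      unfolding finsum_families_at[OF x d]
    proof (rule R.finsum_cong'[OF refl])
      show "(\<lambda>y. if x = y then F x else \<zero>\<^bsub>mer_stalk V x\<^esub>) \<in> ?S \<rightarrow> carrier (mer_stalk V x)"
        by (rule funcsetI) (use Fx in auto)
    qed (simp add: delta_def x)
    also have "\<dots> = F x"
    proof (cases "x \<in> ?S")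
      case True
      then show ?thesis
        using R.add.finprod_singleton[of x ?S "\<lambda>_. F x"] reg_familiesD(2)[OF F] Fx by simp
    next
      case False
      then have "(\<Oplus>\<^bsub>mer_stalk V x\<^esub>y\<in>?S. if x = y then F x else \<zero>\<^bsub>mer_stalk V x\<^esub>)
          = (\<Oplus>\<^bsub>mer_stalk V x\<^esub>y\<in>?S. \<zero>\<^bsub>mer_stalk V x\<^esub>)"
        using Fx by (intro R.finsum_cong') auto
      then show ?thesis
        using False x by simp
    qed
    finally show "F x = (\<Oplus>\<^bsub>\<FF>\<^esub>y\<in>?S. delta y (F y)) x" by simp
  qed
qed

lemma inv_families_at:
  "F \<in> inv_families \<Longrightarrow> g \<in> carrier G \<Longrightarrow> x \<in> carrier V \<Longrightarrow> F (act g x) = germ_act V G act g x (F x)"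
  using family_act_fixed_iff[of F g] by (auto simp: inv_families_def reg_families_def)

lemma inv_families_stab: "F \<in> inv_families \<Longrightarrow> x \<in> carrier V \<Longrightarrow> F x \<in> carrier (stab_inv x)"
  unfolding stab_inv_carrier using reg_familiesD(4)[OF inv_familiesD(1)] by (metis inv_families_at)

lemma inv_families_zero: "\<zero>\<^bsub>\<FF>\<^esub> \<in> inv_families"
  using family_act_const[of _ 0] by (simp add: inv_families_def reg_families_zero const_family_ops)

lemma inv_families_add: "F \<in> inv_families \<Longrightarrow> H \<in> inv_families \<Longrightarrow> F \<oplus>\<^bsub>\<FF>\<^esub> H \<in> inv_families"
  by (simp add: inv_families_def reg_families_add ring_hom_add[OF family_act_hom] reg_familiesD(1))

lemma inv_families_smult: "F \<in> inv_families \<Longrightarrow> const_family V c \<otimes>\<^bsub>\<FF>\<^esub> F \<in> inv_families"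
  by (simp add: inv_families_def reg_families_smult ring_hom_mult[OF family_act_hom] reg_familiesD(1)
      const_family_closed family_act_const)

lemma kernel_iff: "F \<in> kernel \<longleftrightarrow> F \<in> inv_families \<and> (\<forall>x\<in>carrier V. to_unit x (F x) \<in> \<J>)"
  using inv_families_stab by (auto simp: kernel_def trans_ideal_iff)

lemma kernel_zero: "\<zero>\<^bsub>\<FF>\<^esub> \<in> kernel"
  by (simp add: kernel_iff inv_families_zero families_at germ_hom_zero[OF to_unit_hom] inv_ideal_zero)

lemma kernel_add:
  assumes "F \<in> kernel" "H \<in> kernel"
  shows "F \<oplus>\<^bsub>\<FF>\<^esub> H \<in> kernel"
  using assms families_in[OF inv_familiesD(2)]
  by (simp add: kernel_iff inv_families_add families_at ring_hom_add[OF to_unit_hom] inv_ideal_add)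

text \<open>
  At \<open>x\<close> the product is \<open>\<phi>\<^sub>x\<close> of \<open>L\<close> times a regular germ at \<open>e\<close>, and \<open>L\<close> generates.
\<close>

lemma spread_mult_kernel:
  assumes L: "L \<in> invariant_generators" and H: "H \<in> inv_families"
  shows "spread_germ L \<otimes>\<^bsub>\<FF>\<^esub> H \<in> kernel"
proof -
  note Lr = invariant_generatorsD(1)[OF L]
  have Lm: "L \<in> carrier (mer_stalk V \<one>)"
    using Lr by (simp add: reg_stalk_mer)
  have "spread_germ L \<otimes>\<^bsub>\<FF>\<^esub> H \<in> inv_families"
    using H Lm spread_germ_reg[OF Lr] invariant_generatorsD(2)[OF L]
    by (simp add: inv_families_def reg_families_mult spread_germ_closed ring_hom_mult[OF family_act_hom]
        reg_familiesD(1) family_act_spread)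
  moreover have "to_unit x ((spread_germ L \<otimes>\<^bsub>\<FF>\<^esub> H) x) \<in> \<J>" if x: "x \<in> carrier V" for x
  proof -
    have Hx: "H x \<in> carrier (reg_stalk V x)"
      using H x by (simp add: reg_familiesD inv_familiesD)
    have tr: "germ_trans V x \<one> L \<in> carrier (mer_stalk V x)"
      using ring_hom_closed[OF germ_trans_hom[OF x one_closed] Lm] x by simp
    have "to_unit x ((spread_germ L \<otimes>\<^bsub>\<FF>\<^esub> H) x) = L \<otimes>\<^bsub>mer_stalk V \<one>\<^esub> to_unit x (H x)"
      using x tr Hx by (simp add: families_at spread_germ_def ring_hom_mult[OF to_unit_hom] reg_stalk_mer to_unit_trans Lm)
    also have "\<dots> \<in> \<J>"
      by (rule inv_ideal_mult(2)[OF inv_ideal_gen[OF L] to_unit_reg[OF x Hx]])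
    finally show ?thesis .
  qed
  ultimately show ?thesis
    by (simp add: kernel_iff)
qed

text \<open>
  Let \<open>N\<close> be the set of invariant families that \<open>D\<close> maps into the kernel. The germs \<open>p\<close> at \<open>e\<close> such that
  for all \<open>x\<close> and all regular \<open>a\<close> the average of \<open>\<phi>\<^sub>x(a p)\<close>, placed at \<open>x\<close>, lies in \<open>N\<close> form an ideal.
  It contains every generator \<open>L\<close>, because this average is the spread of \<open>L\<close> times an invariant family
  and \<open>D\<close> commutes with the spread. So it contains the ideal that is divided out, and an invariant
  family in the kernel is the sum of the averages of its germs.
\<close>

theorem kernel_stable:
  assumes D_inv: "\<And>F. F \<in> inv_families \<Longrightarrow> D F \<in> inv_families"
    and D_add: "\<And>F H. F \<in> inv_families \<Longrightarrow> H \<in> inv_families \<Longrightarrow> D (F \<oplus>\<^bsub>\<FF>\<^esub> H) = D F \<oplus>\<^bsub>\<FF>\<^esub> D H"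
    and D_spread: "\<And>L F. L \<in> invariant_generators \<Longrightarrow> F \<in> inv_families \<Longrightarrow>
      D (spread_germ L \<otimes>\<^bsub>\<FF>\<^esub> F) = spread_germ L \<otimes>\<^bsub>\<FF>\<^esub> D F"
    and F: "F \<in> kernel"
  shows "D F \<in> kernel"
proof -
  define N where "N = {F \<in> inv_families. D F \<in> kernel}"
  have "D \<zero>\<^bsub>\<FF>\<^esub> \<oplus>\<^bsub>\<FF>\<^esub> D \<zero>\<^bsub>\<FF>\<^esub> = D \<zero>\<^bsub>\<FF>\<^esub>"
    using D_add[OF inv_families_zero inv_families_zero] by simp
  then have D0: "D \<zero>\<^bsub>\<FF>\<^esub> = \<zero>\<^bsub>\<FF>\<^esub>"
    using inv_familiesD(2)[OF D_inv[OF inv_families_zero]] by (metis fam.add.l_cancel_one)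
  then have N_zero: "\<zero>\<^bsub>\<FF>\<^esub> \<in> N"
    by (simp add: N_def inv_families_zero kernel_zero)
  have N_add: "F \<oplus>\<^bsub>\<FF>\<^esub> H \<in> N" if "F \<in> N" "H \<in> N" for F H
    using that by (simp add: N_def inv_families_add D_add kernel_add)
  have N_sum: "(\<Oplus>\<^bsub>\<FF>\<^esub>i\<in>S. f i) \<in> N" if "finite S" "\<And>i. i \<in> S \<Longrightarrow> f i \<in> N" for f :: "'v \<Rightarrow> 'v \<Rightarrow> 'v mgerm" and S
    using that
  proof (induction S)
    case (insert i S)
    then have "f \<in> S \<rightarrow> carrier \<FF>" "f i \<in> carrier \<FF>"
      by (auto simp: N_def inv_familiesD)
    then show ?case
      using insert by (simp add: fam.finsum_insert N_add)
  qed (simp add: N_zero)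
  interpret O_e: cring "reg_stalk V \<one>"
    by (rule reg_stalk_cring[OF one_closed])
  note reg = reg_stalk_mer[OF one_closed]
  define bump where "bump x p = delta x (germ_trans V x \<one> p)" for x p
  have bump_reg: "bump x p \<in> reg_families" if "x \<in> W" "p \<in> carrier (reg_stalk V \<one>)" for x p
    using that germ_trans_reg[of x \<one> p] W_carrier unfolding bump_def by (intro delta_reg_families) auto
  note bump_fam = reg_familiesD(1)[OF bump_reg]
  have bump_add: "bump x (p \<oplus>\<^bsub>mer_stalk V \<one>\<^esub> q) = bump x p \<oplus>\<^bsub>\<FF>\<^esub> bump x q"
    if "x \<in> W" and p: "p \<in> carrier (reg_stalk V \<one>)" and q: "q \<in> carrier (reg_stalk V \<one>)" for x p q
  proof -
    have x: "x \<in> carrier V" using that W_carrier by blast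
    note hom = germ_trans_hom[OF x one_closed, unfolded r_one[OF x]]
    show ?thesis
      unfolding bump_def ring_hom_add[OF hom reg[OF p] reg[OF q]]
      by (rule delta_add[OF x]) (simp_all add: ring_hom_closed[OF hom] reg p q)
  qed
  define T where "T = {p \<in> carrier (reg_stalk V \<one>).
      \<forall>x\<in>W. \<forall>a\<in>carrier (reg_stalk V \<one>). average (bump x (a \<otimes>\<^bsub>mer_stalk V \<one>\<^esub> p)) \<in> N}"
  have "ideal T (reg_stalk V \<one>)"
  proof (rule O_e.ideal_of_closed)
    show "\<zero>\<^bsub>reg_stalk V \<one>\<^esub> \<in> T"
    proof -
      have "bump x \<zero>\<^bsub>mer_stalk V \<one>\<^esub> = \<zero>\<^bsub>\<FF>\<^esub>" if "x \<in> W" for x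
        using that W_carrier germ_hom_zero[OF germ_trans_hom[OF _ one_closed]]
        by (auto simp: bump_def delta_zero)
      then show ?thesis
        using N_zero average_inv[OF inv_families_zero]
        by (simp add: T_def zero_reg mer_stalk_zero_simps reg)
    qed
    fix p q assume p: "p \<in> T"
    then have p': "p \<in> carrier (reg_stalk V \<one>)" by (simp add: T_def)
    {
      assume q: "q \<in> T"
      then have q': "q \<in> carrier (reg_stalk V \<one>)" by (simp add: T_def)
      have "average (bump x (a \<otimes>\<^bsub>mer_stalk V \<one>\<^esub> (p \<oplus>\<^bsub>mer_stalk V \<one>\<^esub> q))) \<in> N"
        if x: "x \<in> W" and a: "a \<in> carrier (reg_stalk V \<one>)" for x a
      proof -
        have ap: "a \<otimes>\<^bsub>mer_stalk V \<one>\<^esub> p \<in> carrier (reg_stalk V \<one>)" "a \<otimes>\<^bsub>mer_stalk V \<one>\<^esub> q \<in> carrier (reg_stalk V \<one>)"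
          using a p' q' by (simp_all add: reg_stalk_closed)
        have "a \<otimes>\<^bsub>mer_stalk V \<one>\<^esub> (p \<oplus>\<^bsub>mer_stalk V \<one>\<^esub> q) = a \<otimes>\<^bsub>mer_stalk V \<one>\<^esub> p \<oplus>\<^bsub>mer_stalk V \<one>\<^esub> a \<otimes>\<^bsub>mer_stalk V \<one>\<^esub> q"
          using O_e.r_distr[OF p' q' a] by simp
        then show ?thesis
          using p q x a by (simp add: bump_add[OF x ap] average_add[OF bump_fam[OF x ap(1)] bump_fam[OF x ap(2)]] N_add T_def)
      qed
      then show "p \<oplus>\<^bsub>reg_stalk V \<one>\<^esub> q \<in> T"
        using p' q' by (simp add: T_def reg_stalk_closed)
    next
      assume q: "q \<in> carrier (reg_stalk V \<one>)"
      have "a \<otimes>\<^bsub>mer_stalk V \<one>\<^esub> (q \<otimes>\<^bsub>mer_stalk V \<one>\<^esub> p) = (a \<otimes>\<^bsub>mer_stalk V \<one>\<^esub> q) \<otimes>\<^bsub>mer_stalk V \<one>\<^esub> p"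
        if "a \<in> carrier (reg_stalk V \<one>)" for a
        using O_e.m_assoc[OF that q p'] by simp
      then show "q \<otimes>\<^bsub>reg_stalk V \<one>\<^esub> p \<in> T"
        using p q by (simp add: T_def reg_stalk_closed)
    }
  qed (auto simp: T_def)
  moreover have "invariant_generators \<subseteq> T"
  proof
    fix L assume L: "L \<in> invariant_generators"
    note Lr = invariant_generatorsD(1)[OF L]
    have "average (bump x (a \<otimes>\<^bsub>mer_stalk V \<one>\<^esub> L)) \<in> N"
      if x: "x \<in> W" and a: "a \<in> carrier (reg_stalk V \<one>)" for x a
    proof -
      have "x \<in> carrier V" using x W_carrier by blast
      then have "bump x (a \<otimes>\<^bsub>mer_stalk V \<one>\<^esub> L) = spread_germ L \<otimes>\<^bsub>\<FF>\<^esub> bump x a"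
        unfolding bump_def by (rule spread_germ_delta[OF _ reg[OF a] reg[OF Lr]])
      then have eq: "average (bump x (a \<otimes>\<^bsub>mer_stalk V \<one>\<^esub> L)) = spread_germ L \<otimes>\<^bsub>\<FF>\<^esub> average (bump x a)"
        using average_invariant_mult[OF spread_germ_closed[OF reg[OF Lr]] bump_fam[OF x a]]
          family_act_spread[OF reg[OF Lr]] invariant_generatorsD(2)[OF L] by simp
      note H = average_inv_families[OF bump_reg[OF x a]]
      show ?thesis
        unfolding eq N_def using spread_mult_kernel[OF L H] spread_mult_kernel[OF L D_inv[OF H]] D_spread[OF L H]
        by (simp add: kernel_iff)
    qed
    then show "L \<in> T"
      using Lr by (simp add: T_def)
  qed
  ultimately have JT: "\<J> \<subseteq> T"
    by (rule inv_ideal_least)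
  \<comment> \<open>By invariance, \<open>F\<close> equals its average, which is the sum of the averages of its germs.\<close>
  let ?S = "{x \<in> carrier V. F x \<noteq> \<zero>\<^bsub>mer_stalk V x\<^esub>}"
  have F': "F \<in> inv_families" "F \<in> reg_families"
    using F by (simp_all add: kernel_iff inv_familiesD)
  have term_in_N: "average (delta x (F x)) \<in> N" if x: "x \<in> ?S" for x
  proof -
    have xV: "x \<in> carrier V" and xW: "x \<in> W"
      using x reg_familiesD(3)[OF F'(2)] by auto
    have p: "to_unit x (F x) \<in> T"
      using F JT xV by (auto simp: kernel_iff)
    then have pr: "to_unit x (F x) \<in> carrier (reg_stalk V \<one>)"
      by (simp add: T_def)
    have "average (bump x (\<one>\<^bsub>mer_stalk V \<one>\<^esub> \<otimes>\<^bsub>mer_stalk V \<one>\<^esub> to_unit x (F x))) \<in> N"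
      using p xW O_e.one_closed by (simp add: T_def)
    moreover have "\<one>\<^bsub>mer_stalk V \<one>\<^esub> \<otimes>\<^bsub>mer_stalk V \<one>\<^esub> to_unit x (F x) = to_unit x (F x)"
      using O_e.l_one[OF pr] by simp
    moreover have "bump x (to_unit x (F x)) = delta x (F x)"
      unfolding bump_def using trans_to_unit[OF xV families_in[OF inv_familiesD(2)[OF F'(1)] xV]] by simp
    ultimately show ?thesis by simp
  qed
  have d: "delta x (F x) \<in> carrier \<FF>" if "x \<in> ?S" for x
    using that families_in[OF inv_familiesD(2)[OF F'(1)]] by (auto intro: delta_closed)
  have "average (\<Oplus>\<^bsub>\<FF>\<^esub>x\<in>S. delta x (F x)) = (\<Oplus>\<^bsub>\<FF>\<^esub>x\<in>S. average (delta x (F x)))"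
    if "finite S" "S \<subseteq> ?S" for S
    using that
  proof (induction S)
    case empty
    then show ?case using average_inv[OF inv_families_zero] by simp
  next
    case (insert x S)
    then have "(\<lambda>x. delta x (F x)) \<in> S \<rightarrow> carrier \<FF>" "(\<lambda>x. average (delta x (F x))) \<in> S \<rightarrow> carrier \<FF>"
      "delta x (F x) \<in> carrier \<FF>"
      using d by (auto intro!: average_closed)
    then show ?case
      using insert by (simp add: fam.finsum_insert average_add average_closed fam.finsum_closed)
  qed
  from this[OF reg_familiesD(2)[OF F'(2)] subset_refl]
  have "F = (\<Oplus>\<^bsub>\<FF>\<^esub>x\<in>?S. average (delta x (F x)))"
    using delta_decomposition[OF F'(2)] average_inv[OF F'(1)] by simp
  also have "\<dots> \<in> N"
    using reg_familiesD(2)[OF F'(2)] term_in_N by (intro N_sum)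
  finally show ?thesis
    by (simp add: N_def)
qed

end

section \<open>Complex vector spaces and modules\<close>

lemma complex_ring_cring: "cring complex_ring"
proof (rule cringI)
  show "abelian_group complex_ring"
    by (rule abelian_groupI) (auto simp: complex_ring_def intro: exI[of _ "- _"])
  show "comm_monoid complex_ring"
    by (rule comm_monoidI) (auto simp: complex_ring_def)
qed (auto simp: complex_ring_def distrib_right)

lemma complex_moduleI:
  assumes "\<zero>\<^bsub>M\<^esub> \<in> carrier M"
    and add: "\<And>x y. x \<in> carrier M \<Longrightarrow> y \<in> carrier M \<Longrightarrow> x \<oplus>\<^bsub>M\<^esub> y \<in> carrier M"
    and "\<And>x y. x \<in> carrier M \<Longrightarrow> y \<in> carrier M \<Longrightarrow> x \<oplus>\<^bsub>M\<^esub> y = y \<oplus>\<^bsub>M\<^esub> x"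
    and "\<And>x y z. x \<in> carrier M \<Longrightarrow> y \<in> carrier M \<Longrightarrow> z \<in> carrier M \<Longrightarrow> x \<oplus>\<^bsub>M\<^esub> y \<oplus>\<^bsub>M\<^esub> z = x \<oplus>\<^bsub>M\<^esub> (y \<oplus>\<^bsub>M\<^esub> z)"
    and "\<And>x. x \<in> carrier M \<Longrightarrow> \<zero>\<^bsub>M\<^esub> \<oplus>\<^bsub>M\<^esub> x = x"
    and smult: "\<And>c x. x \<in> carrier M \<Longrightarrow> c \<odot>\<^bsub>M\<^esub> x \<in> carrier M"
    and neg: "\<And>x. x \<in> carrier M \<Longrightarrow> (-1) \<odot>\<^bsub>M\<^esub> x \<oplus>\<^bsub>M\<^esub> x = \<zero>\<^bsub>M\<^esub>"
    and "\<And>c d x. x \<in> carrier M \<Longrightarrow> (c + d) \<odot>\<^bsub>M\<^esub> x = c \<odot>\<^bsub>M\<^esub> x \<oplus>\<^bsub>M\<^esub> d \<odot>\<^bsub>M\<^esub> x"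
    and "\<And>c x y. x \<in> carrier M \<Longrightarrow> y \<in> carrier M \<Longrightarrow> c \<odot>\<^bsub>M\<^esub> (x \<oplus>\<^bsub>M\<^esub> y) = c \<odot>\<^bsub>M\<^esub> x \<oplus>\<^bsub>M\<^esub> c \<odot>\<^bsub>M\<^esub> y"
    and "\<And>c d x. x \<in> carrier M \<Longrightarrow> (c * d) \<odot>\<^bsub>M\<^esub> x = c \<odot>\<^bsub>M\<^esub> (d \<odot>\<^bsub>M\<^esub> x)"
    and "\<And>x. x \<in> carrier M \<Longrightarrow> 1 \<odot>\<^bsub>M\<^esub> x = x"
  shows "module complex_ring M"
proof (rule moduleI)
  show "cring complex_ring"
    by (rule complex_ring_cring)
  show "abelian_group M"
  proof (rule abelian_groupI)
    fix x assume "x \<in> carrier M"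
    with smult neg show "\<exists>y\<in>carrier M. y \<oplus>\<^bsub>M\<^esub> x = \<zero>\<^bsub>M\<^esub>"
      by blast
  qed (use assms in auto)
qed (use assms in \<open>auto simp: complex_ring_def\<close>)

lemma complex_moduleD:
  assumes "module complex_ring M"
  shows "abelian_group M"
    and "\<And>c x. x \<in> carrier M \<Longrightarrow> c \<odot>\<^bsub>M\<^esub> x \<in> carrier M"
    and "\<And>c d x. x \<in> carrier M \<Longrightarrow> (c + d) \<odot>\<^bsub>M\<^esub> x = c \<odot>\<^bsub>M\<^esub> x \<oplus>\<^bsub>M\<^esub> d \<odot>\<^bsub>M\<^esub> x"
    and "\<And>c x y. x \<in> carrier M \<Longrightarrow> y \<in> carrier M \<Longrightarrow> c \<odot>\<^bsub>M\<^esub> (x \<oplus>\<^bsub>M\<^esub> y) = c \<odot>\<^bsub>M\<^esub> x \<oplus>\<^bsub>M\<^esub> c \<odot>\<^bsub>M\<^esub> y"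
    and "\<And>c d x. x \<in> carrier M \<Longrightarrow> (c * d) \<odot>\<^bsub>M\<^esub> x = c \<odot>\<^bsub>M\<^esub> (d \<odot>\<^bsub>M\<^esub> x)"
    and "\<And>x. x \<in> carrier M \<Longrightarrow> 1 \<odot>\<^bsub>M\<^esub> x = x"
    and "\<And>x. x \<in> carrier M \<Longrightarrow> (-1) \<odot>\<^bsub>M\<^esub> x \<oplus>\<^bsub>M\<^esub> x = \<zero>\<^bsub>M\<^esub>"
proof -
  interpret module complex_ring M by fact
  show "abelian_group M" ..
  show "c \<odot>\<^bsub>M\<^esub> x \<in> carrier M" if "x \<in> carrier M" for c x
    using smult_closed[of c x] that by (simp add: complex_ring_def)
  show "(c + d) \<odot>\<^bsub>M\<^esub> x = c \<odot>\<^bsub>M\<^esub> x \<oplus>\<^bsub>M\<^esub> d \<odot>\<^bsub>M\<^esub> x" if "x \<in> carrier M" for c d x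
    using smult_l_distr[of c d x] that by (simp add: complex_ring_def)
  show "c \<odot>\<^bsub>M\<^esub> (x \<oplus>\<^bsub>M\<^esub> y) = c \<odot>\<^bsub>M\<^esub> x \<oplus>\<^bsub>M\<^esub> c \<odot>\<^bsub>M\<^esub> y" if "x \<in> carrier M" "y \<in> carrier M" for c x y
    using smult_r_distr[of c x y] that by (simp add: complex_ring_def)
  show "(c * d) \<odot>\<^bsub>M\<^esub> x = c \<odot>\<^bsub>M\<^esub> (d \<odot>\<^bsub>M\<^esub> x)" if "x \<in> carrier M" for c d x
    using smult_assoc1[of c d x] that by (simp add: complex_ring_def)
  show one: "1 \<odot>\<^bsub>M\<^esub> x = x" if "x \<in> carrier M" for x
    using smult_one[of x] that by (simp add: complex_ring_def)
  show "(-1) \<odot>\<^bsub>M\<^esub> x \<oplus>\<^bsub>M\<^esub> x = \<zero>\<^bsub>M\<^esub>" if x: "x \<in> carrier M" for x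
  proof -
    have "(-1) \<odot>\<^bsub>M\<^esub> x \<oplus>\<^bsub>M\<^esub> x = (-1 + 1) \<odot>\<^bsub>M\<^esub> x"
      using smult_l_distr[of "-1" 1 x] one[OF x] x by (simp add: complex_ring_def)
    also have "\<dots> = \<zero>\<^bsub>M\<^esub>"
      using smult_l_null[OF x] by (simp add: complex_ring_def)
    finally show ?thesis .
  qed
qed

text \<open>A linear image of a vector space is a vector space.\<close>

lemma module_image:
  assumes modL: "module complex_ring L"
    and img: "f ` carrier L = carrier M" and zero: "f \<zero>\<^bsub>L\<^esub> = \<zero>\<^bsub>M\<^esub>"
    and add: "\<And>x y. x \<in> carrier L \<Longrightarrow> y \<in> carrier L \<Longrightarrow> f (x \<oplus>\<^bsub>L\<^esub> y) = f x \<oplus>\<^bsub>M\<^esub> f y"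
    and smult: "\<And>c x. x \<in> carrier L \<Longrightarrow> f (c \<odot>\<^bsub>L\<^esub> x) = c \<odot>\<^bsub>M\<^esub> f x"
  shows "module complex_ring M"
proof -
  note D = complex_moduleD[OF modL]
  interpret L: abelian_group L by (rule D(1))
  have el: "\<exists>x\<in>carrier L. m = f x" if "m \<in> carrier M" for m
    using that img by blast
  have in_M: "f x \<in> carrier M" if "x \<in> carrier L" for x
    using that img by blast
  note simps = add[symmetric] smult[symmetric] zero[symmetric] in_M D(2)
  show ?thesis
  proof (rule complex_moduleI)
    fix m assume "m \<in> carrier M"
    then obtain x where x: "x \<in> carrier L" "m = f x" using el by blast
    show "\<zero>\<^bsub>M\<^esub> \<oplus>\<^bsub>M\<^esub> m = m" "1 \<odot>\<^bsub>M\<^esub> m = m"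
      "(- 1) \<odot>\<^bsub>M\<^esub> m \<oplus>\<^bsub>M\<^esub> m = \<zero>\<^bsub>M\<^esub>"
      using x by (simp_all add: simps D(6,7))
    fix c show "c \<odot>\<^bsub>M\<^esub> m \<in> carrier M"
      using x by (simp add: simps)
    fix d show "(c + d) \<odot>\<^bsub>M\<^esub> m = c \<odot>\<^bsub>M\<^esub> m \<oplus>\<^bsub>M\<^esub> d \<odot>\<^bsub>M\<^esub> m" "(c * d) \<odot>\<^bsub>M\<^esub> m = c \<odot>\<^bsub>M\<^esub> (d \<odot>\<^bsub>M\<^esub> m)"
      using x by (simp_all add: simps D(3,5))
    fix n assume "n \<in> carrier M"
    then obtain y where y: "y \<in> carrier L" "n = f y" using el by blast
    show "m \<oplus>\<^bsub>M\<^esub> n \<in> carrier M" "m \<oplus>\<^bsub>M\<^esub> n = n \<oplus>\<^bsub>M\<^esub> m"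
      "c \<odot>\<^bsub>M\<^esub> (m \<oplus>\<^bsub>M\<^esub> n) = c \<odot>\<^bsub>M\<^esub> m \<oplus>\<^bsub>M\<^esub> c \<odot>\<^bsub>M\<^esub> n"
      using x y by (simp_all add: simps D(4) L.a_comm)
    fix k assume "k \<in> carrier M"
    then obtain z where z: "z \<in> carrier L" "k = f z" using el by blast
    show "m \<oplus>\<^bsub>M\<^esub> n \<oplus>\<^bsub>M\<^esub> k = m \<oplus>\<^bsub>M\<^esub> (n \<oplus>\<^bsub>M\<^esub> k)"
      using x y z by (simp add: simps L.a_assoc)
  qed (simp add: simps)
qed

text \<open>A linear image of a left module, with the transported action, is a left module.\<close>

lemma left_module_image:
  assumes L: "left_module S \<A> L \<mu>"
    and img: "f ` carrier L = carrier M" and zero: "f \<zero>\<^bsub>L\<^esub> = \<zero>\<^bsub>M\<^esub>"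
    and add: "\<And>x y. x \<in> carrier L \<Longrightarrow> y \<in> carrier L \<Longrightarrow> f (x \<oplus>\<^bsub>L\<^esub> y) = f x \<oplus>\<^bsub>M\<^esub> f y"
    and smult: "\<And>c x. x \<in> carrier L \<Longrightarrow> f (c \<odot>\<^bsub>L\<^esub> x) = c \<odot>\<^bsub>M\<^esub> f x"
    and act: "\<And>A x. A \<in> \<A> \<Longrightarrow> x \<in> carrier L \<Longrightarrow> \<nu> A (f x) = f (\<mu> A x)"
    and \<A>: "is_subalgebra S \<A>"
  shows "left_module S \<A> M \<nu>"
proof -
  have modL: "module complex_ring L" and bil: "bilinear_action S \<A> L \<mu>"
    and comp: "\<And>A B x. A \<in> \<A> \<Longrightarrow> B \<in> \<A> \<Longrightarrow> x \<in> carrier L \<Longrightarrow> \<mu> (A \<otimes>\<^bsub>S\<^esub> B) x = \<mu> A (\<mu> B x)"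
    using L by (auto simp: left_module_def)
  note D = complex_moduleD[OF modL]
  interpret L: abelian_group L by (rule D(1))
  have el: "\<exists>x\<in>carrier L. m = f x" if "m \<in> carrier M" for m
    using that img by blast
  have in_M: "f x \<in> carrier M" if "x \<in> carrier L" for x
    using that img by blast
  note simps = add[symmetric] smult[symmetric] zero[symmetric] in_M D(2)
  have "module complex_ring M"
    by (rule module_image[OF modL img zero add smult])
  moreover have "bilinear_action S \<A> M \<nu>"
    unfolding bilinear_action_def
  proof (intro conjI ballI allI impI)
    fix m assume "m \<in> carrier M"
    then obtain x where x: "x \<in> carrier L" "m = f x" using el by blast
    show "\<nu> \<one>\<^bsub>S\<^esub> m = m" if "\<one>\<^bsub>S\<^esub> \<in> \<A>"
      using bil x that act[OF that] by (simp add: bilinear_action_def)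
    fix A assume A: "A \<in> \<A>"
    have Ax: "\<mu> A x \<in> carrier L"
      using bil A x by (simp add: bilinear_action_def)
    show "\<nu> A m \<in> carrier M"
      using Ax x by (simp add: act[OF A] in_M)
    fix c
    have cA: "c \<odot>\<^bsub>S\<^esub> A \<in> \<A>"
      using A \<A> by (simp add: is_subalgebra_def)
    show "\<nu> A (c \<odot>\<^bsub>M\<^esub> m) = c \<odot>\<^bsub>M\<^esub> \<nu> A m"
      using bil A Ax x by (simp add: simps act[OF A] bilinear_action_def)
    show "\<nu> (c \<odot>\<^bsub>S\<^esub> A) m = c \<odot>\<^bsub>M\<^esub> \<nu> A m"
      using bil A Ax x by (simp add: simps act[OF A] act[OF cA] bilinear_action_def)
    fix B assume B: "B \<in> \<A>"
    have Bx: "\<mu> B x \<in> carrier L" and AB: "A \<oplus>\<^bsub>S\<^esub> B \<in> \<A>"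
      using bil B x A \<A> by (simp_all add: bilinear_action_def is_subalgebra_def)
    show "\<nu> (A \<oplus>\<^bsub>S\<^esub> B) m = \<nu> A m \<oplus>\<^bsub>M\<^esub> \<nu> B m"
      using bil A B Ax Bx x by (simp add: simps act[OF A] act[OF B] act[OF AB] bilinear_action_def)
  next
    fix A m n assume A: "A \<in> \<A>" and "m \<in> carrier M" "n \<in> carrier M"
    then obtain x y where x: "x \<in> carrier L" "m = f x" and y: "y \<in> carrier L" "n = f y" using el by blast
    have "\<mu> A x \<in> carrier L" "\<mu> A y \<in> carrier L"
      using bil A x y by (simp_all add: bilinear_action_def)
    then show "\<nu> A (m \<oplus>\<^bsub>M\<^esub> n) = \<nu> A m \<oplus>\<^bsub>M\<^esub> \<nu> A n"
      using bil A x y by (simp add: simps act[OF A] bilinear_action_def)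
  qed
  moreover have "\<nu> (A \<otimes>\<^bsub>S\<^esub> B) m = \<nu> A (\<nu> B m)" if A: "A \<in> \<A>" and B: "B \<in> \<A>" and m: "m \<in> carrier M" for A B m
  proof -
    obtain x where x: "x \<in> carrier L" "m = f x" using el[OF m] by blast
    have Bx: "\<mu> B x \<in> carrier L" and AB: "A \<otimes>\<^bsub>S\<^esub> B \<in> \<A>"
      using bil B x A \<A> by (simp_all add: bilinear_action_def is_subalgebra_def)
    then show ?thesis
      using x A B by (simp add: act comp)
  qed
  ultimately show ?thesis
    by (simp add: left_module_def)
qed


section \<open>Internal sums over the orbits of an invariant set\<close>

context sheaf_group_action
begin

lemma orbit_self: "x \<in> carrier V \<Longrightarrow> x \<in> orbit G act x"
  unfolding orbit_def using G.one_closed act_one by force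

lemma orbit_finite: "finite (orbit G act x)"
proof -
  have "orbit G act x = (\<lambda>g. act g x) ` carrier G"
    by (auto simp: orbit_def)
  then show ?thesis
    using finite_G by simp
qed

lemma orbit_eq:
  assumes x: "x \<in> carrier V" and y: "y \<in> orbit G act x"
  shows "orbit G act y = orbit G act x"
proof -
  have sub: "orbit G act (act g x) \<subseteq> orbit G act x" if "g \<in> carrier G" "x \<in> carrier V" for g x
    using that by (auto simp: orbit_def act_act)
  obtain g where g: "g \<in> carrier G" "y = act g x"
    using y by (auto simp: orbit_def)
  have "orbit G act (act (inv\<^bsub>G\<^esub> g) y) \<subseteq> orbit G act y"
    using g x by (intro sub) (auto simp: act_closed)
  then show ?thesis
    using sub[OF g(1) x] g x by (auto simp: act_cancel)
qed

end

context invariant_set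
begin

lemma Union_orbits: "\<Union>(orbits G W act) = W"
proof (intro equalityI subsetI)
  fix x assume "x \<in> \<Union>(orbits G W act)"
  then show "x \<in> W"
    using W_invariant by (auto simp: orbits_def orbit_def)
next
  fix x assume x: "x \<in> W"
  then have "x \<in> orbit G act x" "orbit G act x \<in> orbits G W act"
    using W_carrier orbit_self by (auto simp: orbits_def)
  then show "x \<in> \<Union>(orbits G W act)"
    by blast
qed

lemma orbitsD:
  assumes "X \<in> orbits G W act"
  shows "X \<subseteq> W" "finite X" "x \<in> X \<Longrightarrow> orbit G act x = X"
    "g \<in> carrier G \<Longrightarrow> x \<in> carrier V \<Longrightarrow> act g x \<in> X \<longleftrightarrow> x \<in> X"
proof -
  obtain w where w: "X = orbit G act w" "w \<in> W"
    using assms by (auto simp: orbits_def)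
  then have wV: "w \<in> carrier V"
    using W_carrier by blast
  show "X \<subseteq> W" "finite X"
    using w W_invariant orbit_finite by (auto simp: orbit_def)
  show eq: "x \<in> X \<Longrightarrow> orbit G act x = X" for x
    using orbit_eq[OF wV] w by simp
  show "act g x \<in> X \<longleftrightarrow> x \<in> X" if g: "g \<in> carrier G" and x: "x \<in> carrier V"
  proof
    assume "x \<in> X"
    from eq[OF this] show "act g x \<in> X"
      using g by (auto simp: orbit_def)
  next
    assume "act g x \<in> X"
    from eq[OF this] have "act (inv\<^bsub>G\<^esub> g) (act g x) \<in> X"
      using g by (auto simp: orbit_def)
    then show "x \<in> X"
      using g x by (simp add: act_cancel)
  qed
qed

lemma orbit_mem: "x \<in> W \<Longrightarrow> orbit G act x \<in> orbits G W act"
  by (auto simp: orbits_def)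

text \<open>
  Equivariance and the support condition are tested orbit by orbit, so the internal sum of the
  equivariant families on the orbits consists of all finitely supported equivariant families on \<open>W\<close>.
\<close>

lemma internal_sum_orbits:
  assumes \<tau>: "\<And>g x. g \<in> carrier G \<Longrightarrow> x \<in> carrier V \<Longrightarrow> \<tau> g x \<zero>\<^bsub>R x\<^esub> = \<zero>\<^bsub>R (act g x)\<^esub>"
    and ring: "\<And>x. x \<in> carrier V \<Longrightarrow> \<zero>\<^bsub>R x\<^esub> \<in> carrier (R x)"
  shows "internal_sum (carrier V) R (orbits G W act)
      (\<lambda>X. {F \<in> direct_sum (carrier V) R. supported_in (carrier V) R X F \<and> (\<forall>x\<in>X. F x \<in> S x) \<and>
         (\<forall>g\<in>carrier G. \<forall>x\<in>carrier V. F (act g x) = \<tau> g x (F x))})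
    = {F \<in> direct_sum (carrier V) R. supported_in (carrier V) R W F \<and> (\<forall>x\<in>W. F x \<in> S x) \<and>
         (\<forall>g\<in>carrier G. \<forall>x\<in>carrier V. F (act g x) = \<tau> g x (F x))}" (is "?L = ?R")
proof (intro equalityI subsetI)
  fix F assume F: "F \<in> ?L"
  have sum: "F \<in> direct_sum (carrier V) R" and supp: "supported_in (carrier V) R W F"
    and comp: "\<And>X. X \<in> orbits G W act \<Longrightarrow> (\<forall>x\<in>X. component (carrier V) R X F x \<in> S x) \<and>
       (\<forall>g\<in>carrier G. \<forall>x\<in>carrier V. component (carrier V) R X F (act g x) = \<tau> g x (component (carrier V) R X F x))"
    using F by (simp_all add: internal_sum_def Union_orbits)
  have "F x \<in> S x" if x: "x \<in> W" for x
  proof -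
    have xV: "x \<in> carrier V" using x W_carrier by blast
    then show ?thesis
      using comp[OF orbit_mem[OF x]] orbit_self[OF xV] by (auto simp: component_def)
  qed
  moreover have "F (act g x) = \<tau> g x (F x)" if g: "g \<in> carrier G" and x: "x \<in> carrier V" for g x
  proof (cases "x \<in> W")
    case True
    let ?X = "orbit G act x"
    have "component (carrier V) R ?X F (act g x) = \<tau> g x (component (carrier V) R ?X F x)"
      using comp[OF orbit_mem[OF True]] g x by blast
    moreover have "x \<in> ?X" "act g x \<in> ?X"
      using orbit_self[OF x] g by (auto simp: orbit_def)
    ultimately show ?thesis
      using g x by (simp add: component_def act_closed)
  next
    case False
    then have "F x = \<zero>\<^bsub>R x\<^esub>" "F (act g x) = \<zero>\<^bsub>R (act g x)\<^esub>"
      using supp g x by (simp_all add: supported_in_def act_closed act_W_iff)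
    then show ?thesis
      using \<tau>[OF g x] by simp
  qed
  ultimately show "F \<in> ?R"
    using sum supp by blast
next
  fix F assume F: "F \<in> ?R"
  have "component (carrier V) R X F \<in> {F \<in> direct_sum (carrier V) R. supported_in (carrier V) R X F \<and>
      (\<forall>x\<in>X. F x \<in> S x) \<and> (\<forall>g\<in>carrier G. \<forall>x\<in>carrier V. F (act g x) = \<tau> g x (F x))}"
    if X: "X \<in> orbits G W act" for X
  proof -
    have XV: "X \<subseteq> carrier V" "X \<subseteq> W"
      using orbitsD(1)[OF X] W_carrier by auto
    have "{x \<in> carrier V. component (carrier V) R X F x \<noteq> \<zero>\<^bsub>R x\<^esub>} \<subseteq> {x \<in> carrier V. F x \<noteq> \<zero>\<^bsub>R x\<^esub>}"
      by (auto simp: component_def)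
    then have "finite {x \<in> carrier V. component (carrier V) R X F x \<noteq> \<zero>\<^bsub>R x\<^esub>}"
      using F finite_subset by (auto simp: direct_sum_def)
    then have "component (carrier V) R X F \<in> direct_sum (carrier V) R"
      using F ring by (auto simp: direct_sum_def component_def)
    moreover have "supported_in (carrier V) R X (component (carrier V) R X F)"
      by (auto simp: supported_in_def component_def)
    moreover have "component (carrier V) R X F x \<in> S x" if "x \<in> X" for x
      using that F XV by (auto simp: component_def)
    moreover have "component (carrier V) R X F (act g x) = \<tau> g x (component (carrier V) R X F x)"
      if "g \<in> carrier G" "x \<in> carrier V" for g x
      using that F \<tau> by (simp add: component_def act_closed orbitsD(4)[OF X])
    ultimately show ?thesis by blast
  qed
  then show "F \<in> ?L"
    using F by (simp add: internal_sum_def Union_orbits)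
qed

lemma inv_germs_on_carrier: "carrier (inv_germs_on V G act W) = inv_families"
proof -
  have "carrier (inv_germs_on V G act W) =
     {F \<in> direct_sum (carrier V) (mer_stalk V). supported_in (carrier V) (mer_stalk V) W F \<and>
        (\<forall>x\<in>W. F x \<in> carrier (reg_stalk V x)) \<and>
        (\<forall>g\<in>carrier G. \<forall>x\<in>carrier V. F (act g x) = germ_act V G act g x (F x))}"
    unfolding inv_germs_on_def family_space_def inv_germs_def partial_object.select_convs
    by (rule internal_sum_orbits) (simp_all add: germ_hom_zero[OF germ_act_hom] act_closed mer_stalk_zero_closed)
  also have "\<dots> = inv_families"
  proof (intro equalityI subsetI)
    fix F assume F: "F \<in> {F \<in> direct_sum (carrier V) (mer_stalk V). supported_in (carrier V) (mer_stalk V) W F \<and>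
        (\<forall>x\<in>W. F x \<in> carrier (reg_stalk V x)) \<and>
        (\<forall>g\<in>carrier G. \<forall>x\<in>carrier V. F (act g x) = germ_act V G act g x (F x))}"
    then have Fc: "F \<in> carrier \<FF>"
      by (simp add: direct_sum_def germ_families_ops)
    have "F x \<in> carrier (reg_stalk V x)" if "x \<in> carrier V" for x
      using F that zero_reg[OF that] by (cases "x \<in> W") (auto simp: supported_in_def)
    then show "F \<in> inv_families"
      using F Fc family_act_fixed_iff[OF Fc]
      by (simp add: inv_families_def reg_families_def direct_sum_def supported_in_def)
  next
    fix F assume F: "F \<in> inv_families"
    then show "F \<in> {F \<in> direct_sum (carrier V) (mer_stalk V). supported_in (carrier V) (mer_stalk V) W F \<and>
        (\<forall>x\<in>W. F x \<in> carrier (reg_stalk V x)) \<and>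
        (\<forall>g\<in>carrier G. \<forall>x\<in>carrier V. F (act g x) = germ_act V G act g x (F x))}"
      using inv_families_at[OF F] W_carrier
      by (auto simp: inv_families_def reg_families_def direct_sum_def supported_in_def germ_families_ops)
  qed
  finally show ?thesis .
qed

lemma inv_germs_on_ops:
  "\<zero>\<^bsub>inv_germs_on V G act W\<^esub> = \<zero>\<^bsub>\<FF>\<^esub>"
  "F \<oplus>\<^bsub>inv_germs_on V G act W\<^esub> H = F \<oplus>\<^bsub>\<FF>\<^esub> H"
  "c \<odot>\<^bsub>inv_germs_on V G act W\<^esub> F = const_family V c \<otimes>\<^bsub>\<FF>\<^esub> F"
  by (simp_all add: inv_germs_on_def family_space_def germ_families_ops const_family_def cong: restrict_cong)

lemma inv_germs_on_module: "module complex_ring (inv_germs_on V G act W)"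
proof (rule complex_moduleI, unfold inv_germs_on_carrier inv_germs_on_ops)
  note fam' = inv_familiesD(2)
  fix F assume F: "F \<in> inv_families"
  show "const_family V (- 1) \<otimes>\<^bsub>\<FF>\<^esub> F \<oplus>\<^bsub>\<FF>\<^esub> F = \<zero>\<^bsub>\<FF>\<^esub>"
  proof -
    have "const_family V (- 1) \<otimes>\<^bsub>\<FF>\<^esub> F \<oplus>\<^bsub>\<FF>\<^esub> F = const_family V (- 1 + 1) \<otimes>\<^bsub>\<FF>\<^esub> F"
      unfolding const_family_ops(1) using fam'[OF F] by (simp add: fam.l_distr const_family_closed const_family_ops(3))
    also have "\<dots> = \<zero>\<^bsub>\<FF>\<^esub>"
      using fam'[OF F] by (simp add: const_family_ops(4))
    finally show ?thesis .
  qed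
  fix H assume H: "H \<in> inv_families"
  show "F \<oplus>\<^bsub>\<FF>\<^esub> H = H \<oplus>\<^bsub>\<FF>\<^esub> F"
    by (rule fam.a_comm[OF fam'[OF F] fam'[OF H]])
qed (simp_all add: inv_families_zero inv_families_add inv_families_smult inv_familiesD(2) fam.a_assoc
      const_family_ops fam.l_distr fam.r_distr fam.m_assoc const_family_closed)

end

section \<open>The quotient module\<close>

context invariant_set
begin

abbreviation "MM \<equiv> M_space V G act W"
abbreviation "proj \<equiv> M_proj V G act"
abbreviation "E_zero x \<equiv> \<zero>\<^bsub>E_rng x\<^esub>"

lemma E_zero_closed: "x \<in> carrier V \<Longrightarrow> E_zero x \<in> carrier (E_rng x)"
  using ring.ring_simprules(2)[OF E_ring_ring] .

lemma germ_act_E_zero: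
  "g \<in> carrier G \<Longrightarrow> x \<in> carrier V \<Longrightarrow> germ_act V G act g x ` E_zero x = E_zero (act g x)"
  by (simp add: E_ring_zero germ_act_trans_ideal)

text \<open>
  The elements of the internal sum of the orbit spaces, described without reference to single orbits.
\<close>

lemma M_space_carrier:
  "m \<in> carrier MM \<longleftrightarrow> m \<in> direct_sum (carrier V) E_rng \<and> supported_in (carrier V) E_rng W m \<and>
     (\<forall>g\<in>carrier G. \<forall>x\<in>carrier V. m (act g x) = germ_act V G act g x ` m x)"
proof -
  have E: "E_orbit V G act = (\<lambda>X. {m \<in> direct_sum (carrier V) E_rng. supported_in (carrier V) E_rng X m \<and>
      (\<forall>x\<in>X. m x \<in> UNIV) \<and> (\<forall>g\<in>carrier G. \<forall>x\<in>carrier V. m (act g x) = germ_act V G act g x ` m x)})"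
    by (rule ext) (simp add: E_orbit_def)
  have "carrier MM = {m \<in> direct_sum (carrier V) E_rng. supported_in (carrier V) E_rng W m \<and>
      (\<forall>x\<in>W. m x \<in> UNIV) \<and> (\<forall>g\<in>carrier G. \<forall>x\<in>carrier V. m (act g x) = germ_act V G act g x ` m x)}"
    unfolding M_space_def E_space_def family_space_def partial_object.select_convs E
    by (rule internal_sum_orbits) (simp_all add: germ_act_E_zero E_zero_closed)
  then show ?thesis by simp
qed

lemma E_orbit_carrier:
  assumes X: "X \<in> orbits G W act"
  shows "m \<in> E_orbit V G act X \<longleftrightarrow> m \<in> carrier MM \<and> supported_in (carrier V) E_rng X m"
  using orbitsD(1)[OF X] by (auto simp: M_space_carrier E_orbit_def supported_in_def)

lemma M_space_ops:
  "\<zero>\<^bsub>MM\<^esub> = (\<lambda>x\<in>carrier V. E_zero x)"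
  "m \<oplus>\<^bsub>MM\<^esub> n = (\<lambda>x\<in>carrier V. m x \<oplus>\<^bsub>E_rng x\<^esub> n x)"
  "c \<odot>\<^bsub>MM\<^esub> m = (\<lambda>x\<in>carrier V. E_cls x (mconst V x c) \<otimes>\<^bsub>E_rng x\<^esub> m x)"
  by (simp_all add: M_space_def E_space_def family_space_def)

lemma E_space_ops:
  "carrier (E_space V G act C) = C"
  "m \<oplus>\<^bsub>E_space V G act C\<^esub> n = m \<oplus>\<^bsub>MM\<^esub> n"
  "c \<odot>\<^bsub>E_space V G act C\<^esub> m = c \<odot>\<^bsub>MM\<^esub> m"
  by (simp_all add: M_space_def E_space_def family_space_def)

lemma M_space_at: "m \<in> carrier MM \<Longrightarrow> x \<in> carrier V \<Longrightarrow> m x \<in> carrier (E_rng x)"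
  by (auto simp: M_space_carrier direct_sum_def)

lemma M_space_ext: "m \<in> carrier MM \<Longrightarrow> m \<in> extensional (carrier V)"
  by (auto simp: M_space_carrier direct_sum_def PiE_iff)

lemma mconst_stab:
  assumes x: "x \<in> carrier V"
  shows "mconst V x c \<in> carrier (stab_inv x)"
  unfolding stab_inv_carrier
proof (intro conjI ballI impI)
  fix g assume g: "g \<in> carrier G" "act g x = x"
  show "germ_act V G act g x (mconst V x c) = mconst V x c"
    using mpull_mconst[OF act_auto[OF g(1)] x, of c] g x act_cancel[OF g(1) x] by (simp add: germ_act_def)
qed (rule mconst_reg[OF x])

lemma proj_at: "x \<in> carrier V \<Longrightarrow> proj F x = E_cls x (F x)"
  by (simp add: M_proj_def)

lemma E_class_add:
  "x \<in> carrier V \<Longrightarrow> P \<in> carrier (stab_inv x) \<Longrightarrow> Q \<in> carrier (stab_inv x) \<Longrightarrow>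
    E_cls x (P \<oplus>\<^bsub>mer_stalk V x\<^esub> Q) = E_cls x P \<oplus>\<^bsub>E_rng x\<^esub> E_cls x Q"
  using ring_hom_add[OF E_class_hom] by simp

lemma E_class_mult:
  "x \<in> carrier V \<Longrightarrow> P \<in> carrier (stab_inv x) \<Longrightarrow> Q \<in> carrier (stab_inv x) \<Longrightarrow>
    E_cls x (P \<otimes>\<^bsub>mer_stalk V x\<^esub> Q) = E_cls x P \<otimes>\<^bsub>E_rng x\<^esub> E_cls x Q"
  using ring_hom_mult[OF E_class_hom] by simp

lemma zero_stab: "x \<in> carrier V \<Longrightarrow> \<zero>\<^bsub>mer_stalk V x\<^esub> \<in> carrier (stab_inv x)"
  using ring.ring_simprules(2)[OF cring.axioms(1)[OF stab_inv_cring]] by simp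

lemma E_class_zero: "x \<in> carrier V \<Longrightarrow> E_cls x \<zero>\<^bsub>mer_stalk V x\<^esub> = E_zero x"
  using E_class_zero_iff[OF _ zero_stab] trans_ideal_iff[of x] germ_hom_zero[OF to_unit_hom] inv_ideal_zero zero_stab
  by simp

lemma proj_add:
  "F \<in> inv_families \<Longrightarrow> H \<in> inv_families \<Longrightarrow> proj (F \<oplus>\<^bsub>\<FF>\<^esub> H) = proj F \<oplus>\<^bsub>MM\<^esub> proj H"
  unfolding M_space_ops M_proj_def
  by (rule restrict_ext) (simp add: families_at E_class_add inv_families_stab)

lemma proj_smult: "F \<in> inv_families \<Longrightarrow> proj (const_family V c \<otimes>\<^bsub>\<FF>\<^esub> F) = c \<odot>\<^bsub>MM\<^esub> proj F"
  unfolding M_space_ops M_proj_def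
  by (rule restrict_ext) (simp add: families_at E_class_mult inv_families_stab const_family_at mconst_stab)

lemma proj_zero: "proj \<zero>\<^bsub>\<FF>\<^esub> = \<zero>\<^bsub>MM\<^esub>"
  unfolding M_space_ops M_proj_def by (rule restrict_ext) (simp add: families_at E_class_zero)

lemma proj_in:
  assumes F: "F \<in> inv_families"
  shows "proj F \<in> carrier MM"
proof -
  have zero: "proj F x = E_zero x" if "x \<in> carrier V" "F x = \<zero>\<^bsub>mer_stalk V x\<^esub>" for x
    using that by (simp add: proj_at E_class_zero)
  have "{x \<in> carrier V. proj F x \<noteq> E_zero x} \<subseteq> {x \<in> carrier V. F x \<noteq> \<zero>\<^bsub>mer_stalk V x\<^esub>}"
    using zero by blast
  then have "finite {x \<in> carrier V. proj F x \<noteq> E_zero x}"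
    using reg_familiesD(2)[OF inv_familiesD(1)[OF F]] finite_subset by blast
  moreover have "proj F \<in> (\<Pi>\<^sub>E x\<in>carrier V. carrier (E_rng x))"
    using inv_families_stab[OF F] by (auto simp: M_proj_def E_ring_carrier)
  moreover have "supported_in (carrier V) E_rng W (proj F)"
    unfolding supported_in_def using zero reg_familiesD(3)[OF inv_familiesD(1)[OF F]] by blast
  moreover have "proj F (act g x) = germ_act V G act g x ` proj F x" if "g \<in> carrier G" "x \<in> carrier V" for g x
    using that inv_families_stab[OF F] by (simp add: proj_at act_closed germ_act_E_class inv_families_at[OF F])
  ultimately show ?thesis
    by (simp add: M_space_carrier direct_sum_def)
qed

lemma proj_kernel:
  assumes D: "D \<in> kernel" and F: "F \<in> inv_families"
  shows "proj (D \<oplus>\<^bsub>\<FF>\<^esub> F) = proj F"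
  unfolding M_proj_def
  using D by (intro restrict_ext) (simp add: families_at E_class_shift inv_families_stab[OF F] kernel_def)

text \<open>
  The difference is formed with the scalar \<open>-1\<close>, so that only operations of the module are involved.
\<close>

lemma proj_eqD:
  assumes F: "F \<in> inv_families" and H: "H \<in> inv_families" and eq: "proj F = proj H"
  obtains D where "D \<in> kernel" "F = D \<oplus>\<^bsub>\<FF>\<^esub> H"
proof -
  let ?n = "const_family V (- 1) \<otimes>\<^bsub>\<FF>\<^esub> H"
  note fam' = inv_familiesD(2)
  have n: "?n \<oplus>\<^bsub>\<FF>\<^esub> H = \<zero>\<^bsub>\<FF>\<^esub>"
    using complex_moduleD(7)[OF inv_germs_on_module, of H] H by (simp add: inv_germs_on_carrier inv_germs_on_ops)
  have n': "?n \<in> inv_families"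
    by (rule inv_families_smult[OF H])
  define D where "D = F \<oplus>\<^bsub>\<FF>\<^esub> ?n"
  have D_inv: "D \<in> inv_families"
    unfolding D_def by (rule inv_families_add[OF F n'])
  have "D x \<in> trans_ideal V G act x" if x: "x \<in> carrier V" for x
  proof -
    interpret R: cring "mer_stalk V x"
      by (rule mer_stalk_cring[OF x])
    have mer: "F x \<in> carrier (mer_stalk V x)" "H x \<in> carrier (mer_stalk V x)" "?n x \<in> carrier (mer_stalk V x)"
      using families_in[OF fam' x] F H n' by blast+
    have "E_cls x (F x) = E_cls x (H x)"
      using eq proj_at[OF x] by metis
    then obtain i where i: "i \<in> trans_ideal V G act x" "F x = i \<oplus>\<^bsub>mer_stalk V x\<^esub> H x"
      using E_class_eqD[OF x inv_families_stab[OF F x] inv_families_stab[OF H x]] by blast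
    have i': "i \<in> carrier (mer_stalk V x)"
      using i(1) stab_inv_mer[OF x] by (simp add: trans_ideal_iff[OF x])
    have "?n x \<oplus>\<^bsub>mer_stalk V x\<^esub> H x = \<zero>\<^bsub>mer_stalk V x\<^esub>"
      using n families_at(2,4)[OF x] by metis
    then have "H x \<oplus>\<^bsub>mer_stalk V x\<^esub> ?n x = \<zero>\<^bsub>mer_stalk V x\<^esub>"
      using R.a_comm[OF mer(2,3)] by simp
    then have "D x = i"
      unfolding D_def families_at(2)[OF x] i(2) using R.a_assoc[OF i' mer(2,3)] i' by simp
    with i(1) show ?thesis by simp
  qed
  then have "D \<in> kernel"
    using D_inv by (simp add: kernel_def)
  moreover have "D \<oplus>\<^bsub>\<FF>\<^esub> H = F"
    unfolding D_def using n fam'[OF F] fam'[OF n'] fam'[OF H] by (simp add: fam.a_assoc)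
  ultimately show thesis
    using that by metis
qed

text \<open>
  Representatives of the coset at each point are chosen independently and then averaged over \<open>G\<close>.
  By equivariance of the cosets, the germs that are averaged at a given point all lie in the same coset.
\<close>

lemma proj_lift:
  assumes m: "m \<in> carrier MM"
  obtains F where "F \<in> inv_families" "proj F = m"
    "\<And>x. x \<in> carrier V \<Longrightarrow> m x = E_zero x \<Longrightarrow> F x = \<zero>\<^bsub>mer_stalk V x\<^esub>"
proof -
  have "\<exists>p. p \<in> carrier (stab_inv x) \<and> E_cls x p = m x \<and> (m x = E_zero x \<longrightarrow> p = \<zero>\<^bsub>mer_stalk V x\<^esub>)"
    if x: "x \<in> carrier V" for x
  proof (cases "m x = E_zero x")
    case True
    then show ?thesis
      using x zero_stab E_class_zero by auto
  next
    case False
    then show ?thesis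
      using M_space_at[OF m x] unfolding E_ring_carrier by auto
  qed
  then obtain p where p: "\<And>x. x \<in> carrier V \<Longrightarrow> p x \<in> carrier (stab_inv x)"
    "\<And>x. x \<in> carrier V \<Longrightarrow> E_cls x (p x) = m x"
    "\<And>x. x \<in> carrier V \<Longrightarrow> m x = E_zero x \<Longrightarrow> p x = \<zero>\<^bsub>mer_stalk V x\<^esub>"
    by metis
  define P where "P = restrict p (carrier V)"
  have P_fam: "P \<in> carrier \<FF>"
    using p(1) stab_inv_mer by (simp add: P_def germ_families_ops)
  have "{x \<in> carrier V. P x \<noteq> \<zero>\<^bsub>mer_stalk V x\<^esub>} \<subseteq> {x \<in> carrier V. m x \<noteq> E_zero x}"
    using p(3) by (auto simp: P_def)
  then have "finite {x \<in> carrier V. P x \<noteq> \<zero>\<^bsub>mer_stalk V x\<^esub>}"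
    using m finite_subset by (auto simp: M_space_carrier direct_sum_def)
  then have P_reg: "P \<in> reg_families"
    using P_fam p m by (auto simp: reg_families_def P_def M_space_carrier supported_in_def stab_inv_carrier)
  have act_P: "family_act g P x \<in> carrier (stab_inv x) \<and> E_cls x (family_act g P x) = m x \<and>
      (m x = E_zero x \<longrightarrow> family_act g P x = \<zero>\<^bsub>mer_stalk V x\<^esub>)"
    if g: "g \<in> carrier G" and x: "x \<in> carrier V" for g x
  proof -
    let ?h = "inv\<^bsub>G\<^esub> g" and ?y = "act (inv\<^bsub>G\<^esub> g) x"
    have y: "?y \<in> carrier V" "act g ?y = x" "?h \<in> carrier G"
      using g x by (simp_all add: act_closed act_cancel)
    have at: "family_act g P x = germ_act V G act g ?y (p ?y)"
      using family_act_at[OF g y(1), of P] y by (simp add: P_def)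
    have "germ_act V G act g ?y (p ?y) \<in> carrier (stab_inv x)"
      using germ_act_stab_inv[OF g y(1) p(1)[OF y(1)]] y(2) by simp
    moreover have "E_cls x (germ_act V G act g ?y (p ?y)) = m x"
    proof -
      have "E_cls x (germ_act V G act g ?y (p ?y)) = germ_act V G act g ?y ` m ?y"
        using germ_act_E_class[OF g y(1) p(1)[OF y(1)]] p(2)[OF y(1)] y(2) by simp
      also have "\<dots> = m (act g ?y)"
        using m g y(1) unfolding M_space_carrier by blast
      finally show ?thesis
        by (simp add: y(2))
    qed
    moreover have "germ_act V G act g ?y (p ?y) = \<zero>\<^bsub>mer_stalk V x\<^esub>" if "m x = E_zero x"
    proof -
      have "m ?y = E_zero ?y"
        using m that y(3) x germ_act_E_zero[OF y(3) x] by (simp add: M_space_carrier)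
      then show ?thesis
        using p(3)[OF y(1)] germ_hom_zero[OF germ_act_hom[OF g y(1)] y(1)] y x by simp
    qed
    ultimately show ?thesis
      by (simp add: at)
  qed
  define c where "c = 1 / complex_of_nat (card (carrier G))"
  have F: "average P \<in> inv_families"
    by (rule average_inv_families[OF P_reg])
  have at: "average P x = mconst V x c \<otimes>\<^bsub>mer_stalk V x\<^esub> (\<Oplus>\<^bsub>mer_stalk V x\<^esub>g\<in>carrier G. family_act g P x)"
    if x: "x \<in> carrier V" for x
    unfolding average_def families_at(1)[OF x] const_family_at[OF x] finsum_families_at[OF x family_act_funcset[OF P_fam]] c_def ..
  have "E_cls x (average P x) = m x" if x: "x \<in> carrier V" for x
  proof -
    interpret R: cring "mer_stalk V x"
      by (rule mer_stalk_cring[OF x])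
    interpret E: ring "E_rng x"
      by (rule E_ring_ring[OF x])
    interpret St: cring "stab_inv x"
      by (rule stab_inv_cring[OF x])
    note mx = M_space_at[OF m x]
    have mc: "E_cls x (mconst V x d) \<in> carrier (E_rng x)" for d
      by (rule ring_hom_closed[OF E_class_hom[OF x] mconst_stab[OF x]])
    have "(\<Oplus>\<^bsub>mer_stalk V x\<^esub>g\<in>S. family_act g P x) \<in> carrier (stab_inv x) \<and>
        E_cls x (\<Oplus>\<^bsub>mer_stalk V x\<^esub>g\<in>S. family_act g P x) = E_cls x (mconst V x (of_nat (card S))) \<otimes>\<^bsub>E_rng x\<^esub> m x"
      if "finite S" "S \<subseteq> carrier G" for S
      using that
    proof (induction S)
      case empty
      have "mconst V x 0 = \<zero>\<^bsub>mer_stalk V x\<^esub>"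
        using mconst_ops(4)[OF x] .
      then show ?case
        using mx by (simp add: zero_stab[OF x] E_class_zero[OF x])
    next
      case (insert g S)
      then have g: "g \<in> carrier G" and IH: "(\<Oplus>\<^bsub>mer_stalk V x\<^esub>g\<in>S. family_act g P x) \<in> carrier (stab_inv x)"
        "E_cls x (\<Oplus>\<^bsub>mer_stalk V x\<^esub>g\<in>S. family_act g P x) = E_cls x (mconst V x (of_nat (card S))) \<otimes>\<^bsub>E_rng x\<^esub> m x"
        by auto
      note gP = act_P[OF g x]
      have "(\<Oplus>\<^bsub>mer_stalk V x\<^esub>g\<in>insert g S. family_act g P x)
          = family_act g P x \<oplus>\<^bsub>mer_stalk V x\<^esub> (\<Oplus>\<^bsub>mer_stalk V x\<^esub>g\<in>S. family_act g P x)"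
        using insert act_P[OF _ x] stab_inv_mer[OF x] by (intro R.finsum_insert) auto
      moreover have "family_act g P x \<oplus>\<^bsub>mer_stalk V x\<^esub> (\<Oplus>\<^bsub>mer_stalk V x\<^esub>g\<in>S. family_act g P x) \<in> carrier (stab_inv x)"
        using St.a_closed[of "family_act g P x"] gP IH by simp
      moreover have "E_cls x (family_act g P x \<oplus>\<^bsub>mer_stalk V x\<^esub> (\<Oplus>\<^bsub>mer_stalk V x\<^esub>g\<in>S. family_act g P x))
          = m x \<oplus>\<^bsub>E_rng x\<^esub> E_cls x (mconst V x (of_nat (card S))) \<otimes>\<^bsub>E_rng x\<^esub> m x"
        using E_class_add[OF x] gP IH by simp
      moreover have "\<dots> = E_cls x (mconst V x (1 + of_nat (card S))) \<otimes>\<^bsub>E_rng x\<^esub> m x"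
      proof -
        have "E_cls x (mconst V x 1) = \<one>\<^bsub>E_rng x\<^esub>"
          using ring_hom_one[OF E_class_hom[OF x]] by (simp add: mconst_ops(3)[OF x])
        then have "E_cls x (mconst V x (1 + of_nat (card S))) = \<one>\<^bsub>E_rng x\<^esub> \<oplus>\<^bsub>E_rng x\<^esub> E_cls x (mconst V x (of_nat (card S)))"
          unfolding mconst_ops(1)[OF x] E_class_add[OF x mconst_stab[OF x] mconst_stab[OF x]] by simp
        then show ?thesis
          using E.l_distr[OF E.one_closed mc mx] E.l_one[OF mx] by simp
      qed
      ultimately show ?case
        using insert.hyps by simp
    qed
    from this[OF finite_G subset_refl]
    have s: "(\<Oplus>\<^bsub>mer_stalk V x\<^esub>g\<in>carrier G. family_act g P x) \<in> carrier (stab_inv x)"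
      "E_cls x (\<Oplus>\<^bsub>mer_stalk V x\<^esub>g\<in>carrier G. family_act g P x)
        = E_cls x (mconst V x (of_nat (card (carrier G)))) \<otimes>\<^bsub>E_rng x\<^esub> m x"
      by auto
    have "card (carrier G) > 0"
      using finite_G G.one_closed card_gt_0_iff by blast
    then have "mconst V x c \<otimes>\<^bsub>mer_stalk V x\<^esub> mconst V x (of_nat (card (carrier G))) = \<one>\<^bsub>mer_stalk V x\<^esub>"
      unfolding mconst_ops(2)[OF x, symmetric] c_def by (simp add: mconst_ops(3)[OF x])
    then have unit: "E_cls x (mconst V x c) \<otimes>\<^bsub>E_rng x\<^esub> E_cls x (mconst V x (of_nat (card (carrier G)))) = \<one>\<^bsub>E_rng x\<^esub>"
      unfolding E_class_mult[OF x mconst_stab[OF x] mconst_stab[OF x], symmetric]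
      using ring_hom_one[OF E_class_hom[OF x]] by simp
    show ?thesis
      unfolding at[OF x] E_class_mult[OF x mconst_stab[OF x] s(1)] s(2) E.m_assoc[OF mc mc mx, symmetric] unit
      by (rule E.l_one[OF mx])
  qed
  then have "proj (average P) = m"
    using M_space_ext[OF m] by (intro extensionalityI[of _ "carrier V"]) (simp_all add: M_proj_def)
  moreover have "average P x = \<zero>\<^bsub>mer_stalk V x\<^esub>" if x: "x \<in> carrier V" and "m x = E_zero x" for x
  proof -
    interpret R: cring "mer_stalk V x"
      by (rule mer_stalk_cring[OF x])
    have "(\<Oplus>\<^bsub>mer_stalk V x\<^esub>g\<in>carrier G. family_act g P x) = (\<Oplus>\<^bsub>mer_stalk V x\<^esub>g\<in>carrier G. \<zero>\<^bsub>mer_stalk V x\<^esub>)"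
    proof (rule R.finsum_cong'[OF refl])
      show "family_act g P x = \<zero>\<^bsub>mer_stalk V x\<^esub>" if "g \<in> carrier G" for g
        using act_P[OF that x] \<open>m x = E_zero x\<close> by blast
    qed simp
    then show ?thesis
      unfolding at[OF x] by (simp add: mconst_carrier[OF x])
  qed
  ultimately show thesis
    using that F by blast
qed

lemma proj_image: "proj ` carrier (inv_germs_on V G act W) = carrier MM"
proof (intro equalityI subsetI)
  fix m assume "m \<in> carrier MM"
  then obtain F where "F \<in> inv_families" "proj F = m"
    using proj_lift by blast
  then show "m \<in> proj ` carrier (inv_germs_on V G act W)"
    unfolding inv_germs_on_carrier by blast
qed (auto simp: inv_germs_on_carrier proj_in)


lemma proj_linear:
  "proj \<zero>\<^bsub>inv_germs_on V G act W\<^esub> = \<zero>\<^bsub>MM\<^esub>"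
  "F \<in> carrier (inv_germs_on V G act W) \<Longrightarrow> H \<in> carrier (inv_germs_on V G act W) \<Longrightarrow>
    proj (F \<oplus>\<^bsub>inv_germs_on V G act W\<^esub> H) = proj F \<oplus>\<^bsub>MM\<^esub> proj H"
  "F \<in> carrier (inv_germs_on V G act W) \<Longrightarrow> proj (c \<odot>\<^bsub>inv_germs_on V G act W\<^esub> F) = c \<odot>\<^bsub>MM\<^esub> proj F"
  by (simp_all only: inv_germs_on_carrier inv_germs_on_ops proj_zero proj_add proj_smult)

lemma M_space_module: "module complex_ring MM"
  by (rule module_image[where f = proj, OF inv_germs_on_module proj_image proj_linear])

end

section \<open>Finitely supported functionals\<close>

context invariant_set
begin

abbreviation "Mst \<equiv> Mstar_space V G act W"
abbreviation "compo \<equiv> component (carrier V) E_rng"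

lemma M_space_zero_at: "x \<in> carrier V \<Longrightarrow> \<zero>\<^bsub>MM\<^esub> x = E_zero x"
  by (simp add: M_space_ops)

lemma compo_in:
  assumes m: "m \<in> carrier MM"
    and Y: "\<And>g x. g \<in> carrier G \<Longrightarrow> x \<in> carrier V \<Longrightarrow> act g x \<in> Y \<longleftrightarrow> x \<in> Y"
  shows "compo Y m \<in> carrier MM"
proof -
  have "{x \<in> carrier V. compo Y m x \<noteq> E_zero x} \<subseteq> {x \<in> carrier V. m x \<noteq> E_zero x}"
    by (auto simp: component_def)
  then have "finite {x \<in> carrier V. compo Y m x \<noteq> E_zero x}"
    using m finite_subset by (auto simp: M_space_carrier direct_sum_def)
  moreover have "compo Y m \<in> (\<Pi>\<^sub>E x\<in>carrier V. carrier (E_rng x))"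
    using M_space_at[OF m] E_zero_closed by (auto simp: component_def)
  moreover have "supported_in (carrier V) E_rng W (compo Y m)"
    using m by (auto simp: M_space_carrier supported_in_def component_def)
  moreover have "compo Y m (act g x) = germ_act V G act g x ` compo Y m x"
    if "g \<in> carrier G" "x \<in> carrier V" for g x
    using that m Y[OF that] germ_act_E_zero[OF that] by (simp add: component_def act_closed M_space_carrier)
  ultimately show ?thesis
    by (simp add: M_space_carrier direct_sum_def)
qed

lemma compo_union:
  assumes m: "m \<in> carrier MM" and disj: "Y \<inter> Z = {}"
  shows "compo (Y \<union> Z) m = compo Y m \<oplus>\<^bsub>MM\<^esub> compo Z m"
  unfolding M_space_ops component_def
proof (rule restrict_ext)
  fix x assume x: "x \<in> carrier V"
  interpret E: ring "E_rng x"
    by (rule E_ring_ring[OF x])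
  show "(if x \<in> Y \<union> Z then m x else E_zero x) =
      (\<lambda>x\<in>carrier V. if x \<in> Y then m x else E_zero x) x \<oplus>\<^bsub>E_rng x\<^esub> (\<lambda>x\<in>carrier V. if x \<in> Z then m x else E_zero x) x"
    using x disj M_space_at[OF m x] by auto
qed

lemma compo_add:
  "compo Y (m \<oplus>\<^bsub>MM\<^esub> n) = compo Y m \<oplus>\<^bsub>MM\<^esub> compo Y n"
  unfolding M_space_ops component_def
proof (rule restrict_ext)
  fix x assume x: "x \<in> carrier V"
  interpret E: ring "E_rng x"
    by (rule E_ring_ring[OF x])
  show "(if x \<in> Y then (\<lambda>x\<in>carrier V. m x \<oplus>\<^bsub>E_rng x\<^esub> n x) x else E_zero x) =
      (\<lambda>x\<in>carrier V. if x \<in> Y then m x else E_zero x) x \<oplus>\<^bsub>E_rng x\<^esub> (\<lambda>x\<in>carrier V. if x \<in> Y then n x else E_zero x) x"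
    using x by simp
qed

lemma compo_smult: "compo Y (c \<odot>\<^bsub>MM\<^esub> m) = c \<odot>\<^bsub>MM\<^esub> compo Y m"
  unfolding M_space_ops component_def
proof (rule restrict_ext)
  fix x assume x: "x \<in> carrier V"
  interpret E: ring "E_rng x"
    by (rule E_ring_ring[OF x])
  have "E_cls x (mconst V x c) \<in> carrier (E_rng x)"
    by (rule ring_hom_closed[OF E_class_hom[OF x] mconst_stab[OF x]])
  then show "(if x \<in> Y then (\<lambda>x\<in>carrier V. E_cls x (mconst V x c) \<otimes>\<^bsub>E_rng x\<^esub> m x) x else E_zero x) =
      E_cls x (mconst V x c) \<otimes>\<^bsub>E_rng x\<^esub> (\<lambda>x\<in>carrier V. if x \<in> Y then m x else E_zero x) x"
    using x by simp
qed

lemma compo_orbit: "X \<in> orbits G W act \<Longrightarrow> m \<in> carrier MM \<Longrightarrow> compo X m \<in> E_orbit V G act X"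
  using orbitsD(4) by (auto simp: E_orbit_carrier supported_in_def component_def intro!: compo_in[unfolded component_def])

lemma compo_eq_self: "m \<in> E_orbit V G act X \<Longrightarrow> X \<in> orbits G W act \<Longrightarrow> compo X m = m"
  using M_space_ext by (intro extensionalityI[of _ "carrier V"])
    (auto simp: E_orbit_carrier supported_in_def component_def)

lemma linear_dualD:
  assumes "\<alpha> \<in> linear_dual M"
  shows "m \<in> carrier M \<Longrightarrow> n \<in> carrier M \<Longrightarrow> \<alpha> (m \<oplus>\<^bsub>M\<^esub> n) = \<alpha> m + \<alpha> n"
    and "m \<in> carrier M \<Longrightarrow> \<alpha> (c \<odot>\<^bsub>M\<^esub> m) = c * \<alpha> m"
    and "\<alpha> \<in> extensional (carrier M)"
  using assms by (simp_all add: linear_dual_def)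

definition vanishing_on :: "'v set \<Rightarrow> (('v \<Rightarrow> 'v mgerm set) \<Rightarrow> complex) \<Rightarrow> bool" where
  "vanishing_on K \<alpha> \<longleftrightarrow> finite K \<and> K \<subseteq> carrier V \<and>
     (\<forall>m\<in>carrier MM. (\<forall>x\<in>K. m x = E_zero x) \<longrightarrow> \<alpha> m = 0)"

lemma linear_dual_zero:
  assumes "\<alpha> \<in> linear_dual MM"
  shows "\<alpha> \<zero>\<^bsub>MM\<^esub> = 0"
proof -
  interpret abelian_group MM
    by (rule complex_moduleD(1)[OF M_space_module])
  have "\<alpha> \<zero>\<^bsub>MM\<^esub> = \<alpha> \<zero>\<^bsub>MM\<^esub> + \<alpha> \<zero>\<^bsub>MM\<^esub>"
    using linear_dualD(1)[OF assms zero_closed zero_closed] by simp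
  then show ?thesis by simp
qed

text \<open>
  A functional on \<open>M(G,W)\<close> is additive over the decomposition of a family into its components on finitely
  many orbits.
\<close>

lemma compo_Union_sum:
  assumes \<alpha>: "\<alpha> \<in> linear_dual MM" and m: "m \<in> carrier MM" and \<X>: "finite \<X>" "\<X> \<subseteq> orbits G W act"
  shows "\<alpha> (compo (\<Union>\<X>) m) = (\<Sum>X\<in>\<X>. \<alpha> (compo X m))"
  using \<X>
proof (induction \<X>)
  case empty
  have "compo (\<Union>{}) m = \<zero>\<^bsub>MM\<^esub>"
    by (simp add: component_def M_space_ops)
  then show ?case
    by (simp add: linear_dual_zero[OF \<alpha>])
next
  case (insert X \<X>)
  have X: "X \<in> orbits G W act" and \<X>: "\<X> \<subseteq> orbits G W act"
    using insert.prems by auto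
  have "X \<inter> \<Union>\<X> = {}"
  proof (rule ccontr)
    assume "X \<inter> \<Union>\<X> \<noteq> {}"
    then obtain x Z where "x \<in> X" "x \<in> Z" "Z \<in> \<X>" by blast
    then have "X = Z"
      using orbitsD(3)[OF X] orbitsD(3)[of Z x] \<X> by auto
    then show False
      using insert.hyps \<open>Z \<in> \<X>\<close> by simp
  qed
  then have "compo (\<Union>(insert X \<X>)) m = compo X m \<oplus>\<^bsub>MM\<^esub> compo (\<Union>\<X>) m"
    using compo_union[OF m] by simp
  moreover have "compo X m \<in> carrier MM"
    by (rule compo_in[OF m]) (rule orbitsD(4)[OF X])
  moreover have "compo (\<Union>\<X>) m \<in> carrier MM"
  proof (rule compo_in[OF m])
    show "act g x \<in> \<Union>\<X> \<longleftrightarrow> x \<in> \<Union>\<X>" if "g \<in> carrier G" "x \<in> carrier V" for g x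
      using orbitsD(4)[OF _ that] \<X> by blast
  qed
  ultimately show ?case
    using insert \<X> linear_dualD(1)[OF \<alpha>] by simp
qed

text \<open>
  \<open>M\<^sup>*(G,W)\<close> consists of the functionals that only depend on the values at finitely many points. In
  this form it is visibly stable under the transposes of the elements of the skew-group ring.
\<close>

lemma Mstar_carrier:
  "\<alpha> \<in> carrier Mst \<longleftrightarrow> \<alpha> \<in> linear_dual MM \<and> (\<exists>K. vanishing_on K \<alpha>)"
proof -
  let ?E = "\<lambda>X. E_space V G act (E_orbit V G act X)"
  let ?supp = "\<lambda>\<beta>. {X \<in> orbits G W act. \<beta> X \<noteq> zero_functional (?E X)}"
  let ?\<alpha> = "\<lambda>\<beta>. \<lambda>m\<in>carrier MM. \<Sum>X\<in>?supp \<beta>. \<beta> X (compo X m)"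
  have Mst: "carrier Mst = {?\<alpha> \<beta> | \<beta>. (\<forall>X\<in>orbits G W act. \<beta> X \<in> linear_dual (?E X)) \<and> finite (?supp \<beta>)}"
    by (simp add: Mstar_space_def Let_def)
  interpret M: abelian_group MM
    by (rule complex_moduleD(1)[OF M_space_module])
  have smult_closed: "c \<odot>\<^bsub>MM\<^esub> m \<in> carrier MM" if "m \<in> carrier MM" for c m
    by (rule complex_moduleD(2)[OF M_space_module that])
  show ?thesis
  proof
    assume "\<alpha> \<in> carrier Mst"
    then obtain \<beta> where \<alpha>: "\<alpha> = ?\<alpha> \<beta>" and \<beta>: "\<And>X. X \<in> orbits G W act \<Longrightarrow> \<beta> X \<in> linear_dual (?E X)"
      and fin: "finite (?supp \<beta>)"
      unfolding Mst by blast
    have \<beta>_add: "\<beta> X (compo X (m \<oplus>\<^bsub>MM\<^esub> n)) = \<beta> X (compo X m) + \<beta> X (compo X n)"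
      if "X \<in> orbits G W act" "m \<in> carrier MM" "n \<in> carrier MM" for X m n
      using linear_dualD(1)[OF \<beta>[OF that(1)], of "compo X m" "compo X n"] compo_orbit[OF that(1)] that
      by (simp add: E_space_ops compo_add)
    have \<beta>_smult: "\<beta> X (compo X (c \<odot>\<^bsub>MM\<^esub> m)) = c * \<beta> X (compo X m)"
      if "X \<in> orbits G W act" "m \<in> carrier MM" for X m c
      using linear_dualD(2)[OF \<beta>[OF that(1)], of "compo X m" c] compo_orbit[OF that(1)] that
      by (simp add: E_space_ops compo_smult)
    have "\<alpha> \<in> linear_dual MM"
      unfolding linear_dual_def \<alpha>
      by (auto simp: smult_closed \<beta>_add \<beta>_smult sum.distrib sum_distrib_left intro!: sum.cong)
    moreover have "vanishing_on (\<Union>(?supp \<beta>)) \<alpha>"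
      unfolding vanishing_on_def
    proof (intro conjI ballI impI)
      show "finite (\<Union>(?supp \<beta>))"
        using fin orbitsD(2) by blast
      show "\<Union>(?supp \<beta>) \<subseteq> carrier V"
        using orbitsD(1) W_carrier by blast
      fix m assume m: "m \<in> carrier MM" and zero: "\<forall>x\<in>\<Union>(?supp \<beta>). m x = E_zero x"
      have "\<beta> X (compo X m) = 0" if X: "X \<in> ?supp \<beta>" for X
      proof -
        have X': "X \<in> orbits G W act" using X by simp
        have "compo X m = compo X \<zero>\<^bsub>MM\<^esub>"
          unfolding component_def using zero X by (intro restrict_ext) (auto simp: M_space_zero_at)
        moreover have "\<beta> X (compo X \<zero>\<^bsub>MM\<^esub>) = \<beta> X (compo X \<zero>\<^bsub>MM\<^esub>) + \<beta> X (compo X \<zero>\<^bsub>MM\<^esub>)"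
          using \<beta>_add[OF X' M.zero_closed M.zero_closed] by simp
        ultimately show ?thesis by simp
      qed
      then show "\<alpha> m = 0"
        using m by (simp add: \<alpha>)
    qed
    ultimately show "\<alpha> \<in> linear_dual MM \<and> (\<exists>K. vanishing_on K \<alpha>)" by blast
  next
    assume "\<alpha> \<in> linear_dual MM \<and> (\<exists>K. vanishing_on K \<alpha>)"
    then obtain K where \<alpha>: "\<alpha> \<in> linear_dual MM" and K: "vanishing_on K \<alpha>" by blast
    define \<beta> where "\<beta> X = restrict \<alpha> (E_orbit V G act X)" for X
    define \<X> where "\<X> = {X \<in> orbits G W act. X \<inter> K \<noteq> {}}"
    have sub: "\<X> \<subseteq> (\<lambda>x. orbit G act x) ` K"
    proof
      fix X assume "X \<in> \<X>"
      then obtain x where x: "x \<in> X" "x \<in> K" "X \<in> orbits G W act"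
        by (auto simp: \<X>_def)
      then show "X \<in> (\<lambda>x. orbit G act x) ` K"
        using orbitsD(3)[OF x(3,1)] by (intro image_eqI[of _ _ x]) auto
    qed
    have fin_\<X>: "finite \<X>"
      using K by (intro finite_subset[OF sub finite_imageI]) (simp add: vanishing_on_def)
    have orbit_M: "m \<in> carrier MM" if "X \<in> orbits G W act" "m \<in> E_orbit V G act X" for X m
      using that by (simp add: E_orbit_carrier)
    have \<beta>: "\<beta> X \<in> linear_dual (?E X)" if X: "X \<in> orbits G W act" for X
    proof -
      have "m \<oplus>\<^bsub>MM\<^esub> n \<in> E_orbit V G act X" if "m \<in> E_orbit V G act X" "n \<in> E_orbit V G act X" for m n
        using compo_orbit[OF X M.a_closed[OF orbit_M[OF X that(1)] orbit_M[OF X that(2)]]] that X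
        by (simp add: compo_add compo_eq_self)
      moreover have "c \<odot>\<^bsub>MM\<^esub> m \<in> E_orbit V G act X" if "m \<in> E_orbit V G act X" for m c
        using compo_orbit[OF X smult_closed[OF orbit_M[OF X that]], of c] that X
        by (simp add: compo_smult compo_eq_self)
      ultimately show ?thesis
        using linear_dualD[OF \<alpha>] orbit_M[OF X] by (simp add: linear_dual_def E_space_ops \<beta>_def)
    qed
    have supp: "?supp \<beta> \<subseteq> \<X>"
    proof
      fix X assume X: "X \<in> ?supp \<beta>"
      then have X': "X \<in> orbits G W act" by simp
      have "X \<inter> K \<noteq> {}"
      proof
        assume disj: "X \<inter> K = {}"
        have "\<alpha> m = 0" if m: "m \<in> E_orbit V G act X" for m
        proof -
          have "m x = E_zero x" if "x \<in> K" for x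
            using m that disj K X' by (auto simp: E_orbit_carrier supported_in_def vanishing_on_def)
          then show ?thesis
            using K orbit_M[OF X' m] by (simp add: vanishing_on_def)
        qed
        then have "\<beta> X = zero_functional (?E X)"
          unfolding \<beta>_def zero_functional_def E_space_ops by (intro restrict_ext) simp
        with X show False by simp
      qed
      with X' show "X \<in> \<X>"
        by (simp add: \<X>_def)
    qed
    have "\<alpha> m = (\<Sum>X\<in>?supp \<beta>. \<beta> X (compo X m))" if m: "m \<in> carrier MM" for m
    proof -
      let ?Y = "\<Union>\<X>"
      have inv: "act g x \<in> ?Y \<longleftrightarrow> x \<in> ?Y" if "g \<in> carrier G" "x \<in> carrier V" for g x
        using orbitsD(4)[OF _ that] by (auto simp: \<X>_def)
      have Y: "compo ?Y m \<in> carrier MM" "compo (- ?Y) m \<in> carrier MM"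
        using inv by (auto intro!: compo_in[OF m])
      have "compo (?Y \<union> - ?Y) m = m"
        using M_space_ext[OF m] by (intro extensionalityI[of _ "carrier V"]) (auto simp: component_def)
      then have "\<alpha> m = \<alpha> (compo ?Y m) + \<alpha> (compo (- ?Y) m)"
        using compo_union[OF m, of ?Y "- ?Y"] linear_dualD(1)[OF \<alpha> Y] by simp
      moreover have "\<alpha> (compo (- ?Y) m) = 0"
      proof -
        have "compo (- ?Y) m x = E_zero x" if x: "x \<in> K" for x
        proof -
          have xV: "x \<in> carrier V"
            using x K by (auto simp: vanishing_on_def)
          show ?thesis
          proof (cases "x \<in> W")
            case True
            then have "x \<in> ?Y"
              using x orbit_mem[OF True] orbit_self[OF xV] unfolding \<X>_def by blast
            then show ?thesis
              using xV by (auto simp: component_def)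
          next
            case False
            then have "m x = E_zero x"
              using m xV by (simp add: M_space_carrier supported_in_def)
            then show ?thesis
              using xV by (simp add: component_def)
          qed
        qed
        then show ?thesis
          using K Y(2) by (simp add: vanishing_on_def)
      qed
      moreover have "\<alpha> (compo ?Y m) = (\<Sum>X\<in>\<X>. \<alpha> (compo X m))"
        by (rule compo_Union_sum[OF \<alpha> m fin_\<X>]) (auto simp: \<X>_def)
      moreover have "(\<Sum>X\<in>\<X>. \<alpha> (compo X m)) = (\<Sum>X\<in>\<X>. \<beta> X (compo X m))"
        using compo_orbit[OF _ m] by (intro sum.cong) (auto simp: \<beta>_def \<X>_def)
      moreover have "(\<Sum>X\<in>\<X>. \<beta> X (compo X m)) = (\<Sum>X\<in>?supp \<beta>. \<beta> X (compo X m))"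
      proof (rule sum.mono_neutral_right[OF fin_\<X> supp], intro ballI)
        fix X assume X: "X \<in> \<X> - ?supp \<beta>"
        then have X': "X \<in> orbits G W act" by (simp add: \<X>_def)
        then have "\<beta> X = zero_functional (?E X)" using X by simp
        then show "\<beta> X (compo X m) = 0"
          using compo_orbit[OF X' m] by (simp add: zero_functional_def E_space_ops)
      qed
      ultimately show ?thesis by simp
    qed
    then have "\<alpha> = ?\<alpha> \<beta>"
      using linear_dualD(3)[OF \<alpha>] by (intro extensionalityI[of _ "carrier MM"]) simp_all
    moreover have "finite (?supp \<beta>)"
      using supp fin_\<X> by (rule finite_subset)
    ultimately show "\<alpha> \<in> carrier Mst"
      unfolding Mst using \<beta> by blast
  qed
qed

lemma Mstar_ops:
  "\<zero>\<^bsub>Mst\<^esub> = (\<lambda>m\<in>carrier MM. 0)"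
  "\<alpha> \<oplus>\<^bsub>Mst\<^esub> \<beta> = (\<lambda>m\<in>carrier MM. \<alpha> m + \<beta> m)"
  "c \<odot>\<^bsub>Mst\<^esub> \<alpha> = (\<lambda>m\<in>carrier MM. c * \<alpha> m)"
  by (simp_all add: Mstar_space_def zero_functional_def Let_def)

lemma Mstar_module: "module complex_ring Mst"
proof -
  interpret M: abelian_group MM
    by (rule complex_moduleD(1)[OF M_space_module])
  have smult_closed: "c \<odot>\<^bsub>MM\<^esub> m \<in> carrier MM" if "m \<in> carrier MM" for c m
    by (rule complex_moduleD(2)[OF M_space_module that])
  note ext = extensionalityI[of _ "carrier MM"]
  have ext_MS: "\<alpha> \<in> extensional (carrier MM)" if "\<alpha> \<in> carrier Mst" for \<alpha>
    using that by (simp add: Mstar_carrier linear_dual_def)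
  have zero: "\<zero>\<^bsub>Mst\<^esub> \<in> carrier Mst"
  proof -
    have "\<zero>\<^bsub>Mst\<^esub> \<in> linear_dual MM"
      by (simp add: linear_dual_def Mstar_ops smult_closed)
    moreover have "vanishing_on {} \<zero>\<^bsub>Mst\<^esub>"
      by (simp add: vanishing_on_def Mstar_ops)
    ultimately show ?thesis
      unfolding Mstar_carrier by blast
  qed
  have add: "\<alpha> \<oplus>\<^bsub>Mst\<^esub> \<beta> \<in> carrier Mst" if a: "\<alpha> \<in> carrier Mst" and b: "\<beta> \<in> carrier Mst" for \<alpha> \<beta>
  proof -
    obtain K L where \<alpha>: "\<alpha> \<in> linear_dual MM" "vanishing_on K \<alpha>" and \<beta>: "\<beta> \<in> linear_dual MM" "vanishing_on L \<beta>"
      using a b unfolding Mstar_carrier by blast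
    have "\<alpha> \<oplus>\<^bsub>Mst\<^esub> \<beta> \<in> linear_dual MM"
      using \<alpha>(1) \<beta>(1) by (simp add: linear_dual_def Mstar_ops smult_closed distrib_left)
    moreover have "vanishing_on (K \<union> L) (\<alpha> \<oplus>\<^bsub>Mst\<^esub> \<beta>)"
      using \<alpha>(2) \<beta>(2) by (auto simp: vanishing_on_def Mstar_ops)
    ultimately show ?thesis
      unfolding Mstar_carrier by blast
  qed
  have smult: "c \<odot>\<^bsub>Mst\<^esub> \<alpha> \<in> carrier Mst" if a: "\<alpha> \<in> carrier Mst" for c \<alpha>
  proof -
    obtain K where \<alpha>: "\<alpha> \<in> linear_dual MM" "vanishing_on K \<alpha>"
      using a unfolding Mstar_carrier by blast
    have "c \<odot>\<^bsub>Mst\<^esub> \<alpha> \<in> linear_dual MM"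
      using \<alpha>(1) by (simp add: linear_dual_def Mstar_ops smult_closed distrib_left)
    moreover have "vanishing_on K (c \<odot>\<^bsub>Mst\<^esub> \<alpha>)"
      using \<alpha>(2) by (simp add: vanishing_on_def Mstar_ops)
    ultimately show ?thesis
      unfolding Mstar_carrier by blast
  qed
  show ?thesis
  proof (rule complex_moduleI)
    fix \<alpha> assume \<alpha>: "\<alpha> \<in> carrier Mst"
    show "\<zero>\<^bsub>Mst\<^esub> \<oplus>\<^bsub>Mst\<^esub> \<alpha> = \<alpha>" "1 \<odot>\<^bsub>Mst\<^esub> \<alpha> = \<alpha>"
      using ext_MS[OF \<alpha>] by (auto simp: Mstar_ops intro!: ext)
  qed (simp_all only: zero add smult, auto simp: Mstar_ops algebra_simps intro!: restrict_ext)
qed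

end


section \<open>The action of the skew-group ring on the quotient and on its dual\<close>

text \<open>
  The action on the quotient is defined by the single element of the set of all classes of \<open>A F\<close>.
\<close>

lemma the_elem_constant_image: "x \<in> S \<Longrightarrow> (\<And>y. y \<in> S \<Longrightarrow> f y = c) \<Longrightarrow> the_elem (f ` S) = c"
  using image_constant[of x S c] image_cong[of S S f "\<lambda>_. c"] by simp

text \<open>
  Here \<open>W\<close> is any \<open>G\<close>-invariant set such that the algebra preserves the invariant families of regular
  germs on \<open>W\<close>.
\<close>

locale skew_setting = invariant_set V G act W
  for V :: "('v, 'z) sgroup_scheme" (structure) and G :: "('g, 'y) monoid_scheme" and act and W +
  fixes \<Gamma> :: "'v set" and \<A> :: "('v \<Rightarrow> 'v \<Rightarrow> 'v mgerm) set"
  assumes subgroup_\<Gamma>: "subgroup \<Gamma> V"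
    and subalgebra: "is_subalgebra (skew_ring V \<Gamma>) \<A>"
    and preserves: "A \<in> \<A> \<Longrightarrow> F \<in> carrier (inv_germs_on V G act W) \<Longrightarrow>
      skew_act V \<Gamma> A F \<in> carrier (inv_germs_on V G act W)"
begin

sublocale skew: translation_subgroup V \<Gamma>
  by (intro translation_subgroup.intro translation_subgroup_axioms.intro sheaf_group_axioms subgroup_\<Gamma>)

lemma \<A>_skew: "A \<in> \<A> \<Longrightarrow> A \<in> carrier (skew_ring V \<Gamma>)"
  using subalgebra by (auto simp: is_subalgebra_def)

lemma skew_act_inv: "A \<in> \<A> \<Longrightarrow> F \<in> inv_families \<Longrightarrow> skew_act V \<Gamma> A F \<in> inv_families"
  using preserves by (simp add: inv_germs_on_carrier)

lemma skew_act_kernel: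
  assumes A: "A \<in> \<A>" and D: "D \<in> kernel"
  shows "skew_act V \<Gamma> A D \<in> kernel"
proof (rule kernel_stable[OF _ _ _ D])
  note fam' = inv_familiesD(2)
  fix F assume F: "F \<in> inv_families"
  show "skew_act V \<Gamma> A F \<in> inv_families"
    by (rule skew_act_inv[OF A F])
  show "skew_act V \<Gamma> A (F \<oplus>\<^bsub>\<FF>\<^esub> H) = skew_act V \<Gamma> A F \<oplus>\<^bsub>\<FF>\<^esub> skew_act V \<Gamma> A H" if "H \<in> inv_families" for H
    by (rule skew.skew_act_add[OF \<A>_skew[OF A] fam'[OF F] fam'[OF that]])
  fix L assume "L \<in> invariant_generators"
  then have "L \<in> carrier (mer_stalk V \<one>)"
    using invariant_generatorsD(1) reg_stalk_mer[OF one_closed] by blast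
  then show "skew_act V \<Gamma> A (spread_germ L \<otimes>\<^bsub>\<FF>\<^esub> F) = spread_germ L \<otimes>\<^bsub>\<FF>\<^esub> skew_act V \<Gamma> A F"
    by (intro skew.skew_act_invariant_mult[OF \<A>_skew[OF A] fam'[OF F]] spread_germ_closed spread_germ_invariant)
qed

text \<open>
  Two representatives of a class differ by an element of the kernel, which \<open>A\<close> preserves.
\<close>

lemma M_act_proj:
  assumes A: "A \<in> \<A>" and F: "F \<in> inv_families"
  shows "M_act V G act \<Gamma> W A (proj F) = proj (skew_act V \<Gamma> A F)"
proof -
  have "proj (skew_act V \<Gamma> A H) = proj (skew_act V \<Gamma> A F)" if H: "H \<in> inv_families" "proj H = proj F" for H
  proof -
    obtain D where D: "D \<in> kernel" "H = D \<oplus>\<^bsub>\<FF>\<^esub> F"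
      using proj_eqD[OF H(1) F H(2)] .
    have "D \<in> carrier \<FF>"
      using D(1) by (simp add: kernel_def inv_familiesD)
    then have "skew_act V \<Gamma> A H = skew_act V \<Gamma> A D \<oplus>\<^bsub>\<FF>\<^esub> skew_act V \<Gamma> A F"
      unfolding D(2) by (rule skew.skew_act_add[OF \<A>_skew[OF A] _ inv_familiesD(2)[OF F]])
    then show ?thesis
      using proj_kernel[OF skew_act_kernel[OF A D(1)] skew_act_inv[OF A F]] by simp
  qed
  note const = this
  have "the_elem ((\<lambda>H. proj (skew_act V \<Gamma> A H)) ` {H \<in> inv_families. proj H = proj F}) = proj (skew_act V \<Gamma> A F)"
  proof (rule the_elem_constant_image)
    show "F \<in> {H \<in> inv_families. proj H = proj F}"
      using F by simp
    fix H assume "H \<in> {H \<in> inv_families. proj H = proj F}"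
    then have H: "H \<in> inv_families" "proj H = proj F"
      unfolding mem_Collect_eq by (rule conjunct1, rule conjunct2)
    show "proj (skew_act V \<Gamma> A H) = proj (skew_act V \<Gamma> A F)"
      by (rule const[OF H])
  qed
  then show ?thesis
    by (simp only: M_act_def inv_germs_on_carrier)
qed

lemma inv_germs_left_module:
  "left_module (skew_ring V \<Gamma>) \<A> (inv_germs_on V G act W) (skew_act V \<Gamma>)"
  using inv_germs_on_module preserves inv_familiesD(2) \<A>_skew
  by (auto simp: left_module_def bilinear_action_def inv_germs_on_carrier inv_germs_on_ops
      skew.skew_act_add skew.skew_act_add_ring skew.skew_act_smult skew.skew_act_smult_arg skew.skew_act_one
      skew.skew_act_mult_ring)

lemma M_left_module: "left_module (skew_ring V \<Gamma>) \<A> MM (M_act V G act \<Gamma> W)"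
  by (rule left_module_image[where f = proj, OF inv_germs_left_module proj_image proj_linear _ subalgebra])
     (simp_all only: inv_germs_on_carrier M_act_proj)

text \<open>
  If \<open>m\<close> vanishes at the finitely many points \<open>\<xi>\<^sup>-\<^sup>1 x\<close> with \<open>\<xi>\<close> in the support of \<open>A\<close>, it has a
  representative vanishing there, and then \<open>A m\<close> vanishes at \<open>x\<close>.
\<close>

lemma M_act_vanishing:
  assumes A: "A \<in> \<A>" and m: "m \<in> carrier MM" and x: "x \<in> carrier V"
    and zero: "\<And>\<xi>. \<xi> \<in> skew_support V \<Gamma> A \<Longrightarrow> m (inv \<xi> \<otimes> x) = E_zero (inv \<xi> \<otimes> x)"
  shows "M_act V G act \<Gamma> W A m x = E_zero x"
proof -
  obtain F where F: "F \<in> inv_families" "proj F = m"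
    and Fz: "\<And>x. x \<in> carrier V \<Longrightarrow> m x = E_zero x \<Longrightarrow> F x = \<zero>\<^bsub>mer_stalk V x\<^esub>"
    using proj_lift[OF m] by blast
  note A' = \<A>_skew[OF A]
  interpret R: cring "mer_stalk V x"
    by (rule mer_stalk_cring[OF x])
  have "A \<xi> x \<otimes>\<^bsub>mer_stalk V x\<^esub> family_trans V \<xi> F x = \<zero>\<^bsub>mer_stalk V x\<^esub>" if \<xi>: "\<xi> \<in> skew_support V \<Gamma> A" for \<xi>
  proof -
    have \<xi>\<Gamma>: "\<xi> \<in> \<Gamma>" "\<xi> \<in> carrier V"
      using \<xi> skew.skew_support_subset skew.\<Gamma>_carrier by blast+
    then have y: "inv \<xi> \<otimes> x \<in> carrier V" "\<xi> \<otimes> (inv \<xi> \<otimes> x) = x"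
      using x by (simp_all add: left_mult_cancel)
    have "family_trans V \<xi> F x = \<zero>\<^bsub>mer_stalk V x\<^esub>"
      using germ_hom_zero[OF germ_trans_hom[OF \<xi>\<Gamma>(2) y(1)] y(1)] x Fz[OF y(1) zero[OF \<xi>]] y(2)
      by (simp add: family_trans_def)
    moreover have "A \<xi> x \<in> carrier (mer_stalk V x)"
      using families_in[OF skew.skew_coeff[OF _ \<xi>\<Gamma>(1)] x] A' by (simp add: skew.skew_ring_carrier)
    ultimately show ?thesis by simp
  qed
  then have "(\<Oplus>\<^bsub>mer_stalk V x\<^esub>\<xi>\<in>skew_support V \<Gamma> A. A \<xi> x \<otimes>\<^bsub>mer_stalk V x\<^esub> family_trans V \<xi> F x)
      = (\<Oplus>\<^bsub>mer_stalk V x\<^esub>\<xi>\<in>skew_support V \<Gamma> A. \<zero>\<^bsub>mer_stalk V x\<^esub>)"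
    by (intro R.finsum_cong') auto
  then have "skew_act V \<Gamma> A F x = \<zero>\<^bsub>mer_stalk V x\<^esub>"
    using x by (simp add: skew_act_def)
  then have "proj (skew_act V \<Gamma> A F) x = E_zero x"
    using x by (simp add: proj_at E_class_zero)
  then show ?thesis
    using M_act_proj[OF A F(1)] F(2) by simp
qed

lemma Mstar_right_module: "right_module (skew_ring V \<Gamma>) \<A> Mst (Mstar_act V G act \<Gamma> W)"
proof -
  let ?\<mu> = "M_act V G act \<Gamma> W" and ?\<nu> = "Mstar_act V G act \<Gamma> W" and ?S = "skew_ring V \<Gamma>"
  have bil: "bilinear_action ?S \<A> MM ?\<mu>"
    and comp: "\<And>A B m. A \<in> \<A> \<Longrightarrow> B \<in> \<A> \<Longrightarrow> m \<in> carrier MM \<Longrightarrow> ?\<mu> (A \<otimes>\<^bsub>?S\<^esub> B) m = ?\<mu> A (?\<mu> B m)"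
    using M_left_module by (auto simp: left_module_def)
  note closed = bil[unfolded bilinear_action_def, THEN conjunct1, rule_format]
  interpret M: abelian_group MM
    by (rule complex_moduleD(1)[OF M_space_module])
  have smult_closed: "c \<odot>\<^bsub>MM\<^esub> m \<in> carrier MM" if "m \<in> carrier MM" for c m
    by (rule complex_moduleD(2)[OF M_space_module that])
  have at: "?\<nu> A \<alpha> m = \<alpha> (?\<mu> A m)" if "m \<in> carrier MM" for A \<alpha> m
    using that by (simp add: Mstar_act_def)
  have ext_\<nu>: "?\<nu> A \<alpha> \<in> extensional (carrier MM)" for A \<alpha>
    by (simp add: Mstar_act_def)
  have dual: "\<alpha> \<in> linear_dual MM" if "\<alpha> \<in> carrier Mst" for \<alpha>
    using that by (simp add: Mstar_carrier)
  have in_MS: "?\<nu> A \<alpha> \<in> carrier Mst" if A: "A \<in> \<A>" and \<alpha>: "\<alpha> \<in> carrier Mst" for A \<alpha>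
  proof -
    obtain K where K: "vanishing_on K \<alpha>"
      using \<alpha> unfolding Mstar_carrier by blast
    let ?K = "(\<lambda>(\<xi>, x). inv \<xi> \<otimes> x) ` (skew_support V \<Gamma> A \<times> K)"
    have "?\<nu> A \<alpha> \<in> linear_dual MM"
      using bil A closed linear_dualD[OF dual[OF \<alpha>]]
      by (simp add: linear_dual_def ext_\<nu> at smult_closed bilinear_action_def)
    moreover have "vanishing_on ?K (?\<nu> A \<alpha>)"
      unfolding vanishing_on_def
    proof (intro conjI ballI impI)
      show "finite ?K"
        using K \<A>_skew[OF A] by (simp add: vanishing_on_def skew.skew_ring_carrier)
      show "?K \<subseteq> carrier V"
        using K skew.skew_support_subset skew.\<Gamma>_carrier by (auto simp: vanishing_on_def subset_iff)
      fix m assume m: "m \<in> carrier MM" and zero: "\<forall>x\<in>?K. m x = E_zero x"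
      have "?\<mu> A m x = E_zero x" if "x \<in> K" for x
      proof (rule M_act_vanishing[OF A m])
        show "x \<in> carrier V"
          using that K by (auto simp: vanishing_on_def)
        show "m (inv \<xi> \<otimes> x) = E_zero (inv \<xi> \<otimes> x)" if "\<xi> \<in> skew_support V \<Gamma> A" for \<xi>
          by (rule bspec[OF zero], rule image_eqI[of _ _ "(\<xi>, x)"]) (simp_all add: that \<open>x \<in> K\<close>)
      qed
      then show "?\<nu> A \<alpha> m = 0"
        using K closed[OF A m] by (simp add: at[OF m] vanishing_on_def)
    qed
    ultimately show ?thesis
      unfolding Mstar_carrier by blast
  qed
  note eqI = extensionalityI[of _ "carrier MM"]
  have "bilinear_action ?S \<A> Mst ?\<nu>"
    unfolding bilinear_action_def
  proof (intro conjI ballI allI impI)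
    fix \<alpha> assume \<alpha>: "\<alpha> \<in> carrier Mst"
    note lin = linear_dualD[OF dual[OF \<alpha>]]
    show "?\<nu> \<one>\<^bsub>?S\<^esub> \<alpha> = \<alpha>" if "\<one>\<^bsub>?S\<^esub> \<in> \<A>"
      using bil that lin(3) by (intro eqI[OF ext_\<nu>]) (simp_all add: at bilinear_action_def)
    fix A assume A: "A \<in> \<A>"
    show "?\<nu> A \<alpha> \<in> carrier Mst"
      by (rule in_MS[OF A \<alpha>])
    fix c
    show "?\<nu> A (c \<odot>\<^bsub>Mst\<^esub> \<alpha>) = c \<odot>\<^bsub>Mst\<^esub> ?\<nu> A \<alpha>"
      using closed[OF A] by (intro eqI[OF ext_\<nu>]) (simp_all add: at Mstar_ops)
    show "?\<nu> (c \<odot>\<^bsub>?S\<^esub> A) \<alpha> = c \<odot>\<^bsub>Mst\<^esub> ?\<nu> A \<alpha>"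
      using bil A closed[OF A] lin(2) by (intro eqI[OF ext_\<nu>]) (simp_all add: at Mstar_ops bilinear_action_def)
    fix \<beta>
    show "?\<nu> A (\<alpha> \<oplus>\<^bsub>Mst\<^esub> \<beta>) = ?\<nu> A \<alpha> \<oplus>\<^bsub>Mst\<^esub> ?\<nu> A \<beta>"
      using closed[OF A] by (intro eqI[OF ext_\<nu>]) (simp_all add: at Mstar_ops)
    fix B assume B: "B \<in> \<A>"
    show "?\<nu> (A \<oplus>\<^bsub>?S\<^esub> B) \<alpha> = ?\<nu> A \<alpha> \<oplus>\<^bsub>Mst\<^esub> ?\<nu> B \<alpha>"
      using bil A B closed[OF A] closed[OF B] lin(1)
      by (intro eqI[OF ext_\<nu>]) (simp_all add: at Mstar_ops bilinear_action_def)
  qed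
  moreover have "?\<nu> (A \<otimes>\<^bsub>?S\<^esub> B) \<alpha> = ?\<nu> B (?\<nu> A \<alpha>)" if "A \<in> \<A>" "B \<in> \<A>" for A B \<alpha>
    using comp[OF that] closed[OF that(2)] by (intro eqI[OF ext_\<nu> ext_\<nu>]) (simp add: at)
  ultimately show ?thesis
    using Mstar_module by (simp add: right_module_def)
qed

end

lemma sheaf_group_of_category:
  "complex_lie_group V \<or> linear_algebraic_group V \<Longrightarrow> sheaf_group V"
  using complex_lie_group_sheaf_group linear_algebraic_group_sheaf_group by blast

lemma sheaf_group_actionI:
  assumes V: "sheaf_group V" and G: "group G" "finite (carrier G)"
    and act: "act \<in> hom G (AutoGroup V)" and morph: "\<forall>g\<in>carrier G. morphism V (act g)"
  shows "sheaf_group_action V G act"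
proof -
  interpret V: sheaf_group V by (rule V)
  interpret h: group_hom G "AutoGroup V" act
    using G(1) act V.AutoGroup by (simp add: group_hom_def group_hom_axioms_def)
  have auto: "act g \<in> hom V V" "act g \<in> Bij (carrier V)" if "g \<in> carrier G" for g
    using h.hom_closed[OF that] by (simp_all add: AutoGroup_def auto_def)
  show ?thesis
  proof (intro sheaf_group_action.intro sheaf_group_action_axioms.intro V G)
    fix g x y assume g: "g \<in> carrier G" and x: "x \<in> carrier V" and y: "y \<in> carrier V"
    show "act g (x \<otimes>\<^bsub>V\<^esub> y) = act g x \<otimes>\<^bsub>V\<^esub> act g y"
      by (rule hom_mult[OF auto(1)[OF g] x y])
  next
    fix g x assume "g \<in> carrier G" "x \<in> carrier V"
    then show "act g x \<in> carrier V"
      using auto(1) by (auto simp: hom_def)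
  next
    fix x assume "x \<in> carrier V"
    then show "act \<one>\<^bsub>G\<^esub> x = x"
      using h.hom_one by (simp add: AutoGroup_def BijGroup_def)
  next
    fix g h x assume g: "g \<in> carrier G" and h: "h \<in> carrier G" and x: "x \<in> carrier V"
    have "act (g \<otimes>\<^bsub>G\<^esub> h) = compose (carrier V) (act g) (act h)"
      using h.hom_mult[OF g h] auto(2)[OF g] auto(2)[OF h] by (simp add: AutoGroup_def BijGroup_def)
    then show "act g (act h x) = act (g \<otimes>\<^bsub>G\<^esub> h) x"
      using x by (simp add: compose_eq)
  qed (use morph in auto)
qed

theorem corollary6:
  fixes V :: "('v, 'z) sgroup_scheme"
    and G :: "('g, 'y) monoid_scheme"
    and act :: "'g \<Rightarrow> 'v \<Rightarrow> 'v"
    and \<Gamma> W :: "'v set"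
    and v :: 'v
    and \<A> :: "('v \<Rightarrow> 'v \<Rightarrow> 'v mgerm) set"
  assumes "complex_lie_group V \<or> linear_algebraic_group V"
    and "group G" and "finite (carrier G)"
    and "act \<in> hom G (AutoGroup V)" and "\<forall>g\<in>carrier G. morphism V (act g)"
    and "subgroup \<Gamma> V" and "\<forall>g\<in>carrier G. act g ` \<Gamma> \<subseteq> \<Gamma>"
    and "v \<in> carrier V"
    and "W = {act g (\<xi> \<otimes>\<^bsub>V\<^esub> v) | g \<xi>. g \<in> carrier G \<and> \<xi> \<in> \<Gamma>}"
    and "is_subalgebra (skew_ring V \<Gamma>) \<A>"
    and "\<forall>A\<in>\<A>. \<forall>F\<in>carrier (inv_germs_on V G act W).
           skew_act V \<Gamma> A F \<in> carrier (inv_germs_on V G act W)"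
  shows "(\<forall>A\<in>\<A>. \<forall>F\<in>carrier (inv_germs_on V G act W).
            M_act V G act \<Gamma> W A (M_proj V G act F) = M_proj V G act (skew_act V \<Gamma> A F)) \<and>
         left_module (skew_ring V \<Gamma>) \<A> (M_space V G act W) (M_act V G act \<Gamma> W) \<and>
         right_module (skew_ring V \<Gamma>) \<A> (Mstar_space V G act W) (Mstar_act V G act \<Gamma> W)"
proof -
  have SGA: "sheaf_group_action V G act"
    by (rule sheaf_group_actionI[OF sheaf_group_of_category[OF assms(1)] assms(2-5)])
  interpret sheaf_group_action V G act
    by (rule SGA)
  have \<Gamma>: "\<xi> \<in> carrier V" if "\<xi> \<in> \<Gamma>" for \<xi>
    using that subgroup.subset[OF assms(6)] by blast
  interpret skew_setting V G act W \<Gamma> \<A>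
  proof (intro skew_setting.intro invariant_set.intro invariant_set_axioms.intro skew_setting_axioms.intro SGA)
    show "W \<subseteq> carrier V"
      using \<Gamma> assms(8) by (auto simp: assms(9) act_closed)
    fix h x assume h: "h \<in> carrier G" and "x \<in> W"
    then obtain g \<xi> where x: "x = act g (\<xi> \<otimes>\<^bsub>V\<^esub> v)" "g \<in> carrier G" "\<xi> \<in> \<Gamma>"
      by (auto simp: assms(9))
    have "act h x = act (h \<otimes>\<^bsub>G\<^esub> g) (\<xi> \<otimes>\<^bsub>V\<^esub> v)"
      unfolding x(1) using h x(2,3) \<Gamma> assms(8) by (intro act_act) auto
    then show "act h x \<in> W"
      using h x(2,3) unfolding assms(9) by blast
  qed (use assms(6,10,11) in auto)
  show ?thesis
    using M_act_proj M_left_module Mstar_right_module by (simp add: inv_germs_on_carrier)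
qed

end
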